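(* For any $\lambda,\Omega,\omega>0$ there exists a time $t$ with $0\le t\le\pi/\omega$ such that, in operator norm on $\mathbb{C}^2\otimes L^2(\mathbb{R})$, $$\|e^{-itH}-e^{-itH_{\mathrm{RWA}}}\|\ge\frac16.$$
   Context: On Schwartz space $\mathscr{S}(\mathbb{R})\subset L^2(\mathbb{R})$ let $a=\frac{1}{\sqrt2}(x+\frac{d}{dx})$ and $a^\dagger=\frac{1}{\sqrt2}(x-\frac{d}{dx})$, so $[a,a^\dagger]=I$. Let $$\sigma_x=\begin{pmatrix}0&1\\1&0\end{pmatrix},\quad \sigma_z=\begin{pmatrix}1&0\\0&-1\end{pmatrix},\quad \sigma_+=\begin{pmatrix}0&1\\0&0\end{pmatrix},\quad \sigma_-=\begin{pmatrix}0&0\\1&0\end{pmatrix}.$$ On $\mathbb{C}^2\otimes\mathscr{S}(\mathbb{R})$ (algebraic tensor product, a subspace of the Hilbert space $\mathbb{C}^2\otimes L^2(\mathbb{R})$) define $$H=\tfrac{\Omega}{2}\sigma_z\otimes I+I\otimes\omega a^\dagger a+\lambda\,\sigma_x\otimes(a+a^\dagger),$$ $$H_{\mathrm{RWA}}=\tfrac{\Omega}{2}\sigma_z\otimes I+I\otimes\omega a^\dagger a+\lambda(\sigma_+\otimes a+\sigma_-\otimes a^\dagger).$$ The same symbols denote the closures, which are self-adjoint ($\mathbb{C}^2\otimes\mathscr{S}(\mathbb{R})$ is a core). *)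

theory Defs
  imports "HOL-Analysis.Analysis"
begin

definition square_integrable :: "(real \<Rightarrow> complex) \<Rightarrow> bool" where
  "square_integrable f \<longleftrightarrow>
     f \<in> borel_measurable lborel \<and> integrable lborel (\<lambda>x. (norm (f x))\<^sup>2)"

definition l2_rel :: "(real \<Rightarrow> complex) \<Rightarrow> (real \<Rightarrow> complex) \<Rightarrow> bool" where
  "l2_rel f g \<longleftrightarrow>
     square_integrable f \<and> square_integrable g \<and> (AE x in lborel. f x = g x)"

lemma square_integrable_add:
  assumes "square_integrable f" "square_integrable g"
  shows "square_integrable (\<lambda>x. f x + g x)"
  unfolding square_integrable_def
proof (intro conjI)
  show m: "(\<lambda>x. f x + g x) \<in> borel_measurable lborel"
    using assms unfolding square_integrable_def by (intro borel_measurable_add) auto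
  have "integrable lborel (\<lambda>x. 2 * (norm (f x))\<^sup>2 + 2 * (norm (g x))\<^sup>2)"
    using assms unfolding square_integrable_def by auto
  then show "integrable lborel (\<lambda>x. (norm (f x + g x))\<^sup>2)"
  proof (rule Bochner_Integration.integrable_bound)
    show "(\<lambda>x. (norm (f x + g x))\<^sup>2) \<in> borel_measurable lborel"
      using m by measurable
    have "(norm (a + b))\<^sup>2 \<le> 2 * (norm a)\<^sup>2 + 2 * (norm b)\<^sup>2" for a b :: complex
    proof -
      have "(norm (a + b))\<^sup>2 \<le> (norm a + norm b)\<^sup>2"
        by (intro power_mono norm_triangle_ineq) auto
      also have "\<dots> \<le> 2 * (norm a)\<^sup>2 + 2 * (norm b)\<^sup>2"
        using sum_squares_bound[of "norm a" "norm b"] by (simp add: power2_sum)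
      finally show ?thesis .
    qed
    then show "AE x in lborel. norm ((norm (f x + g x))\<^sup>2)
        \<le> norm (2 * (norm (f x))\<^sup>2 + 2 * (norm (g x))\<^sup>2)"
      by auto
  qed
qed

lemma square_integrable_cmult:
  assumes "square_integrable f"
  shows "square_integrable (\<lambda>x. c * f x)"
  using assms unfolding square_integrable_def by (auto simp: norm_mult power_mult_distrib)

lemma square_integrable_scaleR:
  assumes "square_integrable f"
  shows "square_integrable (\<lambda>x. r *\<^sub>R f x)"
  using square_integrable_cmult[OF assms, of "of_real r"] by (simp add: scaleR_conv_of_real)

lemma square_integrable_uminus:
  assumes "square_integrable f"
  shows "square_integrable (\<lambda>x. - f x)"
  using square_integrable_cmult[OF assms, of "- 1"] by simp

lemma square_integrable_diff:
  assumes "square_integrable f" "square_integrable g"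
  shows "square_integrable (\<lambda>x. f x - g x)"
  using square_integrable_add[OF assms(1) square_integrable_uminus[OF assms(2)]] by simp

lemma square_integrable_zero: "square_integrable (\<lambda>x. 0)"
  by (simp add: square_integrable_def)

lemma integrable_inner_square_integrable:
  assumes "square_integrable f" "square_integrable g"
  shows "integrable lborel (\<lambda>x. f x \<bullet> g x)"
proof -
  have "integrable lborel (\<lambda>x. (norm (f x))\<^sup>2 + (norm (g x))\<^sup>2)"
    using assms unfolding square_integrable_def by auto
  then show ?thesis
  proof (rule Bochner_Integration.integrable_bound)
    show "(\<lambda>x. f x \<bullet> g x) \<in> borel_measurable lborel"
      using assms unfolding square_integrable_def by (intro borel_measurable_inner) auto
    have "\<bar>a \<bullet> b\<bar> \<le> (norm a)\<^sup>2 + (norm b)\<^sup>2" for a b :: complex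
    proof -
      have "\<bar>a \<bullet> b\<bar> \<le> norm a * norm b" by (rule Cauchy_Schwarz_ineq2)
      moreover have "2 * (norm a * norm b) \<le> (norm a)\<^sup>2 + (norm b)\<^sup>2"
        using sum_squares_bound[of "norm a" "norm b"] by simp
      moreover have "0 \<le> norm a * norm b" by simp
      ultimately show ?thesis by linarith
    qed
    then show "AE x in lborel. norm (f x \<bullet> g x) \<le> norm ((norm (f x))\<^sup>2 + (norm (g x))\<^sup>2)"
      by auto
  qed
qed

lemma l2_rel_part_equivp: "part_equivp l2_rel"
proof (rule part_equivpI)
  show "\<exists>f. l2_rel f f"
    using square_integrable_zero by (auto simp: l2_rel_def)
  show "symp l2_rel"
    by (auto simp: symp_def l2_rel_def eq_commute)
  show "transp l2_rel"
    by (auto simp: transp_def l2_rel_def elim: AE_mp)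
qed

quotient_type l2 = "real \<Rightarrow> complex" / partial: l2_rel
  by (rule l2_rel_part_equivp)

instantiation l2 :: real_vector
begin

lift_definition zero_l2 :: l2 is "\<lambda>x. 0"
  by (simp add: l2_rel_def square_integrable_zero)

lift_definition plus_l2 :: "l2 \<Rightarrow> l2 \<Rightarrow> l2" is "\<lambda>f g x. f x + g x"
  by (auto simp: l2_rel_def square_integrable_add)

lift_definition minus_l2 :: "l2 \<Rightarrow> l2 \<Rightarrow> l2" is "\<lambda>f g x. f x - g x"
  by (auto simp: l2_rel_def square_integrable_diff)

lift_definition uminus_l2 :: "l2 \<Rightarrow> l2" is "\<lambda>f x. - f x"
  by (auto simp: l2_rel_def square_integrable_uminus)

lift_definition scaleR_l2 :: "real \<Rightarrow> l2 \<Rightarrow> l2" is "\<lambda>r f x. r *\<^sub>R f x"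
  by (auto simp: l2_rel_def square_integrable_scaleR)

instance
  by standard
    (transfer, auto simp: l2_rel_def algebra_simps square_integrable_add square_integrable_zero
       square_integrable_scaleR square_integrable_uminus square_integrable_diff)+

end

instantiation l2 :: real_inner
begin

text \<open>The real inner product is the real part of the usual complex one.\<close>

lift_definition inner_l2 :: "l2 \<Rightarrow> l2 \<Rightarrow> real" is "\<lambda>f g. LINT x|lborel. f x \<bullet> g x"
proof -
  fix f f' g g' assume *: "l2_rel f f'" "l2_rel g g'"
  show "(LINT x|lborel. f x \<bullet> g x) = (LINT x|lborel. f' x \<bullet> g' x)"
  proof (rule integral_cong_AE)
    show "(\<lambda>x. f x \<bullet> g x) \<in> borel_measurable lborel" "(\<lambda>x. f' x \<bullet> g' x) \<in> borel_measurable lborel"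
      using * integrable_inner_square_integrable by (auto simp: l2_rel_def intro: borel_measurable_integrable)
    show "AE x in lborel. f x \<bullet> g x = f' x \<bullet> g' x"
      using * by (auto simp: l2_rel_def)
  qed
qed

definition norm_l2 :: "l2 \<Rightarrow> real" where "norm_l2 u = sqrt (u \<bullet> u)"
definition dist_l2 :: "l2 \<Rightarrow> l2 \<Rightarrow> real" where "dist_l2 u v = norm (u - v)"
definition sgn_l2 :: "l2 \<Rightarrow> l2" where "sgn_l2 u = u /\<^sub>R norm u"
definition uniformity_l2 :: "(l2 \<times> l2) filter" where
  "uniformity_l2 = (INF e\<in>{0<..}. principal {(u, v). dist u v < e})"
definition open_l2 :: "l2 set \<Rightarrow> bool" where
  "open_l2 S \<longleftrightarrow> (\<forall>u\<in>S. eventually (\<lambda>(u', v). u' = u \<longrightarrow> v \<in> S) uniformity)"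

instance
proof
  fix u v w :: l2 and r :: real and S :: "l2 set"
  show "dist u v = norm (u - v)" by (rule dist_l2_def)
  show "sgn u = u /\<^sub>R norm u" by (rule sgn_l2_def)
  show "uniformity = (INF e\<in>{0<..}. principal {(u :: l2, v). dist u v < e})"
    by (rule uniformity_l2_def)
  show "open S \<longleftrightarrow> (\<forall>u\<in>S. eventually (\<lambda>(u', v). u' = u \<longrightarrow> v \<in> S) uniformity)"
    by (rule open_l2_def)
  show "u \<bullet> v = v \<bullet> u"
    by transfer (simp add: inner_commute)
  show "(u + v) \<bullet> w = u \<bullet> w + v \<bullet> w"
    by transfer (simp add: l2_rel_def inner_add_left integrable_inner_square_integrable)
  show "(r *\<^sub>R u) \<bullet> v = r * (u \<bullet> v)"
    by transfer simp
  show "0 \<le> u \<bullet> u"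
    by transfer simp
  show "u \<bullet> u = 0 \<longleftrightarrow> u = 0"
  proof transfer
    fix f assume "l2_rel f f"
    then have f: "square_integrable f" by (simp add: l2_rel_def)
    have "(LINT x|lborel. f x \<bullet> f x) = 0 \<longleftrightarrow> (AE x in lborel. f x \<bullet> f x = 0)"
      by (rule integral_nonneg_eq_0_iff_AE)
        (auto intro: integrable_inner_square_integrable f)
    then show "(LINT x|lborel. f x \<bullet> f x) = 0 \<longleftrightarrow> l2_rel f (\<lambda>x. 0)"
      using f by (simp add: l2_rel_def square_integrable_zero)
  qed
  show "norm u = sqrt (u \<bullet> u)" by (rule norm_l2_def)
qed

end

lift_definition scaleC_l2 :: "complex \<Rightarrow> l2 \<Rightarrow> l2" is "\<lambda>c f x. c * f x"
  by (auto simp: l2_rel_def square_integrable_cmult)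

definition ddx :: "(real \<Rightarrow> complex) \<Rightarrow> real \<Rightarrow> complex" where
  "ddx f = (\<lambda>x. vector_derivative f (at x))"

definition schwartz :: "(real \<Rightarrow> complex) set" where
  "schwartz = {f. (\<forall>m x. (ddx ^^ m) f differentiable (at x)) \<and>
                  (\<forall>k m. bounded (range (\<lambda>x. of_real (x ^ k) * (ddx ^^ m) f x)))}"

definition ann :: "(real \<Rightarrow> complex) \<Rightarrow> real \<Rightarrow> complex" where
  "ann f = (\<lambda>x. of_real (1 / sqrt 2) * (of_real x * f x + ddx f x))"

definition cre :: "(real \<Rightarrow> complex) \<Rightarrow> real \<Rightarrow> complex" where
  "cre f = (\<lambda>x. of_real (1 / sqrt 2) * (of_real x * f x - ddx f x))"

definition sigma_x :: "complex^2^2" where "sigma_x = vector [vector [0, 1], vector [1, 0]]"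
definition sigma_z :: "complex^2^2" where "sigma_z = vector [vector [1, 0], vector [0, - 1]]"
definition sigma_plus :: "complex^2^2" where "sigma_plus = vector [vector [0, 1], vector [0, 0]]"
definition sigma_minus :: "complex^2^2" where "sigma_minus = vector [vector [0, 0], vector [1, 0]]"

text \<open>A tensor product of complex two-space with a space \<open>V\<close> is represented by pairs of
  vectors of \<open>V\<close> (the coefficients of the two standard basis vectors).  Accordingly the Hilbert
  space is the type \<open>l2^2\<close>, with the library norm, and \<open>schwartz2\<close> is the algebraic tensor
  product with Schwartz space.\<close>

definition schwartz2 :: "((real \<Rightarrow> complex)^2) set" where
  "schwartz2 = {\<psi>. \<forall>i. \<psi> $ i \<in> schwartz}"

definition tensor_op ::
  "complex^2^2 \<Rightarrow> ((real \<Rightarrow> complex) \<Rightarrow> real \<Rightarrow> complex) \<Rightarrow> (real \<Rightarrow> complex)^2 \<Rightarrow> (real \<Rightarrow> complex)^2"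
  where "tensor_op M A \<psi> = (\<chi> i. (\<lambda>x. \<Sum>j\<in>UNIV. M $ i $ j * A (\<psi> $ j) x))"

definition H_fun ::
  "real \<Rightarrow> real \<Rightarrow> real \<Rightarrow> (real \<Rightarrow> complex)^2 \<Rightarrow> (real \<Rightarrow> complex)^2" where
  "H_fun \<Omega> \<omega> lam \<psi> = (\<chi> i. (\<lambda>x.
     of_real (\<Omega> / 2) * (tensor_op sigma_z id \<psi> $ i) x
     + (tensor_op (mat 1) (\<lambda>f y. of_real \<omega> * cre (ann f) y) \<psi> $ i) x
     + of_real lam * (tensor_op sigma_x (\<lambda>f y. ann f y + cre f y) \<psi> $ i) x))"

definition H_RWA_fun ::
  "real \<Rightarrow> real \<Rightarrow> real \<Rightarrow> (real \<Rightarrow> complex)^2 \<Rightarrow> (real \<Rightarrow> complex)^2" where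
  "H_RWA_fun \<Omega> \<omega> lam \<psi> = (\<chi> i. (\<lambda>x.
     of_real (\<Omega> / 2) * (tensor_op sigma_z id \<psi> $ i) x
     + (tensor_op (mat 1) (\<lambda>f y. of_real \<omega> * cre (ann f) y) \<psi> $ i) x
     + of_real lam * ((tensor_op sigma_plus ann \<psi> $ i) x + (tensor_op sigma_minus cre \<psi> $ i) x)))"

definition to_l2 :: "(real \<Rightarrow> complex)^2 \<Rightarrow> l2^2" where
  "to_l2 \<psi> = (\<chi> i. abs_l2 (\<psi> $ i))"

definition scaleC_l22 :: "complex \<Rightarrow> l2^2 \<Rightarrow> l2^2" where
  "scaleC_l22 c \<psi> = (\<chi> i. scaleC_l2 c (\<psi> $ i))"

text \<open>An unbounded operator is identified with its graph, so the closure of an operator is the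
  topological closure of its graph.\<close>

definition schwartz_graph :: "((real \<Rightarrow> complex)^2 \<Rightarrow> (real \<Rightarrow> complex)^2) \<Rightarrow> ((l2^2) \<times> (l2^2)) set" where
  "schwartz_graph A = (\<lambda>\<psi>. (to_l2 \<psi>, to_l2 (A \<psi>))) ` schwartz2"

definition H_Rabi :: "real \<Rightarrow> real \<Rightarrow> real \<Rightarrow> ((l2^2) \<times> (l2^2)) set" where
  "H_Rabi \<Omega> \<omega> lam = closure (schwartz_graph (H_fun \<Omega> \<omega> lam))"

definition H_RWA :: "real \<Rightarrow> real \<Rightarrow> real \<Rightarrow> ((l2^2) \<times> (l2^2)) set" where
  "H_RWA \<Omega> \<omega> lam = closure (schwartz_graph (H_RWA_fun \<Omega> \<omega> lam))"

definition unitary :: "(l2^2 \<Rightarrow> l2^2) \<Rightarrow> bool" where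
  "unitary V \<longleftrightarrow>
     (\<forall>\<phi> \<psi>. V (\<phi> + \<psi>) = V \<phi> + V \<psi>) \<and>
     (\<forall>c \<psi>. V (scaleC_l22 c \<psi>) = scaleC_l22 c (V \<psi>)) \<and>
     (\<forall>\<psi>. norm (V \<psi>) = norm \<psi>) \<and> surj V"

text \<open>The strongly continuous unitary group whose infinitesimal generator is exactly
  \<open>-iA\<close>, domain included.  For self-adjoint \<open>A\<close> there is one and only one such group
  (Stone's theorem), namely \<open>exp (-itA)\<close>.\<close>

definition unitary_group_of :: "((l2^2) \<times> (l2^2)) set \<Rightarrow> (real \<Rightarrow> l2^2 \<Rightarrow> l2^2) \<Rightarrow> bool" where
  "unitary_group_of A U \<longleftrightarrow>
     (\<forall>t. unitary (U t)) \<and>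
     U 0 = id \<and> (\<forall>s t. U (s + t) = U s \<circ> U t) \<and>
     (\<forall>\<psi>. continuous_on UNIV (\<lambda>t. U t \<psi>)) \<and>
     (\<forall>\<psi> \<phi>. (\<psi>, \<phi>) \<in> A \<longleftrightarrow>
        ((\<lambda>t. U t \<psi>) has_vector_derivative scaleC_l22 (- \<i>) \<phi>) (at 0))"

definition exp_mi :: "real \<Rightarrow> ((l2^2) \<times> (l2^2)) set \<Rightarrow> l2^2 \<Rightarrow> l2^2" where
  "exp_mi t A = (THE U. unitary_group_of A U) t"

end

theory Submission
  imports Defs "HOL-Probability.Probability"
begin

text \<open>
  Take the two-component wave packet with entries \<open>f\<close> and \<open>- \<i> f\<close>, where
  \<open>f x = exp (\<i> R x - c x\<^sup>2)\<close>.  The momentum boost turns \<open>a\<close> into \<open>a + \<i> R / sqrt 2\<close>, so the terms of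
  order \<open>R\<close> in \<open>a + a\<^sup>\<dagger>\<close> cancel, whereas those in \<open>\<sigma>\<^sub>+ a + \<sigma>\<^sub>- a\<^sup>\<dagger>\<close> act on the spin as a matrix of which
  \<open>(1, - \<i>)\<close> is an eigenvector.  Hence the packet is an approximate eigenvector of both Hamiltonians,
  with eigenvalues that differ by \<open>\<lambda> R / sqrt 2\<close> and with residuals \<open>O(1) + 2 \<omega> c R \<parallel>x f\<parallel>\<close>.  At time
  \<open>pi sqrt 2 / (\<lambda> R)\<close> the two phases are opposite, while the accumulated errors are small if \<open>c\<close> is small
  and \<open>R\<close> is large.

  The unitary groups have to be shown to exist.  The rotating wave Hamiltonian is diagonal in an
  orthonormal basis built from Hermite functions by two-by-two blocks.  For the Rabi Hamiltonian the
  part without \<open>\<Omega>\<close> is a displaced oscillator in each eigenspace of \<open>\<sigma>\<^sub>x\<close>, hence diagonal as well, and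
  \<open>\<Omega> / 2 \<sigma>\<^sub>z\<close> is a bounded perturbation, treated by a Dyson series in the interaction picture.
\<close>

section \<open>The Hilbert space\<close>

text \<open>The coupling may be far smaller than \<omega>, while the time is limited to
  \<open>pi / \<omega>\<close>, so the spectral gap has to come from the state: \<lambda> R is as
  large as desired. The obstacle is that the oscillator term produces a residual
  \<open>2 * \<omega> * c * R * x\<close> growing at the same rate in R, so a large R alone gains
  nothing. The Gaussian has \<open>\<parallel>x f\<parallel> = \<parallel>f\<parallel> / (2 * sqrt
  c)\<close>, which makes this residual
  \<open>\<omega> * sqrt c * R * \<parallel>f\<parallel>\<close>. It loses against the gap once
  \<open>sqrt c\<close> is small compared with \<lambda> / \<omega>. The width is therefore fixed
  before R; a wide packet has large moments, but they do not depend on R. The propagators are given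
  by a definite description, so uniqueness of the groups is needed along with existence, and the
  generator has to be the closure of the Schwartz graph exactly, domain included. The coupling is
  unbounded and cannot be perturbed in, so it stays inside the exactly solved part of both
  Hamiltonians.\<close>

lemma l2_rel_refl [simp]: "l2_rel f f \<longleftrightarrow> square_integrable f"
  by (auto simp: l2_rel_def)

lemma abs_l2_plus: "square_integrable f \<Longrightarrow> square_integrable g \<Longrightarrow> abs_l2 f + abs_l2 g = abs_l2 (\<lambda>x. f x + g x)"
  by (rule plus_l2.abs_eq) auto
lemma abs_l2_minus: "square_integrable f \<Longrightarrow> square_integrable g \<Longrightarrow> abs_l2 f - abs_l2 g = abs_l2 (\<lambda>x. f x - g x)"
  by (rule minus_l2.abs_eq) auto
lemma abs_l2_scaleC: "square_integrable f \<Longrightarrow> scaleC_l2 c (abs_l2 f) = abs_l2 (\<lambda>x. c * f x)"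
  by (rule scaleC_l2.abs_eq) auto
lemma abs_l2_inner: "square_integrable f \<Longrightarrow> square_integrable g \<Longrightarrow> abs_l2 f \<bullet> abs_l2 g = (LINT x|lborel. f x \<bullet> g x)"
  by (rule inner_l2.abs_eq) auto

lemma abs_l2_cases:
  obtains f where "square_integrable f" "u = abs_l2 f"
  using that by (induct u rule: l2.abs_induct) auto

lemma norm_abs_l2: "square_integrable f \<Longrightarrow> norm (abs_l2 f) = sqrt (LINT x|lborel. (norm (f x))\<^sup>2)"
  by (simp add: norm_l2_def abs_l2_inner power2_norm_eq_inner)

lemma abs_l2_eq_iff: "square_integrable f \<Longrightarrow> square_integrable g \<Longrightarrow> abs_l2 f = abs_l2 g \<longleftrightarrow> (AE x in lborel. f x = g x)"
  using Quotient_rel[OF Quotient_l2, of f g] by (auto simp: l2_rel_def)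

lemma scaleC_l2_add_right: "scaleC_l2 c (u + v) = scaleC_l2 c u + scaleC_l2 c v"
  by transfer (auto simp: l2_rel_def algebra_simps square_integrable_add square_integrable_cmult)
lemma scaleC_l2_add_left: "scaleC_l2 (c + d) u = scaleC_l2 c u + scaleC_l2 d u"
  by transfer (auto simp: l2_rel_def algebra_simps square_integrable_add square_integrable_cmult)
lemma scaleC_l2_mult: "scaleC_l2 (c * d) u = scaleC_l2 c (scaleC_l2 d u)"
  by transfer (auto simp: l2_rel_def algebra_simps square_integrable_add square_integrable_cmult)
lemma scaleC_l2_of_real: "scaleC_l2 (of_real r) u = r *\<^sub>R u"
  by transfer (auto simp: l2_rel_def scaleR_conv_of_real square_integrable_cmult)
lemma scaleC_l2_inner: "scaleC_l2 c u \<bullet> v = u \<bullet> scaleC_l2 (cnj c) v"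
  by transfer (auto intro!: Bochner_Integration.integral_cong simp: inner_complex_def algebra_simps)

section \<open>Completeness of the space of square integrable classes (Riesz-Fischer)\<close>

lemma dist_abs_l2: "square_integrable f \<Longrightarrow> square_integrable g \<Longrightarrow>
   dist (abs_l2 f) (abs_l2 g) = sqrt (LINT x|lborel. (norm (f x - g x))\<^sup>2)"
  by (simp add: dist_norm abs_l2_minus norm_abs_l2 square_integrable_diff)

lemma nn_integral_l2:
  assumes "square_integrable f" "square_integrable g"
  shows "(\<integral>\<^sup>+x. ennreal ((norm (f x - g x))\<^sup>2) \<partial>lborel) = ennreal ((dist (abs_l2 f) (abs_l2 g))\<^sup>2)"
  using square_integrable_diff[OF assms]
  by (subst nn_integral_eq_integral) (simp_all add: dist_abs_l2[OF assms] square_integrable_def)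

text \<open>Squared distances decay like \<open>(1/4)^n\<close>, so weights \<open>2^n\<close> still
  leave a convergent series of integrals. Finiteness of the weighted series at almost every point
  bounds the increments there by a convergent geometric sequence.\<close>

lemma AE_Cauchy_l2:
  assumes f: "\<And>n. square_integrable (f n)"
    and d: "\<And>n. dist (abs_l2 (f n)) (abs_l2 (f (Suc n))) \<le> (1/2)^n"
  shows "AE x in lborel. convergent (\<lambda>n. f n x)"
proof -
  have [measurable]: "f n \<in> borel_measurable lborel" for n
    using f by (simp add: square_integrable_def)
  have "(\<integral>\<^sup>+x. (\<Sum>n. ennreal (2^n * (norm (f n x - f (Suc n) x))\<^sup>2)) \<partial>lborel)
      = (\<Sum>n. \<integral>\<^sup>+x. ennreal (2^n * (norm (f n x - f (Suc n) x))\<^sup>2) \<partial>lborel)"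
    by (rule nn_integral_suminf) simp
  also have "\<dots> = (\<Sum>n. ennreal (2^n) * ennreal ((dist (abs_l2 (f n)) (abs_l2 (f (Suc n))))\<^sup>2))"
    by (simp add: ennreal_mult nn_integral_cmult nn_integral_l2 f)
  also have "\<dots> \<le> (\<Sum>n. ennreal ((1/2)^n))"
  proof (intro suminf_le summableI)
    fix n
    have "2^n * (dist (abs_l2 (f n)) (abs_l2 (f (Suc n))))\<^sup>2 \<le> 2^n * ((1/2)^n)\<^sup>2"
      by (intro mult_left_mono power_mono d) auto
    also have "\<dots> = (1/2)^n" by (simp add: power2_eq_square power_divide)
    finally show "ennreal (2^n) * ennreal ((dist (abs_l2 (f n)) (abs_l2 (f (Suc n))))\<^sup>2) \<le> ennreal ((1/2)^n)"
      by (simp flip: ennreal_mult)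
  qed
  also have "\<dots> = ennreal (\<Sum>n. (1/2)^n)"
    by (intro suminf_ennreal2 summable_geometric) auto
  finally have "(\<integral>\<^sup>+x. (\<Sum>n. ennreal (2^n * (norm (f n x - f (Suc n) x))\<^sup>2)) \<partial>lborel) \<noteq> \<infinity>"
    by (metis ennreal_neq_top infinity_ennreal_def neq_top_trans)
  then have "AE x in lborel. (\<Sum>n. ennreal (2^n * (norm (f n x - f (Suc n) x))\<^sup>2)) \<noteq> \<infinity>"
    by (intro nn_integral_PInf_AE) simp_all
  then show ?thesis
  proof eventually_elim
    case (elim x)
    define a where "a n = 2^n * (norm (f n x - f (Suc n) x))\<^sup>2" for n
    have "summable a"
      using elim by (intro summable_suminf_not_top) (auto simp: a_def top_ennreal_def)
    then have "Bseq a" using summable_LIMSEQ_zero convergent_imp_Bseq convergentI by blast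
    then obtain K where K: "K > 0" "\<And>n. norm (a n) \<le> K" by (auto simp: Bseq_def)
    have bound: "norm (f (Suc n) x - f n x) \<le> sqrt K * (sqrt (1/2))^n" for n
    proof -
      have "(norm (f n x - f (Suc n) x))\<^sup>2 \<le> K * (1/2)^n"
        using K(2)[of n] by (simp add: a_def field_simps)
      then have "norm (f n x - f (Suc n) x) \<le> sqrt (K * (1/2)^n)"
        by (metis real_le_rsqrt)
      then show ?thesis by (simp add: real_sqrt_mult real_sqrt_power norm_minus_commute)
    qed
    have "summable (\<lambda>n. sqrt K * sqrt (1/2) ^ n)"
    proof -
      have "sqrt (1/2) < sqrt 1" by (subst real_sqrt_less_iff) simp
      then have "norm (sqrt (1/2)) < 1" by simp
      then show ?thesis by (intro summable_mult summable_geometric)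
    qed
    from this bound have "summable (\<lambda>n. f (Suc n) x - f n x)"
      by (rule summable_comparison_test'[where N = 0])
    then have "convergent (\<lambda>n. f n x - f 0 x)"
      by (simp add: summable_iff_convergent sum_lessThan_telescope[of "\<lambda>i. f i x"])
    then show ?case
      using convergent_add[OF _ convergent_const[of "f 0 x"]] by fastforce
  qed
qed

text \<open>A subsequence with geometrically small distances converges almost everywhere, and its
  pointwise limit is then shown to be the limit in norm.\<close>

instance l2 :: complete_space
proof
  fix X :: "nat \<Rightarrow> l2" assume C: "Cauchy X"
  have "\<exists>r. strict_mono r \<and> (\<forall>n. dist (X (r n)) (X (r (Suc n))) \<le> (1/2)^n)"
  proof -
    define P where "P n N \<longleftrightarrow> (\<forall>m\<ge>N. \<forall>k\<ge>N. dist (X m) (X k) < (1/2::real)^n)" for n N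
    have "\<exists>N. P n N" for n
      using metric_CauchyD[OF C, of "(1/2)^n"] by (auto simp: P_def)
    then obtain N where N: "\<And>n. P n (N n)" by metis
    have "\<exists>r. (\<forall>n. N n \<le> r n) \<and> strict_mono r"
    proof -
      \<comment> \<open>Summing the thresholds makes the indices both dominate \<open>N n\<close>
        and increase strictly.\<close>
      define r where "r n = (\<Sum>i\<le>n. Suc (N i))" for n
      have "N n \<le> r n" for n
        unfolding r_def by (cases n) auto
      moreover have "strict_mono r" by (intro strict_mono_Suc_iff[THEN iffD2]) (simp add: r_def)
      ultimately show ?thesis by blast
    qed
    then obtain r where r: "\<And>n. N n \<le> r n" "strict_mono r" by blast
    have "dist (X (r n)) (X (r (Suc n))) \<le> (1/2)^n" for n
      using N[of n] r(1)[of n] r(2) unfolding P_def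
      by (meson lessI less_imp_le order.trans strict_mono_less)
    with r(2) show ?thesis by blast
  qed
  then obtain r where r: "strict_mono r" "\<And>n. dist (X (r n)) (X (r (Suc n))) \<le> (1/2)^n" by blast
  have "\<exists>f. square_integrable f \<and> X (r n) = abs_l2 f" for n
    by (metis abs_l2_cases)
  then obtain f where f: "\<And>n. square_integrable (f n)" "\<And>n. X (r n) = abs_l2 (f n)" by metis
  have [measurable]: "f n \<in> borel_measurable lborel" for n
    using f by (simp add: square_integrable_def)
  have conv: "AE x in lborel. convergent (\<lambda>n. f n x)"
    using AE_Cauchy_l2[of f] f r(2) by simp
  define g where "g x = lim (\<lambda>n. f n x)" for x
  have g[measurable]: "g \<in> borel_measurable lborel"
    unfolding g_def by (rule borel_measurable_lim_metric) simp
  have lim: "AE x in lborel. (\<lambda>n. f n x) \<longlonglongrightarrow> g x"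
    using conv by eventually_elim (simp add: g_def convergent_LIMSEQ_iff)
  have Cf: "Cauchy (\<lambda>n. abs_l2 (f n))"
    using Cauchy_subseq_Cauchy[OF C r(1)] f(2) by (simp add: o_def)
  \<comment> \<open>Fatou's lemma in \<open>m\<close>. It serves twice: with \<open>e = 1\<close>
    for square integrability of the limit, and with \<open>e/2\<close> for convergence in
    norm.\<close>
  have bd: "(\<integral>\<^sup>+x. ennreal ((norm (f n x - g x))\<^sup>2) \<partial>lborel) \<le> ennreal (e\<^sup>2)"
    if "\<And>m. m \<ge> n \<Longrightarrow> dist (abs_l2 (f n)) (abs_l2 (f m)) \<le> e" for n e
  proof -
    have "(\<integral>\<^sup>+x. ennreal ((norm (f n x - g x))\<^sup>2) \<partial>lborel)
        = (\<integral>\<^sup>+x. liminf (\<lambda>m. ennreal ((norm (f n x - f m x))\<^sup>2)) \<partial>lborel)"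
    proof (intro nn_integral_cong_AE)
      show "AE x in lborel. ennreal ((norm (f n x - g x))\<^sup>2) = liminf (\<lambda>m. ennreal ((norm (f n x - f m x))\<^sup>2))"
        using lim
      proof eventually_elim
        case (elim x)
        have "(\<lambda>m. ennreal ((norm (f n x - f m x))\<^sup>2)) \<longlonglongrightarrow> ennreal ((norm (f n x - g x))\<^sup>2)"
          by (intro tendsto_ennrealI tendsto_intros elim)
        then show ?case by (intro lim_imp_Liminf[symmetric]) simp_all
      qed
    qed
    also have "\<dots> \<le> liminf (\<lambda>m. \<integral>\<^sup>+x. ennreal ((norm (f n x - f m x))\<^sup>2) \<partial>lborel)"
      by (rule nn_integral_liminf) simp
    also have "\<dots> = liminf (\<lambda>m. ennreal ((dist (abs_l2 (f n)) (abs_l2 (f m)))\<^sup>2))"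
      by (simp add: nn_integral_l2 f)
    also have "\<dots> \<le> liminf (\<lambda>m::nat. ennreal (e\<^sup>2))"
      using that by (intro Liminf_mono eventually_sequentiallyI[of n] ennreal_leI power_mono) auto
    also have "\<dots> = ennreal (e\<^sup>2)" by (simp add: Liminf_const)
    finally show ?thesis .
  qed
  have sq: "square_integrable g"
  proof -
    obtain n where n: "\<And>m. m \<ge> n \<Longrightarrow> dist (abs_l2 (f n)) (abs_l2 (f m)) \<le> 1"
      using metric_CauchyD[OF Cf, of 1] by (metis le_refl less_imp_le zero_less_one)
    have "integrable lborel (\<lambda>x. (norm (f n x - g x))\<^sup>2)"
      using bd[OF n] by (intro integrableI_bounded) (auto simp: le_less_trans)
    then have "square_integrable (\<lambda>x. f n x - g x)"
      by (simp add: square_integrable_def)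
    from square_integrable_diff[OF f(1)[of n] this] show ?thesis by simp
  qed
  have "(\<lambda>n. abs_l2 (f n)) \<longlonglongrightarrow> abs_l2 g"
  proof (rule metric_LIMSEQ_I)
    fix e :: real assume e: "e > 0"
    obtain N where N: "\<And>m n. m \<ge> N \<Longrightarrow> n \<ge> N \<Longrightarrow> dist (abs_l2 (f n)) (abs_l2 (f m)) < e/2"
      using metric_CauchyD[OF Cf, of "e/2"] e by auto
    have "dist (abs_l2 (f n)) (abs_l2 g) < e" if "n \<ge> N" for n
    proof -
      have "(\<integral>\<^sup>+x. ennreal ((norm (f n x - g x))\<^sup>2) \<partial>lborel) \<le> ennreal ((e/2)\<^sup>2)"
        using that by (intro bd less_imp_le[OF N]) simp_all
      then have "(dist (abs_l2 (f n)) (abs_l2 g))\<^sup>2 \<le> (e/2)\<^sup>2"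
        by (simp add: nn_integral_l2 f sq)
      then have "dist (abs_l2 (f n)) (abs_l2 g) \<le> e/2"
        by (rule power2_le_imp_le) (use e in linarith)
      with e show ?thesis by simp
    qed
    then show "\<exists>no. \<forall>n\<ge>no. dist (abs_l2 (f n)) (abs_l2 g) < e" by blast
  qed
  then have "(\<lambda>n. X (r n)) \<longlonglongrightarrow> abs_l2 g" by (simp add: f)
  then show "convergent X"
    using Cauchy_converges_subseq[OF C r(1)] by (auto simp: convergent_def o_def)
qed

instance l2 :: banach ..

section \<open>Diagonal operators\<close>

lemma scaleC_l22_nth: "scaleC_l22 c u $ i = scaleC_l2 c (u $ i)"
  by (simp add: scaleC_l22_def)
lemma scaleC_l22_add_right: "scaleC_l22 c (u + v) = scaleC_l22 c u + scaleC_l22 c v"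
  by (simp add: vec_eq_iff scaleC_l22_nth scaleC_l2_add_right)
lemma scaleC_l22_add_left: "scaleC_l22 (c + d) u = scaleC_l22 c u + scaleC_l22 d u"
  by (simp add: vec_eq_iff scaleC_l22_nth scaleC_l2_add_left)
lemma scaleC_l22_scaleC: "scaleC_l22 c (scaleC_l22 d u) = scaleC_l22 (c * d) u"
  by (simp add: vec_eq_iff scaleC_l22_nth scaleC_l2_mult)
lemma scaleC_l22_of_real: "scaleC_l22 (of_real r) u = r *\<^sub>R u"
  by (simp add: vec_eq_iff scaleC_l22_nth scaleC_l2_of_real)
lemma scaleC_l22_inner: "scaleC_l22 c u \<bullet> v = u \<bullet> scaleC_l22 (cnj c) v"
  by (simp add: inner_vec_def scaleC_l22_nth scaleC_l2_inner)

lemma scaleC_l22_one [simp]: "scaleC_l22 1 u = u"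
  using scaleC_l22_of_real[of 1 u] by simp
lemma scaleC_l22_zero_left [simp]: "scaleC_l22 0 u = 0"
  using scaleC_l22_of_real[of 0 u] by simp

lemma norm_scaleC_l22: "norm (scaleC_l22 c u) = cmod c * norm u"
proof -
  have "(norm (scaleC_l22 c u))\<^sup>2 = (cmod c * norm u)\<^sup>2"
    by (simp add: power2_norm_eq_inner scaleC_l22_inner scaleC_l22_scaleC power_mult_distrib
        mult.commute[of "cnj c"] complex_norm_square[symmetric] scaleC_l22_of_real
        flip: of_real_power)
  then show ?thesis by (simp add: power2_eq_iff_nonneg)
qed

lemma bounded_bilinear_scaleC_l22: "bounded_bilinear scaleC_l22"
proof
  fix r :: real and c :: complex and u :: "l2^2"
  have r: "r *\<^sub>R c = of_real r * c" by (rule scaleR_conv_of_real)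
  show "scaleC_l22 (r *\<^sub>R c) u = r *\<^sub>R scaleC_l22 c u"
    by (simp add: r flip: scaleC_l22_scaleC scaleC_l22_of_real)
  show "scaleC_l22 c (r *\<^sub>R u) = r *\<^sub>R scaleC_l22 c u"
    by (simp add: mult.commute scaleC_l22_scaleC flip: scaleC_l22_of_real)
  show "\<exists>K. \<forall>a b. norm (scaleC_l22 a b) \<le> norm a * norm b * K"
    by (intro exI[of _ 1]) (simp add: norm_scaleC_l22)
qed (simp_all add: scaleC_l22_add_left scaleC_l22_add_right)

interpretation scaleC: bounded_bilinear scaleC_l22
  by (rule bounded_bilinear_scaleC_l22)

section \<open>The complex inner product and orthonormal bases\<close>

definition cip :: "l2^2 \<Rightarrow> l2^2 \<Rightarrow> complex" where
  \<comment> \<open>The type carries only the real part of the inner product. The imaginary part of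
    \<open><u, v>\<close> is the real part of \<open><\<i> u, v>\<close> because the first argument
    is conjugate linear.\<close>
  "cip u v = Complex (u \<bullet> v) (scaleC_l22 \<i> u \<bullet> v)"

lemma cip_add_right: "cip u (v + w) = cip u v + cip u w"
  by (simp add: cip_def inner_add_right complex_eq_iff)
lemma cip_diff_right: "cip u (v - w) = cip u v - cip u w"
  by (simp add: cip_def inner_diff_right complex_eq_iff)
lemma cip_zero_right [simp]: "cip u 0 = 0"
  by (simp add: cip_def complex_eq_iff)
lemma cip_sum_right: "cip u (\<Sum>i\<in>F. f i) = (\<Sum>i\<in>F. cip u (f i))"
  by (induction F rule: infinite_finite_induct) (auto simp: cip_add_right)
lemma cip_commute: "cip v u = cnj (cip u v)"
proof -
  have "scaleC_l22 \<i> v \<bullet> u = - (scaleC_l22 \<i> u \<bullet> v)"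
    unfolding scaleC_l22_inner[of _ u v] by (simp add: scaleC.minus_left inner_commute)
  then show ?thesis by (simp add: cip_def complex_eq_iff inner_commute[of v u])
qed

lemma scaleC_l22_Re_Im: "scaleC_l22 c u = Re c *\<^sub>R u + Im c *\<^sub>R scaleC_l22 \<i> u"
proof -
  have "scaleC_l22 c u = scaleC_l22 (of_real (Re c) + of_real (Im c) * \<i>) u"
    by (metis complex_eq mult.commute)
  then show ?thesis
    by (simp add: scaleC_l22_add_left scaleC_l22_of_real flip: scaleC_l22_scaleC)
qed

lemma cip_scaleC_right: "cip u (scaleC_l22 c v) = c * cip u v"
proof -
  have *: "u \<bullet> scaleC_l22 \<i> v = - (scaleC_l22 \<i> u \<bullet> v)"
    by (simp add: scaleC_l22_inner[of _ u] scaleC.minus_left)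
  have **: "scaleC_l22 \<i> u \<bullet> scaleC_l22 \<i> v = u \<bullet> v"
    by (simp add: scaleC_l22_inner[of _ u] scaleC_l22_scaleC)
  show ?thesis
    by (simp add: cip_def complex_eq_iff scaleC_l22_Re_Im[of c] inner_add_right * **)
qed

lemma cip_scaleC_left: "cip (scaleC_l22 c u) v = cnj c * cip u v"
  by (subst (1 2) cip_commute) (simp add: cip_scaleC_right)

lemma cip_scaleR_right: "cip u (r *\<^sub>R v) = of_real r * cip u v"
  by (metis cip_scaleC_right scaleC_l22_of_real)

lemma cip_self: "cip u u = of_real ((norm u)\<^sup>2)"
proof -
  have "Im (cip u u) = 0" using cip_commute[of u u] by (simp add: complex_eq_iff)
  then show ?thesis by (simp add: complex_eq_iff cip_def power2_norm_eq_inner)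
qed

lemma tendsto_cip: "(f \<longlongrightarrow> v) F \<Longrightarrow> ((\<lambda>t. cip u (f t)) \<longlongrightarrow> cip u v) F"
  unfolding cip_def by (intro tendsto_intros)

lemma has_vector_derivative_at_0:
  "(f has_vector_derivative d) (at 0) \<longleftrightarrow> ((\<lambda>h. (f h - f 0) /\<^sub>R h) \<longlongrightarrow> d) (at 0)"
proof -
  have "norm (f h - f 0 - h *\<^sub>R d) / norm h = norm ((f h - f 0) /\<^sub>R h - d)" if "h \<noteq> 0" for h
  proof -
    have "(f h - f 0) /\<^sub>R h - d = (f h - f 0 - h *\<^sub>R d) /\<^sub>R h"
      using that by (simp add: scaleR_diff_right)
    then show ?thesis by (simp add: divide_inverse mult.commute)
  qed
  then have "((\<lambda>h. norm (f h - f 0 - h *\<^sub>R d) / norm h) \<longlongrightarrow> 0) (at 0) \<longleftrightarrow>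
      ((\<lambda>h. norm ((f h - f 0) /\<^sub>R h - d)) \<longlongrightarrow> 0) (at 0)"
    by (intro tendsto_cong eventually_at_topological[THEN iffD2]) auto
  then show ?thesis
    by (simp add: has_vector_derivative_def has_derivative_at bounded_linear_scaleR_left
        tendsto_norm_zero_iff LIM_zero_iff)
qed

lemma cis_has_vector_derivative:
  "((\<lambda>s. cis (c * s)) has_vector_derivative \<i> * c * cis (c * s)) (at s)"
proof -
  have "((\<lambda>z. exp (\<i> * c * z)) has_field_derivative \<i> * c * exp (\<i> * c * of_real s)) (at (of_real s))"
    by (auto intro!: derivative_eq_intros)
  from has_vector_derivative_real_field[OF this] show ?thesis
    by (simp add: cis_conv_exp mult.assoc)
qed

lemma cmod_cis_minus_1: "cmod (cis a - 1) \<le> \<bar>a\<bar>"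
proof -
  have "cmod (cis a - 1) = 2 * \<bar>sin (a / 2)\<bar>"
    using dist_exp_i_1[of a] by (simp add: cis_conv_exp mult.commute)
  also have "\<dots> \<le> 2 * \<bar>a / 2\<bar>" using abs_sin_x_le_abs_x[of "a/2"] by linarith
  finally show ?thesis by simp
qed

text \<open>Totality is stated as triviality of the orthogonal complement, since this is what the
  moment argument for Hermite functions delivers. Completeness of the space then turns it into
  convergent expansions.\<close>

locale onb =
  fixes e :: "nat \<Rightarrow> l2^2"
  assumes orth: "cip (e m) (e n) = (if m = n then 1 else 0)"
    and total: "(\<And>n. cip (e n) x = 0) \<Longrightarrow> x = 0"
begin

lemma cip_sum: "finite F \<Longrightarrow> cip (e m) (\<Sum>n\<in>F. scaleC_l22 (z n) (e n)) = (if m \<in> F then z m else 0)"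
  by (simp add: cip_sum_right cip_scaleC_right orth if_distrib[of "\<lambda>x. _ * x"] cong: if_cong)

lemma norm_sum: 
  assumes "finite F"
  shows "(norm (\<Sum>n\<in>F. scaleC_l22 (z n) (e n)))\<^sup>2 = (\<Sum>n\<in>F. (cmod (z n))\<^sup>2)"
proof -
  define w where "w = (\<Sum>n\<in>F. scaleC_l22 (z n) (e n))"
  have "cip w w = (\<Sum>n\<in>F. z n * cip w (e n))"
    by (subst (2) w_def) (simp add: cip_sum_right cip_scaleC_right)
  also have "\<dots> = (\<Sum>n\<in>F. of_real ((cmod (z n))\<^sup>2))"
    by (intro sum.cong refl, subst cip_commute)
      (simp add: w_def cip_sum assms complex_norm_square flip: of_real_power)
  finally have "complex_of_real ((norm w)\<^sup>2) = of_real (\<Sum>n\<in>F. (cmod (z n))\<^sup>2)"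
    unfolding cip_self by simp
  then show ?thesis unfolding w_def by (simp only: of_real_eq_iff)
qed

lemma bessel:
  assumes "finite F"
  shows "(\<Sum>n\<in>F. (cmod (cip (e n) x))\<^sup>2) \<le> (norm x)\<^sup>2"
proof -
  define w where "w = (\<Sum>n\<in>F. scaleC_l22 (cip (e n) x) (e n))"
  have "cip (x - w) w = (\<Sum>n\<in>F. cip (e n) x * cip (x - w) (e n))"
    by (subst (2) w_def) (simp add: cip_sum_right cip_scaleC_right)
  also have "\<dots> = 0"
    by (intro sum.neutral ballI, subst cip_commute)
      (simp add: w_def cip_diff_right cip_sum assms)
  finally have "(x - w) \<bullet> w = 0" by (simp add: cip_def complex_eq_iff)
  then have "(norm x)\<^sup>2 = (norm (x - w))\<^sup>2 + (norm w)\<^sup>2"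
    by (simp add: power2_norm_eq_inner inner_diff_left inner_diff_right inner_commute)
  then show ?thesis
    using norm_sum[OF assms, of "\<lambda>n. cip (e n) x"] by (simp add: w_def)
qed

lemma summable_coeff: "summable (\<lambda>n. (cmod (cip (e n) x))\<^sup>2)"
  by (rule summableI_nonneg_bounded[where x = "(norm x)\<^sup>2"]) (auto intro: bessel)

lemma coeff_eqI: "(\<And>n. cip (e n) x = cip (e n) y) \<Longrightarrow> x = y"
  using total[of "x - y"] by (simp add: cip_diff_right)

lemma convergent_series:
  assumes "summable (\<lambda>n. (cmod (z n))\<^sup>2)"
  shows "\<exists>x. (\<lambda>n. scaleC_l22 (z n) (e n)) sums x \<and> (\<forall>n. cip (e n) x = z n)"
proof -
  have "summable (\<lambda>n. scaleC_l22 (z n) (e n))"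
    unfolding summable_Cauchy
  proof (safe)
    fix d :: real assume "d > 0"
    then obtain N where N: "\<And>m n. m \<ge> N \<Longrightarrow> norm (\<Sum>k=m..<n. (cmod (z k))\<^sup>2) < d\<^sup>2"
      using assms unfolding summable_Cauchy by (meson zero_less_power)
    have "norm (\<Sum>k=m..<n. scaleC_l22 (z k) (e k)) < d" if "m \<ge> N" for m n
    proof (rule power2_less_imp_less)
      show "(norm (\<Sum>k=m..<n. scaleC_l22 (z k) (e k)))\<^sup>2 < d\<^sup>2"
        using N[OF that, of n] by (simp add: norm_sum)
    qed (use \<open>d > 0\<close> in simp)
    then show "\<exists>N. \<forall>m\<ge>N. \<forall>n. norm (\<Sum>k=m..<n. scaleC_l22 (z k) (e k)) < d" by blast
  qed
  then obtain x where x: "(\<lambda>n. scaleC_l22 (z n) (e n)) sums x" by (auto simp: summable_def)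
  have "cip (e n) x = z n" for n
  proof (rule LIMSEQ_unique)
    show "(\<lambda>N. cip (e n) (\<Sum>k<N. scaleC_l22 (z k) (e k))) \<longlonglongrightarrow> cip (e n) x"
      using x unfolding sums_def by (rule tendsto_cip)
    show "(\<lambda>N. cip (e n) (\<Sum>k<N. scaleC_l22 (z k) (e k))) \<longlonglongrightarrow> z n"
      by (rule tendsto_eventually, rule eventually_sequentiallyI[of "Suc n"])
        (simp add: cip_sum)
  qed
  with x show ?thesis by blast
qed

lemma expansion: "(\<lambda>n. scaleC_l22 (cip (e n) x) (e n)) sums x"
proof -
  obtain y where y: "(\<lambda>n. scaleC_l22 (cip (e n) x) (e n)) sums y" "\<And>n. cip (e n) y = cip (e n) x"
    using convergent_series[OF summable_coeff[of x]] by auto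
  with coeff_eqI[of y x] show ?thesis by simp
qed

lemma parseval: "(\<lambda>n. (cmod (cip (e n) x))\<^sup>2) sums (norm x)\<^sup>2"
proof -
  have "(\<lambda>N. (norm (\<Sum>n<N. scaleC_l22 (cip (e n) x) (e n)))\<^sup>2) \<longlonglongrightarrow> (norm x)\<^sup>2"
    using expansion[of x] unfolding sums_def by (intro tendsto_intros)
  then show ?thesis by (simp add: norm_sum sums_def)
qed

lemma norm_eq_suminf_coeff: "(norm x)\<^sup>2 = (\<Sum>n. (cmod (cip (e n) x))\<^sup>2)"
  using parseval sums_unique by blast

text \<open>Dominated convergence in coefficient space: by Parseval the squared distance is a series
  over the basis, and Tannery's theorem passes to the limit in each term.\<close>

lemma dominated_tendsto:
  fixes f :: "'b \<Rightarrow> l2^2"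
  assumes lim: "\<And>n. ((\<lambda>t. cip (e n) (f t)) \<longlongrightarrow> cip (e n) y) F"
    and M: "\<And>n t. (cmod (cip (e n) (f t) - cip (e n) y))\<^sup>2 \<le> M n" "summable M" and F: "F \<noteq> bot"
  shows "(f \<longlongrightarrow> y) F"
proof -
  have "((\<lambda>t. \<Sum>n. (cmod (cip (e n) (f t) - cip (e n) y))\<^sup>2) \<longlongrightarrow> (\<Sum>n::nat. (0::real))) F"
  proof (rule tannerys_theorem[THEN conjunct2, THEN conjunct2])
    show "((\<lambda>t. (cmod (cip (e n) (f t) - cip (e n) y))\<^sup>2) \<longlongrightarrow> 0) F" for n
      using tendsto_power[OF tendsto_norm[OF tendsto_diff[OF lim[of n] tendsto_const[of "cip (e n) y"]]], of 2]
      by simp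
  qed (use M F in \<open>simp_all add: case_prod_unfold\<close>)
  then have "((\<lambda>t. (norm (f t - y))\<^sup>2) \<longlongrightarrow> 0) F"
    by (simp add: norm_eq_suminf_coeff cip_diff_right)
  then have "((\<lambda>t. sqrt ((norm (f t - y))\<^sup>2)) \<longlongrightarrow> sqrt 0) F"
    by (rule tendsto_real_sqrt)
  then show ?thesis by (simp add: LIM_zero_iff tendsto_norm_zero_iff)
qed

section \<open>Diagonal operators and the groups they generate\<close>

definition diag_graph :: "(nat \<Rightarrow> real) \<Rightarrow> ((l2^2) \<times> (l2^2)) set" where
  \<comment> \<open>The domain is implicit: a vector \<open>y\<close> with these coefficients exists
    precisely if the products \<open>E n * cip (e n) x\<close> are square summable. This is the
    maximal, self-adjoint domain.\<close>
  "diag_graph E = {(x, y). \<forall>n. cip (e n) y = of_real (E n) * cip (e n) x}"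

definition diag_group :: "(nat \<Rightarrow> real) \<Rightarrow> real \<Rightarrow> l2^2 \<Rightarrow> l2^2" where
  "diag_group E t x = (\<Sum>n. scaleC_l22 (cis (- E n * t) * cip (e n) x) (e n))"

lemma coeff_diag_group: "cip (e n) (diag_group E t x) = cis (- E n * t) * cip (e n) x"
proof -
  have s: "summable (\<lambda>n. (cmod (cis (- E n * t) * cip (e n) x))\<^sup>2)"
    using summable_coeff[of x] by (simp add: norm_mult)
  obtain y where y: "(\<lambda>n. scaleC_l22 (cis (- E n * t) * cip (e n) x) (e n)) sums y"
    "\<And>n. cip (e n) y = cis (- E n * t) * cip (e n) x"
    using convergent_series[OF s] by auto
  with sums_unique[OF y(1)] show ?thesis by (simp add: diag_group_def)
qed

lemma unitary_diag_group: "unitary (diag_group E t)"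
  unfolding unitary_def
proof (intro conjI allI)
  show "diag_group E t (x + y) = diag_group E t x + diag_group E t y" for x y
    by (rule coeff_eqI) (simp add: coeff_diag_group cip_add_right algebra_simps)
  show "diag_group E t (scaleC_l22 c x) = scaleC_l22 c (diag_group E t x)" for c x
    by (rule coeff_eqI) (simp add: coeff_diag_group cip_scaleC_right)
  show "norm (diag_group E t x) = norm x" for x
  proof -
    have "(norm (diag_group E t x))\<^sup>2 = (norm x)\<^sup>2"
      by (simp add: norm_eq_suminf_coeff coeff_diag_group norm_mult)
    then show ?thesis by simp
  qed
  have "diag_group E t (diag_group E (-t) x) = x" for x
    by (rule coeff_eqI) (simp add: coeff_diag_group cis_mult mult.assoc[symmetric])
  then show "surj (diag_group E t)" by (metis surjI)
qed

lemma diag_group_0: "diag_group E 0 x = x"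
  by (rule coeff_eqI) (simp add: coeff_diag_group)

text \<open>Forward, \<open>\<bar>cis (- E n * h) - 1\<bar> \<le> \<bar>E n * h\<bar>\<close> lets
  the coefficients of \<open>y\<close> dominate the difference quotients. Backward, the limits of
  the single coefficients already identify \<open>y\<close>, so differentiability at zero
  characterizes the domain.\<close>

lemma diag_group_derivative:
  "(x, y) \<in> diag_graph E \<longleftrightarrow>
     ((\<lambda>t. diag_group E t x) has_vector_derivative scaleC_l22 (- \<i>) y) (at 0)"
proof -
  define f where "f h = (diag_group E h x - x) /\<^sub>R h" for h
  have f: "cip (e n) (f h) = (cis (- E n * h) - 1) /\<^sub>R h * cip (e n) x" for n h
    by (simp add: f_def cip_scaleR_right cip_diff_right coeff_diag_group scaleR_conv_of_real algebra_simps)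
  have "((\<lambda>h. cis (- E n * h)) has_vector_derivative (- \<i> * E n)) (at 0)" for n
    using cis_has_vector_derivative[of "- E n" 0] by simp
  then have "((\<lambda>h. (cis (- E n * h) - 1) /\<^sub>R h) \<longlongrightarrow> - \<i> * E n) (at 0)" for n
    unfolding has_vector_derivative_at_0 by simp
  then have lim: "((\<lambda>h. cip (e n) (f h)) \<longlongrightarrow> - \<i> * E n * cip (e n) x) (at 0)" for n
    unfolding f by (intro tendsto_mult_right)
  show ?thesis unfolding has_vector_derivative_at_0 diag_group_0 f_def[symmetric]
  proof
    assume "(x, y) \<in> diag_graph E"
    then have y: "cip (e n) y = E n * cip (e n) x" for n by (simp add: diag_graph_def)
    show "(f \<longlongrightarrow> scaleC_l22 (- \<i>) y) (at 0)"
    proof (rule dominated_tendsto[where M = "\<lambda>n. 4 * (cmod (cip (e n) y))\<^sup>2"])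
      show "((\<lambda>t. cip (e n) (f t)) \<longlongrightarrow> cip (e n) (scaleC_l22 (- \<i>) y)) (at 0)" for n
        using lim[of n] by (simp add: cip_scaleC_right y mult.assoc)
      \<comment> \<open>The quotient and its limit both have coefficients of modulus at most
        \<open>cmod (cip (e n) y)\<close>, hence the factor 4. At \<open>h = 0\<close> the quotient
        is zero by convention, so the bound holds for every \<open>h\<close>.\<close>
      show "(cmod (cip (e n) (f h) - cip (e n) (scaleC_l22 (- \<i>) y)))\<^sup>2 \<le> 4 * (cmod (cip (e n) y))\<^sup>2" for n h
      proof -
        have "cmod ((cis (- E n * h) - 1) /\<^sub>R h) \<le> \<bar>E n\<bar>"
          using cmod_cis_minus_1[of "- E n * h"] unfolding norm_scaleR
          by (cases "h = 0") (auto simp: abs_mult field_simps)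
        then have "cmod (cip (e n) (f h)) \<le> cmod (cip (e n) y)"
          unfolding f y norm_mult by (intro mult_right_mono) auto
        then have "cmod (cip (e n) (f h) - cip (e n) (scaleC_l22 (- \<i>) y)) \<le> 2 * cmod (cip (e n) y)"
          using norm_triangle_ineq4[of "cip (e n) (f h)" "cip (e n) (scaleC_l22 (- \<i>) y)"]
          by (simp add: cip_scaleC_right norm_mult)
        then have "(cmod (cip (e n) (f h) - cip (e n) (scaleC_l22 (- \<i>) y)))\<^sup>2 \<le> (2 * cmod (cip (e n) y))\<^sup>2"
          by (rule power_mono) simp
        then show ?thesis by (simp add: power_mult_distrib)
      qed
    qed (auto intro: summable_coeff summable_mult)
  next
    assume "(f \<longlongrightarrow> scaleC_l22 (- \<i>) y) (at 0)"
    then have "((\<lambda>h. cip (e n) (f h)) \<longlongrightarrow> cip (e n) (scaleC_l22 (- \<i>) y)) (at 0)" for n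
      by (rule tendsto_cip)
    with lim have "cip (e n) (scaleC_l22 (- \<i>) y) = - \<i> * E n * cip (e n) x" for n
      by (metis tendsto_unique at_neq_bot)
    then show "(x, y) \<in> diag_graph E" by (simp add: diag_graph_def cip_scaleC_right mult.assoc)
  qed
qed

lemma unitary_group_of_diag: "unitary_group_of (diag_graph E) (diag_group E)"
  unfolding unitary_group_of_def
proof (intro conjI allI)
  show "diag_group E 0 = id"
    by (intro ext coeff_eqI) (simp add: coeff_diag_group)
  show "diag_group E (s + t) = diag_group E s \<circ> diag_group E t" for s t
    by (intro ext coeff_eqI) (simp add: coeff_diag_group cis_mult ring_distribs flip: mult.assoc)
  show "continuous_on UNIV (\<lambda>t. diag_group E t x)" for x
    unfolding continuous_on_def
  proof
    fix s :: real
    show "((\<lambda>t. diag_group E t x) \<longlongrightarrow> diag_group E s x) (at s within UNIV)"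
    proof (rule dominated_tendsto[where M = "\<lambda>n. 4 * (cmod (cip (e n) x))\<^sup>2"])
      show "((\<lambda>t. cip (e n) (diag_group E t x)) \<longlongrightarrow> cip (e n) (diag_group E s x)) (at s within UNIV)" for n
        unfolding coeff_diag_group cis_conv_exp by (intro tendsto_intros)
      show "(cmod (cip (e n) (diag_group E t x) - cip (e n) (diag_group E s x)))\<^sup>2
         \<le> 4 * (cmod (cip (e n) x))\<^sup>2" for n t
      proof -
        have "cmod (cis (- E n * t) - cis (- E n * s)) \<le> 2"
          using norm_triangle_ineq4[of "cis (- E n * t)" "cis (- E n * s)"] by simp
        then have "cmod (cip (e n) (diag_group E t x) - cip (e n) (diag_group E s x))
           \<le> 2 * cmod (cip (e n) x)"
          unfolding coeff_diag_group left_diff_distrib[symmetric] norm_mult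
          by (rule mult_right_mono) simp
        then have "(cmod (cip (e n) (diag_group E t x) - cip (e n) (diag_group E s x)))\<^sup>2
           \<le> (2 * cmod (cip (e n) x))\<^sup>2" by (rule power_mono) simp
        then show ?thesis by (simp add: power_mult_distrib)
      qed
    qed (auto intro: summable_coeff summable_mult)
  qed
qed (rule unitary_diag_group diag_group_derivative)+

end

section \<open>Unitary groups and their generators\<close>

text \<open>This is essential self-adjointness. The diagonal graph is closed, and the truncated
  expansions of a pair \<open>(x, y)\<close> in it lie in \<open>G\<close> and converge in both
  components at once, because the coefficients of \<open>y\<close> are \<open>E n\<close> times
  those of \<open>x\<close>.\<close>

lemma (in onb) closure_eq_diag_graph:
  assumes sub: "G \<subseteq> diag_graph E"
    and zero: "(0, 0) \<in> G"
    and add: "\<And>x y x' y'. (x, y) \<in> G \<Longrightarrow> (x', y') \<in> G \<Longrightarrow> (x + x', y + y') \<in> G"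
    and eig: "\<And>n z. (scaleC_l22 z (e n), scaleC_l22 (of_real (E n) * z) (e n)) \<in> G"
  shows "closure G = diag_graph E"
proof
  have "closed (diag_graph E)"
    unfolding closed_sequential_limits diag_graph_def
  proof (safe)
    fix X x y n
    assume X: "\<forall>k. X k \<in> {(x, y). \<forall>n. cip (e n) y = of_real (E n) * cip (e n) x}" and l: "X \<longlonglongrightarrow> (x, y)"
    have "(\<lambda>k. cip (e n) (snd (X k))) \<longlonglongrightarrow> cip (e n) y"
      using tendsto_snd[OF l] by (intro tendsto_cip) simp
    moreover have "(\<lambda>k. of_real (E n) * cip (e n) (fst (X k))) \<longlonglongrightarrow> of_real (E n) * cip (e n) x"
      using tendsto_fst[OF l] by (intro tendsto_intros tendsto_cip) simp
    moreover have "(\<lambda>k. cip (e n) (snd (X k))) = (\<lambda>k. of_real (E n) * cip (e n) (fst (X k)))"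
      using X by (auto simp: case_prod_unfold)
    ultimately show "cip (e n) y = of_real (E n) * cip (e n) x"
      by (metis LIMSEQ_unique)
  qed
  with sub show "closure G \<subseteq> diag_graph E" by (rule closure_minimal)
  show "diag_graph E \<subseteq> closure G"
  proof
    fix p assume "p \<in> diag_graph E"
    then obtain x y where p: "p = (x, y)" and y: "\<And>n. cip (e n) y = of_real (E n) * cip (e n) x"
      by (auto simp: diag_graph_def)
    define X where "X N = (\<Sum>n<N. scaleC_l22 (cip (e n) x) (e n), \<Sum>n<N. scaleC_l22 (cip (e n) y) (e n))" for N :: nat
    have "X N \<in> G" for N
    proof (induction N)
      case (Suc N)
      then show ?case
        using add[OF _ eig[of "cip (e N) x" N]] by (simp add: X_def y)
    qed (simp add: X_def zero)
    moreover have "X \<longlonglongrightarrow> p"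
      unfolding X_def p using expansion[of x] expansion[of y] unfolding sums_def
      by (rule tendsto_Pair)
    ultimately show "p \<in> closure G" unfolding closure_sequential by blast
  qed
qed

lemma (in onb) closure_Domain_diag_graph: "closure (fst ` diag_graph E) = UNIV"
proof -
  have "x \<in> closure (fst ` diag_graph E)" for x
  proof -
    have "(\<Sum>n<N. scaleC_l22 (cip (e n) x) (e n)) \<in> fst ` diag_graph E" for N :: nat
    proof -
      have "(\<Sum>n<N. scaleC_l22 (cip (e n) x) (e n), \<Sum>n<N. scaleC_l22 (of_real (E n) * cip (e n) x) (e n)) \<in> diag_graph E"
        by (simp add: diag_graph_def cip_sum)
      then show ?thesis by force
    qed
    moreover have "(\<lambda>N. \<Sum>n<N. scaleC_l22 (cip (e n) x) (e n)) \<longlonglongrightarrow> x"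
      using expansion[of x] by (simp add: sums_def)
    ultimately show ?thesis unfolding closure_sequential by (intro exI[of _ "\<lambda>N. \<Sum>n<N. scaleC_l22 (cip (e n) x) (e n)"]) blast
  qed
  then show ?thesis by auto
qed

locale ugroup =
  fixes A :: "((l2^2) \<times> (l2^2)) set" and U :: "real \<Rightarrow> l2^2 \<Rightarrow> l2^2"
  assumes U: "unitary_group_of A U"
begin

lemma U_add: "U t (x + y) = U t x + U t y"
  using U by (auto simp: unitary_group_of_def unitary_def)
lemma U_scaleC: "U t (scaleC_l22 c x) = scaleC_l22 c (U t x)"
  using U by (auto simp: unitary_group_of_def unitary_def)
lemma U_scaleR: "U t (r *\<^sub>R x) = r *\<^sub>R U t x"
  using U_scaleC[of t "of_real r" x] by (simp add: scaleC_l22_of_real)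
lemma norm_U [simp]: "norm (U t x) = norm x"
  using U by (auto simp: unitary_group_of_def unitary_def)
lemma U_0 [simp]: "U 0 x = x"
  using U by (auto simp: unitary_group_of_def)
lemma U_U: "U s (U t x) = U (s + t) x"
  using U by (auto simp: unitary_group_of_def)
lemma U_diff: "U t (x - y) = U t x - U t y"
  using U_add[of t "x - y" y] by simp
lemma U_zero [simp]: "U t 0 = 0"
  using U_diff[of t 0 0] by simp

lemma U_continuous: "continuous_on UNIV (\<lambda>t. U t x)"
  using U by (auto simp: unitary_group_of_def)

lemma generator_iff: "(x, y) \<in> A \<longleftrightarrow> ((\<lambda>t. U t x) has_vector_derivative scaleC_l22 (- \<i>) y) (at 0)"
  using U by (auto simp: unitary_group_of_def)

lemma bounded_linear_U: "bounded_linear (U t)"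
  by (rule bounded_linear_intro[where K = 1]) (auto simp: U_add U_scaleR)

lemma generator_U:
  assumes "(x, y) \<in> A"
  shows "(U s x, U s y) \<in> A"
proof -
  have "((\<lambda>t. U s (U t x)) has_vector_derivative U s (scaleC_l22 (- \<i>) y)) (at 0)"
    using assms unfolding generator_iff by (rule bounded_linear.has_vector_derivative[OF bounded_linear_U])
  then show ?thesis by (simp add: generator_iff U_U U_scaleC add.commute)
qed

lemma U_derivative:
  assumes "(x, y) \<in> A"
  shows "((\<lambda>t. U t x) has_vector_derivative scaleC_l22 (- \<i>) (U s y)) (at s)"
proof -
  have "((\<lambda>t. U t (U s x)) has_vector_derivative scaleC_l22 (- \<i>) (U s y)) (at (s - s))"
    using generator_U[OF assms] unfolding generator_iff by simp
  moreover have "((\<lambda>t. t - s) has_vector_derivative 1) (at s)"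
    by (auto intro!: derivative_eq_intros)
  ultimately have "((\<lambda>t. U t (U s x)) \<circ> (\<lambda>t. t - s) has_vector_derivative 1 *\<^sub>R scaleC_l22 (- \<i>) (U s y)) (at s)"
    by (intro vector_diff_chain_at) simp_all
  then show ?thesis by (simp add: o_def U_U)
qed

text \<open>Conservation of the norm, differentiated at time zero. The uniqueness proof uses
  self-adjointness only in this form.\<close>

lemma generator_skew:
  assumes "(x, y) \<in> A"
  shows "x \<bullet> scaleC_l22 (- \<i>) y = 0"
proof -
  have d: "((\<lambda>t. U t x) has_vector_derivative scaleC_l22 (- \<i>) y) (at 0)"
    using assms by (simp add: generator_iff)
  have "((\<lambda>t. U t x \<bullet> U t x) has_vector_derivative U 0 x \<bullet> scaleC_l22 (- \<i>) y + scaleC_l22 (- \<i>) y \<bullet> U 0 x) (at 0)"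
    using bounded_bilinear.has_vector_derivative[OF bounded_bilinear_inner d d] .
  moreover have "(\<lambda>t. U t x \<bullet> U t x) = (\<lambda>t. x \<bullet> x)"
    by (simp add: power2_norm_eq_inner[symmetric])
  ultimately have "((\<lambda>t. x \<bullet> x) has_vector_derivative 2 * (x \<bullet> scaleC_l22 (- \<i>) y)) (at 0)"
    by (simp add: inner_commute)
  then show ?thesis
    using vector_derivative_unique_at[OF has_vector_derivative_const] by fastforce
qed

lemma generator_diff:
  assumes "(x, y) \<in> A" "(x', y') \<in> A"
  shows "(x - x', y - y') \<in> A"
  using has_vector_derivative_diff[OF assms[unfolded generator_iff]]
  by (simp add: generator_iff U_diff scaleC.diff_right)

text \<open>Removing the expected phase leaves a curve whose velocity is the evolved residual.
  Unitarity keeps the norm of that velocity constant, so the error grows at most linearly in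
  time.\<close>

lemma approximate_eigenvector:
  assumes "(x, y) \<in> A"
  shows "norm (U t x - scaleC_l22 (cis (- c * t)) x) \<le> \<bar>t\<bar> * norm (y - c *\<^sub>R x)"
proof -
  define f where "f s = scaleC_l22 (cis (c * s)) (U s x)" for s
  have d: "(f has_vector_derivative scaleC_l22 (- \<i> * cis (c * s)) (U s (y - c *\<^sub>R x))) (at s)" for s
  proof -
    have "((\<lambda>s. cis (c * s)) has_vector_derivative \<i> * c * cis (c * s)) (at s)"
      by (rule cis_has_vector_derivative)
    from scaleC.has_vector_derivative[OF this U_derivative[OF assms]]
    have "(f has_vector_derivative scaleC_l22 (cis (c * s)) (scaleC_l22 (- \<i>) (U s y))
       + scaleC_l22 (\<i> * c * cis (c * s)) (U s x)) (at s)"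
      unfolding f_def .
    moreover have "scaleC_l22 (cis (c * s)) (scaleC_l22 (- \<i>) (U s y)) + scaleC_l22 (\<i> * c * cis (c * s)) (U s x)
       = scaleC_l22 (- \<i> * cis (c * s)) (U s (y - c *\<^sub>R x))"
      unfolding U_diff U_scaleR
      by (simp add: scaleC.diff_right scaleC_l22_scaleC scaleC.minus_left scaleC.minus_right mult_ac
         flip: scaleC_l22_of_real)
    ultimately show ?thesis by simp
  qed
  have "norm (f t - f 0) \<le> norm (y - c *\<^sub>R x) * norm (t - 0)"
    by (rule differentiable_bound[of UNIV f "\<lambda>s h. h *\<^sub>R scaleC_l22 (- \<i> * cis (c * s)) (U s (y - c *\<^sub>R x))"])
      (use d in \<open>auto simp: has_vector_derivative_def norm_scaleC_l22 norm_mult intro!: onorm_le\<close>)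
  moreover have "U t x - scaleC_l22 (cis (- c * t)) x = scaleC_l22 (cis (- c * t)) (f t - f 0)"
    by (simp add: f_def scaleC.diff_right scaleC_l22_scaleC cis_mult)
  ultimately show ?thesis by (simp add: norm_scaleC_l22 mult.commute)
qed

end

lemma constant_norm_if_skew_derivative:
  fixes w :: "real \<Rightarrow> 'a::real_inner"
  assumes d: "\<And>t. (w has_vector_derivative w' t) (at t)" and skew: "\<And>t. w t \<bullet> w' t = 0"
  shows "norm (w t) = norm (w s)"
proof -
  have "((\<lambda>t. w t \<bullet> w t) has_vector_derivative 0) (at t)" for t
    using bounded_bilinear.has_vector_derivative[OF bounded_bilinear_inner d d, of t] skew[of t]
    by (simp add: inner_commute)
  then have "w t \<bullet> w t = w s \<bullet> w s"
    using has_vector_derivative_zero_constant[of UNIV "\<lambda>t. w t \<bullet> w t"] 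
    by (metis UNIV_I convex_UNIV has_vector_derivative_at_within)
  then show ?thesis by (simp add: norm_eq_sqrt_inner)
qed

text \<open>For a vector of the domain, the difference of the two orbits solves one equation with a
  skew generator, so its norm stays at its initial value zero. Density of the domain and continuity
  give all other vectors.\<close>

lemma unitary_group_unique:
  assumes U: "unitary_group_of A U" and V: "unitary_group_of A V" and dense: "closure (fst ` A) = UNIV"
  shows "U = V"
proof (intro ext)
  interpret U: ugroup A U by standard (rule U)
  interpret V: ugroup A V by standard (rule V)
  fix t x
  have eq: "U t x = V t x" if xA: "x \<in> fst ` A" for x
  proof -
    obtain y where A: "(x, y) \<in> A" using xA by force
    define w where "w s = U s x - V s x" for s
    have "norm (w t) = norm (w 0)"
    proof (rule constant_norm_if_skew_derivative)
      show "(w has_vector_derivative scaleC_l22 (- \<i>) (U s y - V s y)) (at s)" for s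
        using has_vector_derivative_diff[OF U.U_derivative[OF A] V.U_derivative[OF A]]
        unfolding w_def scaleC.diff_right .
      show "w s \<bullet> scaleC_l22 (- \<i>) (U s y - V s y) = 0" for s
        unfolding w_def by (intro U.generator_skew U.generator_diff U.generator_U V.generator_U A)
    qed
    then show ?thesis by (simp add: w_def)
  qed
  have "closed {x. U t x = V t x}"
    by (intro closed_Collect_eq linear_continuous_on U.bounded_linear_U V.bounded_linear_U)
  with eq have "closure (fst ` A) \<subseteq> {x. U t x = V t x}" by (intro closure_minimal) auto
  with dense show "U t x = V t x" by auto
qed

lemma exp_mi_eq:
  assumes "unitary_group_of A U" "closure (fst ` A) = UNIV"
  shows "exp_mi t A = U t"
proof -
  have "(THE U. unitary_group_of A U) = U"
    using assms by (intro the_equality) (auto dest: unitary_group_unique)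
  then show ?thesis by (simp add: exp_mi_def)
qed

section \<open>Linear differential equations\<close>

text \<open>One integration step of the Dyson series, which builds up the factorial in the
  denominator. Negative times are reduced to positive ones by reflection, as the group has to run in
  both directions.\<close>

lemma norm_le_power_if_derivative_le:
  fixes F :: "real \<Rightarrow> 'a::real_normed_vector"
  assumes d: "\<And>t. (F has_vector_derivative f t) (at t)" and 0: "F 0 = 0"
    and b: "\<And>t. norm (f t) \<le> C * \<bar>t\<bar> ^ n"
  shows "norm (F t) \<le> C * \<bar>t\<bar> ^ Suc n / Suc n"
proof -
  have pos: "norm (F t) \<le> C * \<bar>t\<bar> ^ Suc n / Suc n"
    if "t > 0" and d: "\<And>t. (F has_vector_derivative f t) (at t)" and 0: "F 0 = 0"
      and b: "\<And>t. norm (f t) \<le> C * \<bar>t\<bar> ^ n" for F :: "real \<Rightarrow> 'a" and f t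
  proof -
    have "norm (F t - F 0) \<le> C * t ^ Suc n / Suc n - C * 0 ^ Suc n / Suc n"
    proof (rule differentiable_bound_general[OF \<open>t > 0\<close>])
      show "continuous_on {0..t} F"
        by (intro continuous_at_imp_continuous_on ballI has_vector_derivative_continuous[OF d])
      have "((\<lambda>s. C * s ^ Suc n / Suc n) has_real_derivative C * s ^ n) (at s)" for s
        by (rule derivative_eq_intros refl | simp)+
      then show "((\<lambda>s. C * s ^ Suc n / Suc n) has_vector_derivative C * s ^ n) (at s)" for s
        by (simp add: has_real_derivative_iff_has_vector_derivative)
      show "norm (f s) \<le> C * s ^ n" if "0 < s" for s using b[of s] that by simp
      show "continuous_on {0..t} (\<lambda>s. C * s ^ Suc n / Suc n)"
        by (intro continuous_intros) simp
    qed (rule d)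
    with 0 \<open>t > 0\<close> show ?thesis by simp
  qed
  consider "t > 0" | "t = 0" | "t < 0" by linarith
  then show ?thesis
  proof cases
    case 1 then show ?thesis using pos[of t F f] d 0 b by blast
  next
    case 2 then show ?thesis by (simp add: 0)
  next
    case 3
    have "((\<lambda>s. F (- s)) has_vector_derivative - f (- s)) (at s)" for s
    proof -
      have "((\<lambda>s. - s) has_vector_derivative - 1) (at s)"
        by (auto intro!: derivative_eq_intros)
      from vector_diff_chain_at[OF this d] show ?thesis by (simp add: o_def)
    qed
    from pos[of "- t" "\<lambda>s. F (- s)" "\<lambda>s. - f (- s)"] this 3 0 b[of "- _"] show ?thesis by simp
  qed
qed

lemma antiderivative_exists:
  fixes f :: "real \<Rightarrow> 'a::banach"
  assumes f: "continuous_on UNIV f"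
  shows "\<exists>F. F 0 = 0 \<and> (\<forall>t. (F has_vector_derivative f t) (at t))"
proof -
  \<comment> \<open>For \<open>t \<noteq> 0\<close> the interval that runs the wrong way is empty,
    so one formula serves both signs of \<open>t\<close>.\<close>
  define F where "F t = integral {0..t} f - integral {t..0} f" for t
  have int: "f integrable_on {a..b}" for a b :: real
    using f by (intro integrable_continuous_real) (rule continuous_on_subset, auto)
  have "(F has_vector_derivative f t) (at t)" for t
  proof -
    \<comment> \<open>Locally both integrals are rewritten with the common base point
      \<open>-n\<close>, which makes \<open>t\<close> interior to a compact interval and the
      fundamental theorem applicable at zero as well.\<close>
    define n where "n = \<bar>t\<bar> + 1"
    have eq: "F s = integral {-n..s} f - integral {-n..0} f" if "s \<in> {-n<..<n}" for s
    proof (cases "s \<ge> 0")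
      case True
      then have "integral {-n..0} f + integral {0..s} f = integral {-n..s} f"
        by (intro Henstock_Kurzweil_Integration.integral_combine int) (auto simp: n_def)
      moreover have "integral {s..0} f = 0" using True by (cases "s = 0") auto
      ultimately show ?thesis by (simp add: F_def algebra_simps)
    next
      case False
      then have "integral {-n..s} f + integral {s..0} f = integral {-n..0} f"
        using that by (intro Henstock_Kurzweil_Integration.integral_combine int) auto
      with False show ?thesis by (simp add: F_def algebra_simps)
    qed
    have "((\<lambda>s. integral {-n..s} f) has_vector_derivative f t) (at t within {-n..n})"
      by (rule integral_has_vector_derivative) (auto simp: n_def intro: continuous_on_subset[OF f])
    then have "((\<lambda>s. integral {-n..s} f) has_vector_derivative f t) (at t)"
      by (subst (asm) at_within_interior) (auto simp: n_def)
    then have "((\<lambda>s. integral {-n..s} f - integral {-n..0} f) has_vector_derivative f t) (at t)"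
      by (auto intro!: derivative_eq_intros)
    then show ?thesis
      by (rule has_vector_derivative_transform_within_open[where S = "{-n<..<n}"])
        (auto simp: n_def eq)
  qed
  moreover have "F 0 = 0" by (simp add: F_def)
  ultimately show ?thesis by blast
qed

text \<open>Picard iteration for a bounded generator that depends on time. The hypothesis
  \<open>cont\<close> expresses strong rather than norm continuity, because the intended
  \<open>G\<close> conjugates by a unitary group, which in general is only strongly
  continuous.\<close>

lemma linear_ode_exists:
  fixes G :: "real \<Rightarrow> 'a \<Rightarrow> 'a::banach"
  assumes lin: "\<And>t. bounded_linear (G t)" and "M \<ge> 0"
    and bound: "\<And>t x. norm (G t x) \<le> M * norm x"
    and cont: "\<And>v. continuous_on UNIV v \<Longrightarrow> continuous_on UNIV (\<lambda>t. G t (v t))"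
  shows "\<exists>v. v 0 = x \<and> (\<forall>t. (v has_vector_derivative G t (v t)) (at t))"
proof -
  have "\<exists>P. \<forall>f::real \<Rightarrow> 'a. continuous_on UNIV f \<longrightarrow>
      P f (0::real) = (0::'a) \<and> (\<forall>t. (P f has_vector_derivative f t) (at t))"
    by (rule choice) (use antiderivative_exists in blast)
  then obtain P where P0: "\<And>f::real \<Rightarrow> 'a. continuous_on UNIV f \<Longrightarrow> P f (0::real) = 0"
    and Pd: "\<And>(f::real \<Rightarrow> 'a) t. continuous_on UNIV f \<Longrightarrow> (P f has_vector_derivative f t) (at t)"
    by blast
  \<comment> \<open>\<open>V n\<close> is the n-th Dyson term: an \<open>n\<close>-fold iterated
    integral applied to the initial vector.\<close>
  define V where "V = rec_nat (\<lambda>t. x) (\<lambda>n v. P (\<lambda>t. G t (v t)))"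
  have V0: "V 0 = (\<lambda>t. x)" and VS: "V (Suc n) = P (\<lambda>t. G t (V n t))" for n
    by (simp_all add: V_def)
  have cV: "continuous_on UNIV (V n)" for n
  proof (induction n)
    case (Suc n)
    show ?case unfolding VS
      by (intro continuous_at_imp_continuous_on ballI has_vector_derivative_continuous[OF Pd[OF cont[OF Suc]]])
  qed (simp add: V0)
  have dV: "(V (Suc n) has_vector_derivative G t (V n t)) (at t)" for n t
    unfolding VS by (rule Pd[OF cont[OF cV]])
  have VS0: "V (Suc n) 0 = 0" for n
    unfolding VS by (rule P0[OF cont[OF cV]])
  have bV: "norm (V n t) \<le> norm x * (M * \<bar>t\<bar>) ^ n / fact n" for n t
  proof (induction n arbitrary: t)
    case (Suc n)
    have "norm (V (Suc n) t) \<le> (norm x * M ^ Suc n / fact n) * \<bar>t\<bar> ^ Suc n / Suc n"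
    proof (rule norm_le_power_if_derivative_le[OF dV VS0])
      show "norm (G t (V n t)) \<le> norm x * M ^ Suc n / fact n * \<bar>t\<bar> ^ n" for t
      proof -
        have "norm (G t (V n t)) \<le> M * (norm x * (M * \<bar>t\<bar>) ^ n / fact n)"
          using bound[of t "V n t"] mult_left_mono[OF Suc[of t] \<open>M \<ge> 0\<close>] by linarith
        then show ?thesis by (simp add: power_mult_distrib mult_ac)
      qed
    qed
    also have "\<dots> = norm x * (M * \<bar>t\<bar>) ^ Suc n / fact (Suc n)"
      by (simp add: power_mult_distrib field_simps)
    finally show ?case .
  qed (simp add: V0)
  have sumE: "summable (\<lambda>n. norm x * (M * T) ^ n / fact n)" for T
    using summable_mult[OF summable_exp[of "M * T"], of "norm x"] by (simp add: divide_inverse mult_ac)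
  have bVT: "norm (V n t) \<le> norm x * (M * T) ^ n / fact n" if "\<bar>t\<bar> \<le> T" for n t T
  proof -
    have "norm x * (M * \<bar>t\<bar>) ^ n / fact n \<le> norm x * (M * T) ^ n / fact n"
      using that \<open>M \<ge> 0\<close> by (intro divide_right_mono mult_left_mono power_mono) auto
    with bV[of n t] show ?thesis by linarith
  qed
  define v where "v t = (\<Sum>n. V n t)" for t
  have sV: "(\<lambda>n. V n t) sums v t" for t
    unfolding v_def by (intro summable_sums summable_comparison_test'[OF sumE[of "\<bar>t\<bar>"]] bVT) auto
  have "v 0 = x"
  proof -
    have "(\<lambda>n. V n 0) sums (\<Sum>n\<in>{0}. V n 0)"
      by (rule sums_finite) (use VS0 not0_implies_Suc in auto)
    with sums_unique2[OF sV[of 0]] show ?thesis by (simp add: V0)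
  qed
  moreover have "(v has_vector_derivative G t (v t)) (at t)" for t
  proof -
    define T where "T = \<bar>t\<bar> + 1"
    define S where "S = {-T<..<T}"
    \<comment> \<open>The derivative of the n-th term: zero for the constant term
      \<open>V 0\<close>, and otherwise \<open>G\<close> applied to the preceding term. The index
      shift is the reason why the estimate below starts at \<open>Suc N\<close>.\<close>
    define D where "D n s = (case n of 0 \<Rightarrow> 0 | Suc n \<Rightarrow> G s (V n s))" for n s
    have cS: "convex S" unfolding S_def by (rule convex_real_interval)
    have tS: "t \<in> S" by (auto simp: S_def T_def)
    have unif: "uniform_limit S (\<lambda>n s. \<Sum>i<n. V i s) v sequentially"
      unfolding v_def by (rule Weierstrass_m_test[OF _ sumE[of T]]) (auto simp: S_def intro!: bVT)
    have "\<exists>g. \<forall>s\<in>S. (\<lambda>n. V n s) sums (g s) \<and> (g has_derivative (\<lambda>h. h *\<^sub>R G s (v s))) (at s within S)"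
    proof (rule has_derivative_series[where f' = "\<lambda>n s h. h *\<^sub>R D n s"])
      show "(V n has_derivative (\<lambda>h. h *\<^sub>R D n s)) (at s within S)" for n s
        using dV by (cases n) (auto simp: V0 D_def has_vector_derivative_def intro: has_derivative_at_withinI)
      fix e :: real assume "e > 0"
      \<comment> \<open>The summand 1 keeps the quotient meaningful for \<open>M = 0\<close>, and
        \<open>M * (e / (M + 1)) \<le> e\<close> remains true.\<close>
      then have "e / (M + 1) > 0" using \<open>M \<ge> 0\<close> by simp
      from uniform_limitD[OF unif this]
      obtain N where N: "\<And>n s. n \<ge> N \<Longrightarrow> s \<in> S \<Longrightarrow> dist (\<Sum>i<n. V i s) (v s) < e / (M + 1)"
        by (auto simp: eventually_sequentially)
      have "norm ((\<Sum>i<n. h *\<^sub>R D i s) - h *\<^sub>R G s (v s)) \<le> e * norm h" if nN: "n \<ge> Suc N" and sS: "s \<in> S" for n s h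
      proof -
        obtain m where m: "n = Suc m" "m \<ge> N" using nN by (cases n) auto
        have "(\<Sum>i<n. D i s) = (\<Sum>i<m. G s (V i s))"
          unfolding m(1) by (subst sum.lessThan_Suc_shift) (simp add: D_def)
        also have "\<dots> = G s (\<Sum>i<m. V i s)"
          by (simp add: linear_sum[OF bounded_linear.linear[OF lin]])
        finally have "(\<Sum>i<n. D i s) - G s (v s) = G s ((\<Sum>i<m. V i s) - v s)"
          by (simp add: linear_diff[OF bounded_linear.linear[OF lin]])
        then have "norm ((\<Sum>i<n. D i s) - G s (v s)) \<le> M * (e / (M + 1))"
          using bound[of s "(\<Sum>i<m. V i s) - v s"] N[OF m(2) sS] \<open>M \<ge> 0\<close>
          by (smt (verit) dist_norm mult_left_mono)
        also have "\<dots> \<le> e" using \<open>M \<ge> 0\<close> \<open>e > 0\<close> by (simp add: field_simps)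
        finally have "norm ((\<Sum>i<n. D i s) - G s (v s)) \<le> e" .
        then have "norm (h *\<^sub>R ((\<Sum>i<n. D i s) - G s (v s))) \<le> e * norm h"
          by (simp add: mult.commute[of e] mult_left_mono)
        then show ?thesis by (simp add: scaleR_diff_right scaleR_sum_right)
      qed
      then show "\<forall>\<^sub>F n in sequentially. \<forall>s\<in>S. \<forall>h. norm ((\<Sum>i<n. h *\<^sub>R D i s) - h *\<^sub>R G s (v s)) \<le> e * norm h"
        unfolding eventually_sequentially by blast
    qed (rule cS tS sV)+
    then obtain g where g: "\<And>s. s \<in> S \<Longrightarrow> (\<lambda>n. V n s) sums (g s)"
      "\<And>s. s \<in> S \<Longrightarrow> (g has_derivative (\<lambda>h. h *\<^sub>R G s (v s))) (at s within S)" by blast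
    have oS: "open S" by (simp add: S_def)
    have "(g has_vector_derivative G t (v t)) (at t)"
      using g(2)[OF tS] unfolding has_vector_derivative_def at_within_open[OF tS oS] .
    moreover have "g s = v s" if "s \<in> S" for s using sums_unique2[OF g(1)[OF that] sV] .
    ultimately show ?thesis
      by (rule has_vector_derivative_transform_within_open[OF _ oS tS])
  qed
  ultimately show ?thesis by blast
qed

section \<open>Bounded perturbations\<close>

context ugroup
begin

lemma U_inner: "U t x \<bullet> U t y = x \<bullet> y"
  by (simp add: dot_norm flip: U_add)

lemma tendsto_U:
  assumes s: "(s \<longlongrightarrow> s0) F" and q: "(q \<longlongrightarrow> l) F"
  shows "((\<lambda>h. U (s h) (q h)) \<longlongrightarrow> U s0 l) F"
proof -
  have "((\<lambda>h. U (s h) (q h - l)) \<longlongrightarrow> 0) F"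
    by (rule tendsto_norm_zero_cancel) (use tendsto_norm_zero[OF LIM_zero[OF q]] in simp)
  moreover have "((\<lambda>h. U (s h) l) \<longlongrightarrow> U s0 l) F"
    by (rule continuous_on_tendsto_compose[OF U_continuous[of l] s]) simp_all
  ultimately have "((\<lambda>h. U (s h) (q h - l) + U (s h) l) \<longlongrightarrow> 0 + U s0 l) F"
    by (rule tendsto_add)
  then show ?thesis by (simp add: U_diff)
qed

lemma continuous_on_U:
  assumes "continuous_on S s" "continuous_on S v"
  shows "continuous_on S (\<lambda>t. U (s t) (v t))"
  using assms unfolding continuous_on_def by (auto intro: tendsto_U)

text \<open>Interaction picture: with \<open>V t = U t \<circ> W t\<close> the unbounded generator
  disappears, and \<open>W\<close> solves an equation whose generator \<open>G\<close> is bounded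
  and skew. Skewness gives norm conservation and uniqueness of solutions; linearity and the group
  law of \<open>V\<close> then follow by comparing solutions with equal initial values.\<close>

lemma bounded_perturbation:
  assumes B: "bounded_linear B" and BC: "\<And>c x. B (scaleC_l22 c x) = scaleC_l22 c (B x)"
    and skew: "\<And>x. x \<bullet> scaleC_l22 (- \<i>) (B x) = 0"
  shows "\<exists>V. unitary_group_of ((\<lambda>(x, y). (x, y + B x)) ` A) V"
proof -
  interpret B: bounded_linear B by (rule B)
  obtain M where M: "\<And>x. norm (B x) \<le> M * norm x" "M \<ge> 0"
    using B.nonneg_bounded by (auto simp: mult.commute)
  define G where "G t x = scaleC_l22 (- \<i>) (U (- t) (B (U t x)))" for t x
  have blG: "bounded_linear (G t)" for t
    unfolding G_def
    by (intro bounded_linear_compose[OF scaleC.bounded_linear_right] bounded_linear_compose[OF bounded_linear_U]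
        bounded_linear_compose[OF B] bounded_linear_U)
  have bG: "norm (G t x) \<le> M * norm x" for t x
    using M(1)[of "U t x"] by (simp add: G_def norm_scaleC_l22)
  have cG: "continuous_on UNIV (\<lambda>t. G t (v t))" if "continuous_on UNIV v" for v
    unfolding G_def using that
    by (intro bounded_linear.continuous_on[OF scaleC.bounded_linear_right] continuous_on_U B.continuous_on
        continuous_intros)
  have skewG: "x \<bullet> G t x = 0" for t x
  proof -
    have "x \<bullet> G t x = U t x \<bullet> U t (G t x)" by (simp add: U_inner)
    also have "U t (G t x) = scaleC_l22 (- \<i>) (B (U t x))"
      by (simp add: G_def U_scaleC U_U)
    finally show ?thesis by (simp only: skew)
  qed
  have "\<exists>v. v 0 = x \<and> (\<forall>t. (v has_vector_derivative G t (v t)) (at t))" for x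
    using linear_ode_exists[OF blG M(2) bG cG] by blast
  then obtain W where W0: "\<And>x. W x 0 = x"
    and W: "\<And>x t. (W x has_vector_derivative G t (W x t)) (at t)" by metis
  have uniq: "v t = W (v 0) t" if v: "\<And>t. (v has_vector_derivative G t (v t)) (at t)" for v t
  proof -
    have "norm (v t - W (v 0) t) = norm (v 0 - W (v 0) 0)"
    proof (rule constant_norm_if_skew_derivative)
      show "((\<lambda>t. v t - W (v 0) t) has_vector_derivative G t (v t - W (v 0) t)) (at t)" for t
        using has_vector_derivative_diff[OF v W] 
        by (simp add: linear_diff[OF bounded_linear.linear[OF blG]])
    qed (rule skewG)
    then show ?thesis by (simp add: W0)
  qed
  have normW: "norm (W x t) = norm x" for x t
    using constant_norm_if_skew_derivative[OF W skewG, of x t 0] by (simp add: W0)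
  have addW: "W (x + y) t = W x t + W y t" for x y t
  proof -
    have "((\<lambda>t. W x t + W y t) has_vector_derivative G t (W x t + W y t)) (at t)" for t
      using has_vector_derivative_add[OF W W] by (simp add: linear_add[OF bounded_linear.linear[OF blG]])
    from uniq[OF this] show ?thesis by (simp add: W0)
  qed
  have GC: "G t (scaleC_l22 c x) = scaleC_l22 c (G t x)" for t c x
    by (simp add: G_def U_scaleC BC scaleC_l22_scaleC mult.commute)
  have scaleW: "W (scaleC_l22 c x) t = scaleC_l22 c (W x t)" for c x t
  proof -
    have "((\<lambda>t. scaleC_l22 c (W x t)) has_vector_derivative G t (scaleC_l22 c (W x t))) (at t)" for t
      unfolding GC by (intro bounded_linear.has_vector_derivative[OF scaleC.bounded_linear_right] W)
    from uniq[OF this] show ?thesis by (simp add: W0)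
  qed
  have contW: "continuous_on UNIV (W x)" for x
    by (intro continuous_at_imp_continuous_on ballI has_vector_derivative_continuous[OF W])
  define V where "V t x = U t (W x t)" for t x
  have V0: "V 0 x = x" for x by (simp add: V_def W0)
  have VV: "V t (V s x) = V (t + s) x" for s t x
  proof -
    \<comment> \<open>Translating time by \<open>s\<close> and applying \<open>U s\<close> maps
      solutions to solutions. At \<open>t = 0\<close> the new solution equals \<open>V s x\<close>,
      so uniqueness yields the group law.\<close>
    have "((\<lambda>t. U s (W x (t + s))) has_vector_derivative G t (U s (W x (t + s)))) (at t)" for t
    proof -
      have "((\<lambda>t. t + s) has_vector_derivative 1) (at t)"
        by (auto intro!: derivative_eq_intros)
      from vector_diff_chain_at[OF this W]
      have "((\<lambda>t. W x (t + s)) has_vector_derivative G (t + s) (W x (t + s))) (at t)"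
        by (simp add: o_def)
      from bounded_linear.has_vector_derivative[OF bounded_linear_U this, of s]
      show ?thesis by (simp add: G_def U_scaleC U_U)
    qed
    from uniq[OF this, of t, symmetric] show ?thesis by (simp add: V_def U_U)
  qed
  have gen: "(x, z) \<in> (\<lambda>(x, y). (x, y + B x)) ` A \<longleftrightarrow>
     ((\<lambda>t. V t x) has_vector_derivative scaleC_l22 (- \<i>) z) (at 0)" for x z
  proof -
    have "((\<lambda>h. U h ((W x h - x) /\<^sub>R h)) \<longlongrightarrow> U 0 (G 0 x)) (at 0)"
      using W[of x 0] by (intro tendsto_U tendsto_ident_at) (simp add: W0 has_vector_derivative_at_0)
    then have l: "((\<lambda>h. U h ((W x h - x) /\<^sub>R h)) \<longlongrightarrow> scaleC_l22 (- \<i>) (B x)) (at 0)"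
      by (simp add: G_def)
    \<comment> \<open>The second summand converges to \<open>- \<i>\<close> times \<open>B x\<close>
      for every \<open>x\<close>. Hence both groups are differentiable at zero on the same vectors,
      and the domain does not change.\<close>
    have eq: "(V h x - x) /\<^sub>R h = (U h x - x) /\<^sub>R h + U h ((W x h - x) /\<^sub>R h)" for h
      by (simp add: V_def U_diff U_scaleR algebra_simps)
    have "((\<lambda>h. (V h x - x) /\<^sub>R h) \<longlongrightarrow> scaleC_l22 (- \<i>) z) (at 0) \<longleftrightarrow>
       ((\<lambda>h. (U h x - x) /\<^sub>R h) \<longlongrightarrow> scaleC_l22 (- \<i>) (z - B x)) (at 0)"
      (is "?L \<longleftrightarrow> ?R")
    proof
      assume ?L from tendsto_diff[OF this l] show ?R
        by (simp add: eq scaleC.diff_right)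
    next
      assume ?R from tendsto_add[OF this l] show ?L
        by (simp add: eq scaleC.diff_right)
    qed
    moreover have "(x, z) \<in> (\<lambda>(x, y). (x, y + B x)) ` A \<longleftrightarrow> (x, z - B x) \<in> A"
      by (auto simp: image_iff intro!: bexI[of _ "(x, z - B x)"])
    ultimately show ?thesis
      by (simp add: generator_iff has_vector_derivative_at_0 V0)
  qed
  have "unitary_group_of ((\<lambda>(x, y). (x, y + B x)) ` A) V"
    unfolding unitary_group_of_def unitary_def
  proof (intro conjI allI)
    show "V t (x + y) = V t x + V t y" for t x y by (simp add: V_def addW U_add)
    show "V t (scaleC_l22 c x) = scaleC_l22 c (V t x)" for t c x by (simp add: V_def scaleW U_scaleC)
    show "norm (V t x) = norm x" for t x by (simp add: V_def normW)
    show "surj (V t)" for t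
      by (rule surjI[where f = "V (- t)"]) (simp add: VV V0)
    show "V 0 = id" by (simp add: fun_eq_iff V0)
    show "V (s + t) = V s \<circ> V t" for s t by (simp add: fun_eq_iff VV)
    show "continuous_on UNIV (\<lambda>t. V t x)" for x
      unfolding V_def by (intro continuous_on_U contW continuous_intros)
  qed (rule gen)
  then show ?thesis by blast
qed

end

text \<open>Adding a continuous operator is a homeomorphism of the product space, with subtraction
  of \<open>B x\<close> as inverse, so it commutes with taking the closure of a graph.\<close>

lemma closure_shear:
  fixes B :: "'a::real_normed_vector \<Rightarrow> 'b::real_normed_vector"
  assumes "continuous_on UNIV B"
  shows "closure ((\<lambda>(x, y). (x, y + B x)) ` G) = (\<lambda>(x, y). (x, y + B x)) ` closure G"
proof -
  define p where "p = (\<lambda>(x, y). (x, y + B x))"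
  define q where "q = (\<lambda>(x, y). (x, y - B x))"
  have c: "continuous_on S p" "continuous_on S q" for S
    unfolding p_def q_def case_prod_unfold
    by (intro continuous_intros continuous_on_compose2[OF assms]; simp)+
  have pq: "p (q z) = z" "q (p z) = z" for z by (auto simp: p_def q_def split: prod.splits)
  have sub: "f ` closure S \<subseteq> closure (f ` S)" if "\<And>S. continuous_on S f" for f :: "'a \<times> 'b \<Rightarrow> 'a \<times> 'b" and S
    by (rule image_closure_subset[OF that closed_closure closure_subset])
  have "q ` closure (p ` G) \<subseteq> closure (q ` p ` G)" by (rule sub) (rule c)
  then have "q ` closure (p ` G) \<subseteq> closure G" by (simp add: image_image pq)
  then have "p ` q ` closure (p ` G) \<subseteq> p ` closure G" by blast
  then have "closure (p ` G) \<subseteq> p ` closure G" by (simp add: image_image pq)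
  moreover have "p ` closure G \<subseteq> closure (p ` G)" by (rule sub) (rule c)
  ultimately show ?thesis unfolding p_def by blast
qed

section \<open>Schwartz functions\<close>

lemma ddx_eqI: "(\<And>x. (f has_vector_derivative f' x) (at x)) \<Longrightarrow> ddx f = f'"
  unfolding ddx_def by (intro ext vector_derivative_at)

lemma schwartz_derivative: "f \<in> schwartz \<Longrightarrow> (f has_vector_derivative ddx f x) (at x)"
  unfolding ddx_def schwartz_def mem_Collect_eq vector_derivative_works[symmetric]
  by (metis funpow_0)

lemma schwartz_bounded:
  assumes "f \<in> schwartz"
  shows "\<exists>K. \<forall>x. norm (of_real (x ^ k) * f x) \<le> K"
proof -
  have "bounded (range (\<lambda>x. of_real (x ^ k) * (ddx ^^ 0) f x))"
    using assms unfolding schwartz_def by blast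
  then show ?thesis by (auto simp: bounded_iff)
qed

lemma ddx_schwartz: "f \<in> schwartz \<Longrightarrow> ddx f \<in> schwartz"
  unfolding schwartz_def mem_Collect_eq
  by (metis funpow_Suc_right comp_apply)

text \<open>Membership is proved by exhibiting a family closed under differentiation whose members
  all decay rapidly, which avoids formulas for derivatives of arbitrary order.\<close>

lemma schwartz_coinduct:
  assumes "f \<in> S"
    and der: "\<And>f. f \<in> S \<Longrightarrow> \<exists>f'\<in>S. \<forall>x. (f has_vector_derivative f' x) (at x)"
    and bd: "\<And>f k. f \<in> S \<Longrightarrow> \<exists>K. \<forall>x. norm (of_real (x ^ k) * f x) \<le> K"
  shows "f \<in> schwartz"
proof -
  have S: "(ddx ^^ m) f \<in> S" for m
  proof (induction m)
    case (Suc m)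
    from der[OF this] obtain f' where "f' \<in> S" "\<forall>x. ((ddx ^^ m) f has_vector_derivative f' x) (at x)" by blast
    with ddx_eqI[of "(ddx ^^ m) f" f'] show ?case by simp
  qed (simp add: assms(1))
  have "(ddx ^^ m) f differentiable (at x)" for m x
    using der[OF S[of m]] by (auto simp: differentiable_def has_vector_derivative_def)
  moreover have "bounded (range (\<lambda>x. of_real (x ^ k) * (ddx ^^ m) f x))" for k m
    using bd[OF S[of m]] by (auto simp: bounded_iff)
  ultimately show ?thesis unfolding schwartz_def by blast
qed

lemma schwartz_lincomb:
  assumes "f \<in> schwartz" "g \<in> schwartz"
  shows "(\<lambda>x. c * f x + d * g x) \<in> schwartz"
proof (rule schwartz_coinduct[where S = "{\<lambda>x. c * f x + d * g x | f g. f \<in> schwartz \<and> g \<in> schwartz}"])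
  fix h assume "h \<in> {\<lambda>x. c * f x + d * g x | f g. f \<in> schwartz \<and> g \<in> schwartz}"
  then obtain f g where h: "h = (\<lambda>x. c * f x + d * g x)" and fg: "f \<in> schwartz" "g \<in> schwartz" by blast
  have der: "(h has_vector_derivative c * ddx f x + d * ddx g x) (at x)" for x
    unfolding h by (intro has_vector_derivative_add has_vector_derivative_mult_right schwartz_derivative fg)
  have mem: "(\<lambda>x. c * ddx f x + d * ddx g x) \<in> {\<lambda>x. c * f x + d * g x | f g. f \<in> schwartz \<and> g \<in> schwartz}"
    using ddx_schwartz[OF fg(1)] ddx_schwartz[OF fg(2)] by blast
  show "\<exists>f'\<in>{\<lambda>x. c * f x + d * g x | f g. f \<in> schwartz \<and> g \<in> schwartz}. \<forall>x. (h has_vector_derivative f' x) (at x)"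
    by (rule bexI[OF _ mem]) (intro allI der)
  fix k
  obtain K L where K: "\<And>x. norm (of_real (x ^ k) * f x) \<le> K" and L: "\<And>x. norm (of_real (x ^ k) * g x) \<le> L"
    using schwartz_bounded fg by meson
  have "norm (of_real (x ^ k) * h x) \<le> norm c * K + norm d * L" for x
  proof -
    have "of_real (x ^ k) * h x = c * (of_real (x ^ k) * f x) + d * (of_real (x ^ k) * g x)"
      by (simp add: h algebra_simps)
    also have "norm \<dots> \<le> norm (c * (of_real (x ^ k) * f x)) + norm (d * (of_real (x ^ k) * g x))"
      by (rule norm_triangle_ineq)
    also have "\<dots> \<le> norm c * K + norm d * L"
      unfolding norm_mult[of c] norm_mult[of d] by (intro add_mono mult_left_mono K L) auto
    finally show ?thesis .
  qed
  then show "\<exists>K. \<forall>x. norm (of_real (x ^ k) * h x) \<le> K" by blast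
qed (use assms in blast)

lemma schwartz_cmult: "f \<in> schwartz \<Longrightarrow> (\<lambda>x. c * f x) \<in> schwartz"
  using schwartz_lincomb[of f f c 0] by simp
lemma schwartz_add: "f \<in> schwartz \<Longrightarrow> g \<in> schwartz \<Longrightarrow> (\<lambda>x. f x + g x) \<in> schwartz"
  using schwartz_lincomb[of f g 1 1] by simp
lemma schwartz_diff: "f \<in> schwartz \<Longrightarrow> g \<in> schwartz \<Longrightarrow> (\<lambda>x. f x - g x) \<in> schwartz"
  using schwartz_lincomb[of f g 1 "-1"] by simp

lemma of_real_has_vector_derivative: "((\<lambda>x. complex_of_real x) has_vector_derivative 1) (at x)"
  by (rule has_vector_derivative_real_field[where f = "\<lambda>z. z", OF DERIV_ident])

text \<open>Functions of the form \<open>x f\<close> are not visibly closed under differentiation.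
  The extra summand \<open>g\<close> in the family absorbs the term \<open>f\<close> that the
  product rule produces.\<close>

lemma schwartz_x:
  assumes "f \<in> schwartz"
  shows "(\<lambda>x. of_real x * f x) \<in> schwartz"
proof (rule schwartz_coinduct[where S = "{\<lambda>x. of_real x * f x + g x | f g. f \<in> schwartz \<and> g \<in> schwartz}"])
  have "(\<lambda>x. 0) \<in> schwartz" using schwartz_cmult[OF assms, of 0] by simp
  with assms show "(\<lambda>x. of_real x * f x) \<in> {\<lambda>x. of_real x * f x + g x | f g. f \<in> schwartz \<and> g \<in> schwartz}"
    by (intro CollectI exI[of _ f] exI[of _ "\<lambda>x. 0"]) simp
next
  fix h assume "h \<in> {\<lambda>x. complex_of_real x * f x + g x | f g. f \<in> schwartz \<and> g \<in> schwartz}"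
  then obtain f g where h: "h = (\<lambda>x. of_real x * f x + g x)" and fg: "f \<in> schwartz" "g \<in> schwartz" by blast
  have der: "(h has_vector_derivative of_real x * ddx f x + (f x + ddx g x)) (at x)" for x
  proof -
    from has_vector_derivative_add[OF has_vector_derivative_mult[OF of_real_has_vector_derivative schwartz_derivative[OF fg(1)]] schwartz_derivative[OF fg(2)]]
    show ?thesis unfolding h by (simp add: add.assoc)
  qed
  have mem: "(\<lambda>x. of_real x * ddx f x + (f x + ddx g x)) \<in> {\<lambda>x. of_real x * f x + g x | f g. f \<in> schwartz \<and> g \<in> schwartz}"
    using ddx_schwartz[OF fg(1)] schwartz_add[OF fg(1) ddx_schwartz[OF fg(2)]]
    by (intro CollectI exI[of _ "ddx f"] exI[of _ "\<lambda>x. f x + ddx g x"]) simp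
  show "\<exists>f'\<in>{\<lambda>x. of_real x * f x + g x | f g. f \<in> schwartz \<and> g \<in> schwartz}. \<forall>x. (h has_vector_derivative f' x) (at x)"
    by (rule bexI[OF _ mem]) (intro allI der)
  fix k
  obtain K L where K: "\<And>x. norm (of_real (x ^ Suc k) * f x) \<le> K" and L: "\<And>x. norm (of_real (x ^ k) * g x) \<le> L"
    using schwartz_bounded fg by meson
  have "norm (of_real (x ^ k) * h x) \<le> K + L" for x
  proof -
    have *: "of_real (x ^ k) * h x = of_real (x ^ Suc k) * f x + of_real (x ^ k) * g x"
      by (simp add: h algebra_simps)
    from norm_triangle_ineq[of "of_real (x ^ Suc k) * f x" "of_real (x ^ k) * g x"] K[of x] L[of x]
    show ?thesis unfolding * by linarith
  qed
  then show "\<exists>K. \<forall>x. norm (of_real (x ^ k) * h x) \<le> K" by blast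
qed

lemma ann_schwartz: "f \<in> schwartz \<Longrightarrow> ann f \<in> schwartz"
  unfolding ann_def by (intro schwartz_cmult schwartz_add schwartz_x ddx_schwartz)
lemma cre_schwartz: "f \<in> schwartz \<Longrightarrow> cre f \<in> schwartz"
  unfolding cre_def by (intro schwartz_cmult schwartz_diff schwartz_x ddx_schwartz)

lemma ddx_lincomb:
  "f \<in> schwartz \<Longrightarrow> g \<in> schwartz \<Longrightarrow> ddx (\<lambda>x. c * f x + d * g x) = (\<lambda>x. c * ddx f x + d * ddx g x)"
  by (intro ddx_eqI has_vector_derivative_add has_vector_derivative_mult_right schwartz_derivative)

lemma ann_lincomb:
  "f \<in> schwartz \<Longrightarrow> g \<in> schwartz \<Longrightarrow> ann (\<lambda>x. c * f x + d * g x) = (\<lambda>x. c * ann f x + d * ann g x)"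
  by (simp add: ann_def ddx_lincomb fun_eq_iff algebra_simps)
lemma cre_lincomb:
  "f \<in> schwartz \<Longrightarrow> g \<in> schwartz \<Longrightarrow> cre (\<lambda>x. c * f x + d * g x) = (\<lambda>x. c * cre f x + d * cre g x)"
  by (simp add: cre_def ddx_lincomb fun_eq_iff algebra_simps)
lemma ann_cmult: "f \<in> schwartz \<Longrightarrow> ann (\<lambda>x. c * f x) = (\<lambda>x. c * ann f x)"
  using ann_lincomb[of f f c 0] by simp
lemma cre_cmult: "f \<in> schwartz \<Longrightarrow> cre (\<lambda>x. c * f x) = (\<lambda>x. c * cre f x)"
  using cre_lincomb[of f f c 0] by simp

lemma ddx_x: "f \<in> schwartz \<Longrightarrow> ddx (\<lambda>x. of_real x * f x) = (\<lambda>x. of_real x * ddx f x + f x)"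
proof (rule ddx_eqI)
  fix x :: real assume f: "f \<in> schwartz"
  from has_vector_derivative_mult[OF of_real_has_vector_derivative schwartz_derivative[OF f]]
  show "((\<lambda>x. of_real x * f x) has_vector_derivative of_real x * ddx f x + f x) (at x)" by simp
qed

lemma canonical_commutation:
  assumes "f \<in> schwartz"
  shows "ann (cre f) x = cre (ann f) x + f x"
proof -
  have d: "ddx (\<lambda>x. c * (of_real x * f x + s * ddx f x)) x
      = c * ((of_real x * ddx f x + f x) + s * ddx (ddx f) x)" for c s
  proof -
    have "ddx (\<lambda>x. c * (of_real x * f x) + (c * s) * ddx f x)
      = (\<lambda>x. c * (of_real x * ddx f x + f x) + (c * s) * ddx (ddx f) x)"
      using ddx_lincomb[OF schwartz_x[OF assms] ddx_schwartz[OF assms]] by (simp add: ddx_x assms)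
    then show ?thesis by (simp add: ring_distribs mult.assoc)
  qed
  define r where "r = complex_of_real (1 / sqrt 2)"
  have r: "r * (r * z) = z / 2" for z
  proof -
    have "r * r = 1/2" by (simp add: r_def flip: of_real_mult)
    then show ?thesis by (simp add: mult.assoc[symmetric])
  qed
  have a: "ann g = (\<lambda>x. r * (of_real x * g x + ddx g x))" and c: "cre g = (\<lambda>x. r * (of_real x * g x - ddx g x))" for g
    by (simp_all add: ann_def cre_def r_def)
  have dc: "ddx (cre f) x = r * ((of_real x * ddx f x + f x) - ddx (ddx f) x)"
    using d[of r "-1"] by (simp add: c)
  have da: "ddx (ann f) x = r * ((of_real x * ddx f x + f x) + ddx (ddx f) x)"
    using d[of r 1] by (simp add: a)
  have "ann (cre f) x = r * (r * (of_real x * (of_real x * f x - ddx f x) + ((of_real x * ddx f x + f x) - ddx (ddx f) x)))"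
    unfolding a[of "cre f"] dc unfolding c by (simp add: ring_distribs mult_ac)
  moreover have "cre (ann f) x = r * (r * (of_real x * (of_real x * f x + ddx f x) - ((of_real x * ddx f x + f x) + ddx (ddx f) x)))"
    unfolding c[of "ann f"] da unfolding a by (simp add: ring_distribs mult_ac)
  ultimately have "ann (cre f) x = (of_real x * (of_real x * f x - ddx f x) + ((of_real x * ddx f x + f x) - ddx (ddx f) x)) / 2"
    "cre (ann f) x = (of_real x * (of_real x * f x + ddx f x) - ((of_real x * ddx f x + f x) + ddx (ddx f) x)) / 2"
    unfolding r by simp_all
  note eqs = this
  show ?thesis unfolding eqs by (simp add: field_simps)
qed

lemma schwartz_continuous: "f \<in> schwartz \<Longrightarrow> continuous_on UNIV f"
  by (intro continuous_at_imp_continuous_on ballI has_vector_derivative_continuous[OF schwartz_derivative])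

lemma schwartz_decay:
  assumes "f \<in> schwartz"
  shows "\<exists>K. \<forall>x. norm (f x) \<le> K * inverse (1 + x\<^sup>2)"
proof -
  obtain K L where K: "\<And>x. norm (of_real (x ^ 0) * f x) \<le> K" and L: "\<And>x. norm (of_real (x ^ 2) * f x) \<le> L"
    using schwartz_bounded[OF assms] by meson
  have "norm (f x) \<le> (K + L) * inverse (1 + x\<^sup>2)" for x
  proof -
    have "norm (f x) * (1 + x\<^sup>2) \<le> K + L"
      using K[of x] L[of x] by (simp add: norm_mult norm_power algebra_simps)
    moreover have "1 + x\<^sup>2 > 0" by (smt (verit) zero_le_power2)
    ultimately show ?thesis by (simp add: field_simps)
  qed
  then show ?thesis by blast
qed

lemma integrable_inverse_square: "integrable lborel (\<lambda>x::real. inverse (1 + x\<^sup>2))"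
  using integrable_inverse_1_plus_square by (simp add: set_integrable_def einterval_def)

lemma integrable_schwartz_mult:
  assumes f: "f \<in> schwartz" and g: "g \<in> schwartz"
  shows "integrable lborel (\<lambda>x. cnj (f x) * g x)"
proof -
  obtain K where K: "\<And>x. norm (f x) \<le> K * inverse (1 + x\<^sup>2)" using schwartz_decay[OF f] by blast
  obtain L where L: "\<And>x. norm (of_real (x ^ 0) * g x) \<le> L" using schwartz_bounded[OF g] by blast
  show ?thesis
  proof (rule Bochner_Integration.integrable_bound)
    show "integrable lborel (\<lambda>x. K * inverse (1 + x\<^sup>2) * L)"
      using integrable_inverse_square by simp
    show "(\<lambda>x. cnj (f x) * g x) \<in> borel_measurable lborel"
      using schwartz_continuous[OF f] schwartz_continuous[OF g]
      by (auto intro!: borel_measurable_continuous_onI continuous_intros)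
    have "norm (cnj (f x) * g x) \<le> norm (K * inverse (1 + x\<^sup>2) * L)" for x
    proof -
      have "norm (cnj (f x) * g x) \<le> (K * inverse (1 + x\<^sup>2)) * L"
        unfolding norm_mult complex_mod_cnj using K[of x] L[of x]
        by (intro mult_mono) (auto intro: order_trans[OF norm_ge_zero])
      then show ?thesis by simp
    qed
    then show "AE x in lborel. norm (cnj (f x) * g x) \<le> norm (K * inverse (1 + x\<^sup>2) * L)" by simp
  qed
qed

lemma square_integrable_schwartz:
  assumes "f \<in> schwartz"
  shows "square_integrable f"
proof -
  have "integrable lborel (\<lambda>x. Re (cnj (f x) * f x))"
    using integrable_schwartz_mult[OF assms assms] by (rule integrable_Re)
  moreover have "f \<in> borel_measurable borel"
    by (intro borel_measurable_continuous_onI schwartz_continuous assms)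
  moreover have "(\<lambda>x. Re (cnj (f x) * f x)) = (\<lambda>x. (norm (f x))\<^sup>2)"
    by (simp add: fun_eq_iff cmod_power2 flip: power2_eq_square)
  ultimately show ?thesis by (simp add: square_integrable_def)
qed

lemma schwartz_integral_derivative_zero:
  assumes f: "f \<in> schwartz" and g: "g \<in> schwartz"
  shows "(LINT x|lborel. cnj (f x) * ddx g x + cnj (ddx f x) * g x) = 0"
proof -
  define F where "F x = cnj (f x) * g x" for x
  define F' where "F' x = cnj (f x) * ddx g x + cnj (ddx f x) * g x" for x
  have int: "integrable lborel F'"
    unfolding F'_def by (intro Bochner_Integration.integrable_add integrable_schwartz_mult f g ddx_schwartz)
  have d: "(F has_vector_derivative F' x) (at x)" for x
    unfolding F_def F'_def
    by (intro has_vector_derivative_mult has_vector_derivative_cnj schwartz_derivative f g)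
  have c: "continuous_on UNIV F'"
    unfolding F'_def by (intro continuous_intros schwartz_continuous ddx_schwartz f g)
  obtain K where K: "\<And>x. norm (f x) \<le> K * inverse (1 + x\<^sup>2)" using schwartz_decay[OF f] by blast
  obtain L where L: "\<And>x. norm (of_real (x ^ 0) * g x) \<le> L" using schwartz_bounded[OF g] by blast
  have b: "norm (F x) \<le> L * K * inverse (1 + x\<^sup>2)" for x
  proof -
    have "norm (F x) \<le> (K * inverse (1 + x\<^sup>2)) * L"
      unfolding F_def norm_mult complex_mod_cnj using K[of x] L[of x]
      by (intro mult_mono) (auto intro: order_trans[OF norm_ge_zero])
    then show ?thesis by (simp add: mult_ac)
  qed
  have top: "((\<lambda>x::real. L * K * inverse (1 + x\<^sup>2)) \<longlongrightarrow> 0) at_top" by real_asymp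
  have bot: "((\<lambda>x::real. L * K * inverse (1 + x\<^sup>2)) \<longlongrightarrow> 0) at_bot" by real_asymp
  have "(LBINT x=-\<infinity>..\<infinity>. F' x) = 0 - 0"
  proof (rule interval_integral_FTC_integrable[OF _ d])
    show "isCont F' x" for x using c by (simp add: continuous_on_eq_continuous_at)
    show "set_integrable lborel (einterval (- \<infinity>) \<infinity>) F'"
      using int by (simp add: set_integrable_def einterval_def)
    show "((F \<circ> real_of_ereal) \<longlongrightarrow> 0) (at_right (- \<infinity>))"
      unfolding ereal_tendsto_simps by (rule Lim_null_comparison[OF always_eventually bot]) (use b in blast)
    show "((F \<circ> real_of_ereal) \<longlongrightarrow> 0) (at_left \<infinity>)"
      unfolding ereal_tendsto_simps by (rule Lim_null_comparison[OF always_eventually top]) (use b in blast)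
  qed simp
  then show ?thesis
    by (simp add: interval_lebesgue_integral_def set_lebesgue_integral_def einterval_def F'_def)
qed

section \<open>The inner product on representatives and adjointness of the ladder operators\<close>

definition hip :: "(real \<Rightarrow> complex) \<Rightarrow> (real \<Rightarrow> complex) \<Rightarrow> complex" where
  "hip f g = (LINT x|lborel. cnj (f x) * g x)"

lemma hip_commute: "hip g f = cnj (hip f g)"
  unfolding hip_def Bochner_Integration.integral_cnj[symmetric] by (simp del: Bochner_Integration.integral_cnj add: mult.commute)

lemma hip_lincomb_right:
  assumes "f \<in> schwartz" "g \<in> schwartz" "h \<in> schwartz"
  shows "hip f (\<lambda>x. c * g x + d * h x) = c * hip f g + d * hip f h"
proof -
  have "hip f (\<lambda>x. c * g x + d * h x) = (LINT x|lborel. c * (cnj (f x) * g x) + d * (cnj (f x) * h x))"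
    unfolding hip_def by (intro Bochner_Integration.integral_cong) (auto simp: algebra_simps)
  also have "\<dots> = c * hip f g + d * hip f h"
    unfolding hip_def using assms
    by (subst Bochner_Integration.integral_add) (auto intro!: integrable_schwartz_mult)
  finally show ?thesis .
qed

lemma hip_cmult_right: "hip f (\<lambda>x. c * g x) = c * hip f g"
  unfolding hip_def by (simp add: mult.left_commute[of _ c])
lemma hip_add_right: "f \<in> schwartz \<Longrightarrow> g \<in> schwartz \<Longrightarrow> h \<in> schwartz \<Longrightarrow>
    hip f (\<lambda>x. g x + h x) = hip f g + hip f h"
  using hip_lincomb_right[of f g h 1 1] by simp
lemma hip_cmult_left: "hip (\<lambda>x. c * f x) g = cnj c * hip f g"
  by (subst (1 2) hip_commute) (simp add: hip_cmult_right)
lemma hip_add_left: "f \<in> schwartz \<Longrightarrow> g \<in> schwartz \<Longrightarrow> h \<in> schwartz \<Longrightarrow>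
    hip (\<lambda>x. g x + h x) f = hip g f + hip h f"
  by (subst (1 2 3) hip_commute) (simp add: hip_add_right)

lemma hip_lincomb_left:
  assumes "f \<in> schwartz" "g \<in> schwartz" "h \<in> schwartz"
  shows "hip (\<lambda>x. c * g x + d * h x) f = cnj c * hip g f + cnj d * hip h f"
  using assms by (subst (1 2 3) hip_commute) (simp add: hip_lincomb_right)

lemma hip_ddx:
  assumes f: "f \<in> schwartz" and g: "g \<in> schwartz"
  shows "hip f (ddx g) = - hip (ddx f) g"
proof -
  have "hip f (ddx g) + hip (ddx f) g = 0"
    using schwartz_integral_derivative_zero[OF f g] unfolding hip_def
    by (subst (asm) Bochner_Integration.integral_add) (auto intro: integrable_schwartz_mult ddx_schwartz f g)
  then show ?thesis by (simp add: add_eq_0_iff)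
qed

lemma hip_ann:
  assumes f: "f \<in> schwartz" and g: "g \<in> schwartz"
  shows "hip f (ann g) = hip (cre f) g"
proof -
  define r where "r = complex_of_real (1 / sqrt 2)"
  have r: "cnj r = r" by (simp add: r_def)
  have x: "hip f (\<lambda>x. of_real x * g x) = hip (\<lambda>x. of_real x * f x) g"
    unfolding hip_def by (intro Bochner_Integration.integral_cong) auto
  have "ann g = (\<lambda>x. r * (of_real x * g x) + r * ddx g x)"
    by (simp add: ann_def r_def fun_eq_iff algebra_simps)
  then have "hip f (ann g) = r * hip f (\<lambda>x. of_real x * g x) + r * hip f (ddx g)"
    by (simp add: hip_lincomb_right f g schwartz_x ddx_schwartz)
  moreover have "cre f = (\<lambda>x. r * (of_real x * f x) + (- r) * ddx f x)"
    by (simp add: cre_def r_def fun_eq_iff algebra_simps)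
  then have "hip (cre f) g = r * hip (\<lambda>x. of_real x * f x) g - r * hip (ddx f) g"
    using hip_lincomb_left[OF g schwartz_x[OF f] ddx_schwartz[OF f], of r "- r"] by (simp add: r)
  ultimately show ?thesis by (simp add: x hip_ddx f g)
qed

lemma hip_cre: "f \<in> schwartz \<Longrightarrow> g \<in> schwartz \<Longrightarrow> hip f (cre g) = hip (ann f) g"
  by (metis hip_ann hip_commute)

section \<open>Hermite functions\<close>

text \<open>One family, closed under differentiation, that supplies the oscillator ground state
  (\<open>b = 0\<close>), the boosted packets (\<open>b\<close> imaginary) and the exponential
  majorants in the completeness proof (\<open>b\<close> real).\<close>

definition gauss :: "complex poly \<Rightarrow> real \<Rightarrow> complex \<Rightarrow> real \<Rightarrow> complex" where
  "gauss p a b x = poly p (of_real x) * exp (- of_real a * (of_real x)\<^sup>2 + b * of_real x)"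

lemma gauss_has_vector_derivative:
  "(gauss p a b has_vector_derivative gauss (pderiv p + p * [:b, - 2 * of_real a:]) a b x) (at x)"
proof -
  have "((\<lambda>z. poly p z * exp (- of_real a * z\<^sup>2 + b * z)) has_field_derivative
     poly (pderiv p + p * [:b, - 2 * of_real a:]) (of_real x) * exp (- of_real a * (of_real x)\<^sup>2 + b * of_real x)) (at (of_real x))"
    by (rule derivative_eq_intros refl | simp add: algebra_simps)+
  from has_vector_derivative_real_field[OF this] show ?thesis
    unfolding gauss_def .
qed

text \<open>The power is absorbed by \<open>fact k * exp \<bar>x\<bar>\<close>; completing the
  square then bounds the total exponent.\<close>

lemma gauss_monom_bounded:
  assumes "a > 0"
  shows "\<exists>K. \<forall>x::real. \<bar>x\<bar> ^ k * exp (- a * x\<^sup>2 + b * x) \<le> K"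
proof -
  have "\<bar>x\<bar> ^ k * exp (- a * x\<^sup>2 + b * x) \<le> fact k * exp ((\<bar>b\<bar> + 1)\<^sup>2 / (4 * a))" for x :: real
  proof -
    have "\<bar>x\<bar> ^ k / fact k \<le> exp \<bar>x\<bar>"
    proof -
      have "(\<Sum>n\<in>{k}. \<bar>x\<bar> ^ n /\<^sub>R fact n) \<le> (\<Sum>n. \<bar>x\<bar> ^ n /\<^sub>R fact n)"
        by (intro sum_le_suminf summable_exp_generic) auto
      then show ?thesis by (simp add: exp_def divide_inverse mult.commute)
    qed
    then have "\<bar>x\<bar> ^ k * exp (- a * x\<^sup>2 + b * x) \<le> (fact k * exp \<bar>x\<bar>) * exp (- a * x\<^sup>2 + b * x)"
      by (intro mult_right_mono) (auto simp: field_simps)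
    also have "\<dots> = fact k * exp (\<bar>x\<bar> + (- a * x\<^sup>2 + b * x))"
      by (simp add: exp_add)
    also have "\<dots> \<le> fact k * exp ((\<bar>b\<bar> + 1)\<^sup>2 / (4 * a))"
    proof -
      have "b * x \<le> \<bar>b\<bar> * \<bar>x\<bar>" by (metis abs_ge_self abs_mult)
      moreover have "0 \<le> a * y\<^sup>2 - (\<bar>b\<bar> + 1) * y + (\<bar>b\<bar> + 1)\<^sup>2 / (4 * a)" for y
      proof -
        have "a * y\<^sup>2 - (\<bar>b\<bar> + 1) * y + (\<bar>b\<bar> + 1)\<^sup>2 / (4 * a) = (2 * a * y - (\<bar>b\<bar> + 1))\<^sup>2 / (4 * a)"
          using assms by (simp add: power2_eq_square field_simps)
        then show ?thesis using assms by simp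
      qed
      from this[of "\<bar>x\<bar>"] have "0 \<le> a * x\<^sup>2 - (\<bar>b\<bar> + 1) * \<bar>x\<bar> + (\<bar>b\<bar> + 1)\<^sup>2 / (4 * a)"
        by simp
      ultimately have "\<bar>x\<bar> + (- a * x\<^sup>2 + b * x) \<le> (\<bar>b\<bar> + 1)\<^sup>2 / (4 * a)"
        by (simp add: algebra_simps)
      then show ?thesis by simp
    qed
    finally show ?thesis .
  qed
  then show ?thesis by blast
qed

lemma gauss_schwartz:
  assumes "a > 0"
  shows "gauss p a b \<in> schwartz"
proof (rule schwartz_coinduct[where S = "range (\<lambda>p. gauss p a b)"])
  show "\<exists>f'\<in>range (\<lambda>p. gauss p a b). \<forall>x. (f has_vector_derivative f' x) (at x)"
    if "f \<in> range (\<lambda>p. gauss p a b)" for f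
  proof -
    from that obtain p where "f = gauss p a b" by blast
    then show ?thesis
      by (simp only:) (intro bexI[OF _ rangeI] allI, rule gauss_has_vector_derivative)
  qed
  fix f k assume "f \<in> range (\<lambda>p. gauss p a b)"
  then obtain p where f: "f = gauss p a b" by blast
  have "\<exists>K. \<forall>i x. \<bar>x\<bar> ^ (k + i) * exp (- a * x\<^sup>2 + Re b * x) \<le> K i"
    by (intro choice allI gauss_monom_bounded assms)
  then obtain K where K: "\<And>i x. \<bar>x\<bar> ^ (k + i) * exp (- a * x\<^sup>2 + Re b * x) \<le> K i" by blast
  have "norm (of_real (x ^ k) * f x) \<le> (\<Sum>i\<le>degree p. norm (coeff p i) * K i)" for x
  proof -
    have "of_real (x ^ k) * f x = (\<Sum>i\<le>degree p. coeff p i * (of_real (x ^ (k + i)) * exp (- of_real a * (of_real x)\<^sup>2 + b * of_real x)))"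
      by (simp add: f gauss_def poly_altdef sum_distrib_left sum_distrib_right power_add mult_ac)
    also have "norm \<dots> \<le> (\<Sum>i\<le>degree p. norm (coeff p i) * K i)"
    proof (rule sum_norm_le)
      fix i
      have "norm (exp (- complex_of_real a * (of_real x)\<^sup>2 + b * of_real x)) = exp (- a * x\<^sup>2 + Re b * x)"
        by (simp add: flip: of_real_power)
      then show "norm (coeff p i * (of_real (x ^ (k + i)) * exp (- of_real a * (of_real x)\<^sup>2 + b * of_real x)))
         \<le> norm (coeff p i) * K i"
        using K[of x i] unfolding norm_mult by (intro mult_left_mono) (simp_all add: norm_power power_abs)
    qed
    finally show ?thesis .
  qed
  then show "\<exists>K. \<forall>x. norm (of_real (x ^ k) * f x) \<le> K" by blast
qed blast

definition hermite0 :: "real \<Rightarrow> complex" where "hermite0 = gauss 1 (1/2) 0"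

lemma hermite0_eq: "hermite0 x = of_real (exp (- x\<^sup>2 / 2))"
  by (simp add: hermite0_def gauss_def exp_of_real[symmetric])

lemma hermite0_schwartz: "hermite0 \<in> schwartz"
  unfolding hermite0_def by (rule gauss_schwartz) simp

lemma hip_self: "hip f f = of_real (LINT x|lborel. (norm (f x))\<^sup>2)"
proof -
  have "cnj z * z = of_real ((norm z)\<^sup>2)" for z by (metis complex_norm_square mult.commute)
  then show ?thesis by (simp only: hip_def integral_complex_of_real)
qed

lemma hip_hermite0: "\<exists>c>0. hip hermite0 hermite0 = of_real c"
proof -
  have "(LINT x|lborel. (norm (hermite0 x))\<^sup>2) \<noteq> 0"
  proof
    assume "(LINT x|lborel. (norm (hermite0 x))\<^sup>2) = 0"
    then have "AE x in lborel. (norm (hermite0 x))\<^sup>2 = 0"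
      using square_integrable_schwartz[OF hermite0_schwartz]
      by (subst (asm) integral_nonneg_eq_0_iff_AE) (auto simp: square_integrable_def)
    then have "AE x::real in lborel. False" by (simp add: hermite0_eq)
    then show False unfolding eventually_False ae_filter_eq_bot_iff by simp
  qed
  moreover have "(LINT x|lborel. (norm (hermite0 x))\<^sup>2) \<ge> 0" by simp
  ultimately have "(LINT x|lborel. (norm (hermite0 x))\<^sup>2) > 0" by linarith
  then show ?thesis unfolding hip_self by blast
qed

text \<open>Generated by the ladder rather than by Hermite polynomials, so that the action of both
  ladder operators follows algebraically from the commutation relation.\<close>

fun hermite :: "nat \<Rightarrow> real \<Rightarrow> complex" where
  "hermite 0 = (\<lambda>x. of_real (1 / sqrt (Re (hip hermite0 hermite0))) * hermite0 x)"
| "hermite (Suc n) = (\<lambda>x. of_real (1 / sqrt (real (Suc n))) * cre (hermite n) x)"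

lemma hermite_schwartz [simp]: "hermite n \<in> schwartz"
  by (induction n) (simp_all only: hermite.simps schwartz_cmult cre_schwartz hermite0_schwartz)

lemma cre_hermite: "cre (hermite n) = (\<lambda>x. of_real (sqrt (real (Suc n))) * hermite (Suc n) x)"
proof -
  have "sqrt (real (Suc n)) * (1 / sqrt (real (Suc n))) = 1" by simp
  then have "complex_of_real (sqrt (real (Suc n))) * of_real (1 / sqrt (real (Suc n))) = 1"
    unfolding of_real_mult[symmetric] by simp
  then show ?thesis by (simp only: hermite.simps mult.assoc[symmetric] mult_1_left)
qed

lemma ann_hermite_0: "ann (hermite 0) = (\<lambda>x. 0)"
proof -
  have "ann hermite0 = (\<lambda>x. 0)"
  proof
    fix x
    have "ddx hermite0 = gauss (pderiv 1 + 1 * [:0, - 2 * of_real (1/2):]) (1/2) 0"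
      unfolding hermite0_def by (rule ddx_eqI) (rule gauss_has_vector_derivative)
    then show "ann hermite0 x = 0"
      by (simp add: ann_def) (simp add: gauss_def hermite0_def)
  qed
  then show ?thesis by (simp only: hermite.simps ann_cmult[OF hermite0_schwartz]) simp
qed

lemma ann_hermite_Suc: "ann (hermite (Suc n)) = (\<lambda>x. of_real (sqrt (real (Suc n))) * hermite n x)"
proof -
  have s: "of_real (1 / sqrt (real (Suc n))) * (of_nat (Suc n) * z) = complex_of_real (sqrt (real (Suc n))) * z" for z n
  proof -
    have "1 / sqrt (real (Suc n)) * real (Suc n) = sqrt (real (Suc n))"
      by (simp add: real_div_sqrt)
    then have "complex_of_real (1 / sqrt (real (Suc n))) * of_nat (Suc n) = of_real (sqrt (real (Suc n)))"
      by (metis of_real_mult of_real_of_nat_eq)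
    then show ?thesis by (metis mult.assoc)
  qed
  have eq: "ann (hermite (Suc n)) = (\<lambda>x. of_real (1 / sqrt (real (Suc n))) * (cre (ann (hermite n)) x + hermite n x))" for n
    by (simp only: hermite.simps(2) ann_cmult[OF cre_schwartz[OF hermite_schwartz]] canonical_commutation[OF hermite_schwartz])
  \<comment> \<open>Lowering \<open>hermite (Suc n)\<close> is expressed by \<open>eq\<close>
    through the number operator on \<open>hermite n\<close>, and this in turn gives the number
    operator one level higher. One induction therefore settles both.\<close>
  have N: "cre (ann (hermite n)) = (\<lambda>x. of_nat n * hermite n x)"
  proof (induction n)
    case 0
    have "cre (\<lambda>x. 0 * hermite 0 x) = (\<lambda>x. 0 * cre (hermite 0) x)" by (rule cre_cmult) (rule hermite_schwartz)
    then show ?case by (simp add: ann_hermite_0 del: hermite.simps)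
  next
    case (Suc n)
    have "ann (hermite (Suc n)) = (\<lambda>x. of_real (sqrt (real (Suc n))) * hermite n x)"
      unfolding eq Suc s[symmetric] by (simp add: algebra_simps del: hermite.simps)
    then have "cre (ann (hermite (Suc n))) = (\<lambda>x. of_real (sqrt (real (Suc n))) * (of_real (sqrt (real (Suc n))) * hermite (Suc n) x))"
      by (simp only: cre_cmult[OF hermite_schwartz] cre_hermite)
    moreover have "complex_of_real (sqrt (real (Suc n))) * of_real (sqrt (real (Suc n))) = of_nat (Suc n)"
      by (simp only: of_real_mult[symmetric] real_sqrt_mult_self) simp
    ultimately show ?case by (simp only: mult.assoc[symmetric])
  qed
  show ?thesis unfolding eq N s[symmetric] by (simp add: algebra_simps del: hermite.simps)
qed

lemma number_hermite: "cre (ann (hermite n)) = (\<lambda>x. of_nat n * hermite n x)"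
proof (cases n)
  case 0
  have "cre (\<lambda>x. 0 * hermite 0 x) = (\<lambda>x. 0 * cre (hermite 0) x)" by (rule cre_cmult) (rule hermite_schwartz)
  with 0 show ?thesis by (simp add: ann_hermite_0 del: hermite.simps)
next
  case (Suc m)
  have "complex_of_real (sqrt (real (Suc m))) * of_real (sqrt (real (Suc m))) = of_nat (Suc m)"
    by (simp only: of_real_mult[symmetric] real_sqrt_mult_self) simp
  then show ?thesis
    by (simp only: Suc ann_hermite_Suc cre_cmult[OF hermite_schwartz] cre_hermite mult.assoc[symmetric])
qed

text \<open>Different indices are different eigenvalues of the symmetric number operator, which
  forces orthogonality. The norms are carried upwards from the ground state by adjointness of the
  ladder operators.\<close>

lemma hermite_orthonormal: "hip (hermite m) (hermite n) = (if m = n then 1 else 0)"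
proof (cases "m = n")
  case False
  have "hip (hermite m) (cre (ann (hermite n))) = hip (cre (ann (hermite m))) (hermite n)"
    by (simp only: hip_cre hip_ann ann_schwartz hermite_schwartz)
  then have "of_nat n * hip (hermite m) (hermite n) = of_nat m * hip (hermite m) (hermite n)"
    by (simp only: number_hermite hip_cmult_left
       hip_cmult_right complex_cnj_of_nat)
  with False show ?thesis by simp
next
  case True
  have "hip (hermite n) (hermite n) = 1"
  proof (induction n)
    case 0
    obtain c where c: "c > 0" "hip hermite0 hermite0 = of_real c" using hip_hermite0 by blast
    have "hip (hermite 0) (hermite 0) = of_real (1 / sqrt c) * (of_real (1 / sqrt c) * of_real c)"
      by (simp only: hermite.simps hip_cmult_left hip_cmult_right schwartz_cmult hermite0_schwartz c
          complex_cnj_complex_of_real Re_complex_of_real)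
    also have "\<dots> = of_real (1 / sqrt c * (1 / sqrt c * c))" by (simp only: of_real_mult)
    also have "1 / sqrt c * (1 / sqrt c * c) = 1" using c(1) by (simp add: field_simps)
    finally show ?case by simp
  next
    case (Suc n)
    have "hip (hermite (Suc n)) (hermite (Suc n)) = of_real (1 / sqrt (real (Suc n))) * hip (hermite (Suc n)) (cre (hermite n))"
      by (subst (2) hermite.simps(2)) (rule hip_cmult_right)
    also have "hip (hermite (Suc n)) (cre (hermite n)) = hip (ann (hermite (Suc n))) (hermite n)"
      by (simp only: hip_cre hermite_schwartz)
    also have "\<dots> = of_real (sqrt (real (Suc n))) * hip (hermite n) (hermite n)"
      by (simp only: ann_hermite_Suc hip_cmult_left complex_cnj_complex_of_real)
    finally show ?case unfolding Suc by (simp del: hermite.simps flip: of_real_mult)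
  qed
  with True show ?thesis by simp
qed

section \<open>Completeness of the Hermite functions\<close>

lemma integrable_square_integrable_mult:
  assumes f: "square_integrable f" and g: "square_integrable g"
  shows "integrable lborel (\<lambda>x. f x * g x)"
proof (rule Bochner_Integration.integrable_bound)
  show "integrable lborel (\<lambda>x. (norm (f x))\<^sup>2 + (norm (g x))\<^sup>2)"
    using f g unfolding square_integrable_def by (intro Bochner_Integration.integrable_add) auto
  show "(\<lambda>x. f x * g x) \<in> borel_measurable lborel"
    using f g unfolding square_integrable_def by (intro borel_measurable_times) auto
  have "norm (f x * g x) \<le> norm ((norm (f x))\<^sup>2 + (norm (g x))\<^sup>2)" for x
  proof -
    have "2 * (norm (f x) * norm (g x)) \<le> (norm (f x))\<^sup>2 + (norm (g x))\<^sup>2"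
      using sum_squares_bound[of "norm (f x)" "norm (g x)"] by simp
    moreover have "0 \<le> norm (f x) * norm (g x)" by simp
    ultimately have "norm (f x) * norm (g x) \<le> (norm (f x))\<^sup>2 + (norm (g x))\<^sup>2" by linarith
    then show ?thesis by (simp add: norm_mult)
  qed
  then show "AE x in lborel. norm (f x * g x) \<le> norm ((norm (f x))\<^sup>2 + (norm (g x))\<^sup>2)" by simp
qed

lemma square_integrable_cnj: "square_integrable f \<Longrightarrow> square_integrable (\<lambda>x. cnj (f x))"
proof -
  have "cnj \<in> borel_measurable borel" by (intro borel_measurable_continuous_onI continuous_intros)
  from measurable_compose[OF _ this]
  show "square_integrable f \<Longrightarrow> square_integrable (\<lambda>x. cnj (f x))"
    by (auto simp: square_integrable_def)
qed

text \<open>A reduction to Levy's theorem on characteristic functions: frequency zero shows that the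
  positive and the negative part have equal mass, and after normalization they are probability
  densities with the same characteristic function.\<close>

lemma fourier_transform_unique:
  fixes u :: "real \<Rightarrow> real"
  assumes u: "integrable lborel u"
    and F: "\<And>k. (LINT x|lborel. of_real (u x) * exp (\<i> * of_real (k * x))) = (0::complex)"
  shows "AE x in lborel. u x = 0"
proof -
  define p where "p x = max 0 (u x)" for x
  define n where "n x = max 0 (- u x)" for x
  have ip: "integrable lborel p" and "in": "integrable lborel n"
    unfolding p_def n_def using u by (auto intro!: integrable_max)
  have pn: "u x = p x - n x" "p x \<ge> 0" "n x \<ge> 0" for x by (auto simp: p_def n_def)
  have [measurable]: "p \<in> borel_measurable borel" "n \<in> borel_measurable borel"
    using ip "in" by auto
  have iu: "integrable lborel (\<lambda>x. of_real (v x) * exp (\<i> * of_real (k * x)))"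
    if v: "integrable lborel v" for v k
  proof (rule Bochner_Integration.integrable_bound[OF v])
    have [measurable]: "v \<in> borel_measurable borel" using v by auto
    show "(\<lambda>x. complex_of_real (v x) * exp (\<i> * of_real (k * x))) \<in> borel_measurable lborel" by measurable
    show "AE x in lborel. norm (complex_of_real (v x) * exp (\<i> * of_real (k * x))) \<le> norm (v x)"
      by (simp add: norm_mult)
  qed
  have FE: "(LINT x|lborel. of_real (p x) * exp (\<i> * of_real (k * x))) = (LINT x|lborel. of_real (n x) * exp (\<i> * of_real (k * x)))" for k
    using F[of k] iu[OF ip, of k] iu[OF "in", of k] by (simp add: pn(1) left_diff_distrib)
  define c where "c = (LINT x|lborel. p x)"
  have c: "(LINT x|lborel. n x) = c" unfolding c_def using FE[of 0] by simp
  have "c \<ge> 0" unfolding c_def using pn by simp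
  \<comment> \<open>Mass zero is treated apart because the densities cannot be normalized then; in
    that case both parts vanish almost everywhere.\<close>
  have "AE x in lborel. p x = n x"
  proof (cases "c = 0")
    case True
    have "AE x in lborel. p x = 0" "AE x in lborel. n x = 0"
      using True c c_def pn integral_nonneg_eq_0_iff_AE[OF ip] integral_nonneg_eq_0_iff_AE[OF "in"] by auto
    then show ?thesis by eventually_elim simp
  next
    case False
    with \<open>c \<ge> 0\<close> have "c > 0" by simp
    define M where "M v = density lborel (\<lambda>x. ennreal (v x / c))" for v :: "real \<Rightarrow> real"
    have rd: "real_distribution (M v)" if v: "integrable lborel v" "\<And>x. v x \<ge> 0" "(LINT x|lborel. v x) = c" for v
    proof -
      have [measurable]: "v \<in> borel_measurable borel" using v(1) by auto
      have "emeasure (M v) (space (M v)) = (\<integral>\<^sup>+x. ennreal (v x / c) \<partial>lborel)"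
        by (simp add: M_def emeasure_density)
      also have "\<dots> = ennreal (LINT x|lborel. v x / c)"
        using v \<open>c > 0\<close> by (intro nn_integral_eq_integral) auto
      also have "\<dots> = 1" using v \<open>c > 0\<close> by simp
      finally have "prob_space (M v)" by (rule prob_spaceI)
      then show ?thesis by (simp add: real_distribution_def real_distribution_axioms_def M_def)
    qed
    have ch: "char (M v) k = (LINT x|lborel. of_real (v x) * exp (\<i> * of_real (k * x))) / of_real c"
      if v: "integrable lborel v" "\<And>x. v x \<ge> 0" for v k
    proof -
      have [measurable]: "v \<in> borel_measurable borel" using v(1) by auto
      have "char (M v) k = (LINT x|lborel. (v x / c) *\<^sub>R exp (\<i> * of_real (k * x)))"
        unfolding char_def M_def using v \<open>c > 0\<close> by (intro integral_density) auto
      also have "\<dots> = (LINT x|lborel. (of_real (v x) * exp (\<i> * of_real (k * x))) / of_real c)"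
        by (simp add: scaleR_conv_of_real)
      finally show ?thesis by simp
    qed
    have "M p = M n"
      using rd[OF ip pn(2) c_def[symmetric]] rd[OF "in" pn(3) c] ch[OF ip pn(2)] ch[OF "in" pn(3)] FE
      by (intro Levy_uniqueness) (simp_all add: fun_eq_iff)
    then have "AE x in lborel. ennreal (p x / c) = ennreal (n x / c)"
      unfolding M_def by (subst (asm) sigma_finite_measure.density_unique_iff[OF sigma_finite_lborel]) auto
    then show ?thesis
      by eventually_elim (use pn \<open>c > 0\<close> in \<open>simp add: ennreal_inj\<close>)
  qed
  then show ?thesis by eventually_elim (simp add: pn(1))
qed

text \<open>The three-term recursion, read off from \<open>x = (ann + cre) / sqrt 2\<close>. For
  \<open>n = 0\<close> the function \<open>hermite (n - 1)\<close> is a dummy, as its coefficient is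
  \<open>sqrt 0\<close>.\<close>

lemma x_times_hermite:
  "of_real x * hermite n x = of_real (1 / sqrt 2) * (of_real (sqrt (real n)) * hermite (n - 1) x
     + of_real (sqrt (real (Suc n))) * hermite (Suc n) x)"
proof -
  have r: "complex_of_real (1 / sqrt 2) * (of_real (1 / sqrt 2) * z) = z / 2" for z
  proof -
    have "complex_of_real (1 / sqrt 2) * of_real (1 / sqrt 2) = of_real (1/2)"
      unfolding of_real_mult[symmetric] by simp
    then show ?thesis by (simp add: mult.assoc[symmetric])
  qed
  have a: "ann (hermite n) x = of_real (sqrt (real n)) * hermite (n - 1) x"
    using fun_cong[OF ann_hermite_0, of x] fun_cong[OF ann_hermite_Suc, of "n - 1" x]
    by (cases n) (simp_all del: hermite.simps)
  have "of_real x * hermite n x = of_real (1 / sqrt 2) * (ann (hermite n) x + cre (hermite n) x)"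
    by (simp only: ann_def cre_def distrib_left[symmetric] r) simp
  then show ?thesis by (simp only: a cre_hermite)
qed

lemma moment_schwartz: "f \<in> schwartz \<Longrightarrow> (\<lambda>x. of_real x ^ k * f x) \<in> schwartz"
proof (induction k)
  case (Suc k)
  from schwartz_x[OF Suc.IH[OF Suc.prems]] show ?case by (simp add: mult.assoc)
qed simp

text \<open>The recursion turns vanishing Hermite coefficients into vanishing moments of
  \<open>hermite0 * f\<close>. The Gaussian factor makes this product integrable against every
  exponential, so the exponential series may be integrated term by term and the Fourier transform
  vanishes.\<close>

lemma hermite_total:
  assumes f: "square_integrable f" and 0: "\<And>n. hip (hermite n) f = 0"
  shows "AE x in lborel. f x = 0"
proof -
  have [measurable]: "f \<in> borel_measurable borel" using f by (simp add: square_integrable_def)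
  have int: "integrable lborel (\<lambda>x. g x * f x)" if "g \<in> schwartz" for g
    using integrable_square_integrable_mult[OF square_integrable_schwartz[OF that] f] .
  have intc: "integrable lborel (\<lambda>x. cnj (g x) * f x)" if "g \<in> schwartz" for g
    using integrable_square_integrable_mult[OF square_integrable_cnj[OF square_integrable_schwartz[OF that]] f] .
  \<comment> \<open>Each factor of \<open>x\<close> trades the index \<open>n\<close> for its two
    neighbours, so the induction on \<open>k\<close> keeps \<open>n\<close> arbitrary.\<close>
  have mom: "hip (\<lambda>x. of_real x ^ k * hermite n x) f = 0" for k n
  proof (induction k arbitrary: n)
    case 0
    then show ?case using assms(2) by simp
  next
    case (Suc k)
    have "hip (\<lambda>x. of_real x ^ Suc k * hermite n x) f
        = (LINT x|lborel. of_real (sqrt (real n) / sqrt 2) * (cnj (of_real x ^ k * hermite (n - 1) x) * f x)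
         + of_real (sqrt (real (Suc n)) / sqrt 2) * (cnj (of_real x ^ k * hermite (Suc n) x) * f x))"
      unfolding hip_def
    proof (rule Bochner_Integration.integral_cong[OF refl])
      fix x
      have "of_real x ^ Suc k * hermite n x = of_real x ^ k * (of_real x * hermite n x)"
        by (simp only: power_Suc mult_ac)
      then show "cnj (of_real x ^ Suc k * hermite n x) * f x
        = of_real (sqrt (real n) / sqrt 2) * (cnj (of_real x ^ k * hermite (n - 1) x) * f x)
         + of_real (sqrt (real (Suc n)) / sqrt 2) * (cnj (of_real x ^ k * hermite (Suc n) x) * f x)"
        unfolding x_times_hermite by (simp add: ring_distribs mult_ac del: hermite.simps)
    qed
    also have "\<dots> = of_real (sqrt (real n) / sqrt 2) * hip (\<lambda>x. of_real x ^ k * hermite (n - 1) x) f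
       + of_real (sqrt (real (Suc n)) / sqrt 2) * hip (\<lambda>x. of_real x ^ k * hermite (Suc n) x) f"
      unfolding hip_def
      by (subst Bochner_Integration.integral_add)
        (simp_all only: integral_mult_right_zero integrable_mult_right intc moment_schwartz hermite_schwartz)
    finally show ?case by (simp only: Suc) simp
  qed
  define g where "g x = hermite0 x * f x" for x
  have ig: "integrable lborel g" unfolding g_def by (rule int) (rule hermite0_schwartz)
  have [measurable]: "g \<in> borel_measurable borel" using ig by auto
  have momg: "(LINT x|lborel. of_real x ^ k * g x) = 0" for k
  proof -
    define c where "c = complex_of_real (1 / sqrt (Re (hip hermite0 hermite0)))"
    have c: "c \<noteq> 0" "cnj c = c" using hip_hermite0 by (auto simp: c_def)
    have h: "hermite 0 x = c * hermite0 x" for x by (simp add: c_def)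
    have "(LINT x|lborel. c * (of_real x ^ k * g x)) = hip (\<lambda>x. of_real x ^ k * hermite 0 x) f"
      unfolding hip_def h g_def
      by (intro Bochner_Integration.integral_cong refl) (simp add: c hermite0_eq mult_ac)
    then show ?thesis using mom[of k 0] c by simp
  qed
  have FT: "(LINT x|lborel. g x * exp (\<i> * of_real (k * x))) = 0" for k
  proof -
    define s where "s N x = (\<Sum>n<N. (\<i> * of_real (k * x)) ^ n /\<^sub>R fact n) * g x" for N :: nat and x
    \<comment> \<open>\<open>exp \<bar>k * x\<bar>\<close> is at most the sum of
      \<open>exp (k * x)\<close> and \<open>exp (- k * x)\<close>. Each of these times
      \<open>hermite0\<close> is again a Schwartz function, whose product with the square integrable
      \<open>f\<close> is integrable.\<close>
    have dom: "integrable lborel (\<lambda>x. exp \<bar>k * x\<bar> * norm (g x))"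
    proof (rule Bochner_Integration.integrable_bound)
      show "integrable lborel (\<lambda>x. norm (gauss 1 (1/2) (of_real k) x * f x) + norm (gauss 1 (1/2) (of_real (- k)) x * f x))"
        by (intro Bochner_Integration.integrable_add integrable_norm int gauss_schwartz) simp_all
      have "exp \<bar>k * x\<bar> * norm (g x) \<le> norm (gauss 1 (1/2) (of_real k) x * f x) + norm (gauss 1 (1/2) (of_real (- k)) x * f x)" for x
      proof -
        have n: "norm (gauss 1 (1/2) (of_real k) x * f x) = exp (k * x) * norm (g x)" for k
          by (simp add: gauss_def g_def hermite0_eq norm_mult exp_add[symmetric] flip: of_real_power) 
        have "exp \<bar>k * x\<bar> \<le> exp (k * x) + exp (- k * x)" by (simp add: abs_if)
        then have "exp \<bar>k * x\<bar> * norm (g x) \<le> (exp (k * x) + exp (- k * x)) * norm (g x)"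
          by (rule mult_right_mono) simp
        then show ?thesis unfolding n by (simp add: algebra_simps)
      qed
      then show "AE x in lborel. norm (exp \<bar>k * x\<bar> * norm (g x)) \<le> norm (norm (gauss 1 (1/2) (of_real k) x * f x) + norm (gauss 1 (1/2) (of_real (- k)) x * f x))"
        by simp
    qed measurable
    have "(\<lambda>N. LINT x|lborel. s N x) \<longlonglongrightarrow> (LINT x|lborel. exp (\<i> * of_real (k * x)) * g x)"
    proof (rule integral_dominated_convergence[OF _ _ dom])
      show "AE x in lborel. (\<lambda>N. s N x) \<longlonglongrightarrow> exp (\<i> * of_real (k * x)) * g x"
        unfolding s_def using exp_converges by (intro AE_I2 tendsto_mult_right) (simp add: sums_def)
      have "norm (s N x) \<le> exp \<bar>k * x\<bar> * norm (g x)" for N x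
      proof -
        have "norm (\<Sum>n<N. (\<i> * of_real (k * x)) ^ n /\<^sub>R fact n) \<le> (\<Sum>n<N. \<bar>k * x\<bar> ^ n /\<^sub>R fact n)"
          by (rule sum_norm_le) (simp add: norm_mult norm_power norm_inverse power_abs abs_mult)
        also have "\<dots> \<le> (\<Sum>n. \<bar>k * x\<bar> ^ n /\<^sub>R fact n)"
          by (intro sum_le_suminf summable_exp_generic) auto
        finally show ?thesis unfolding s_def norm_mult by (intro mult_right_mono) (simp_all add: exp_def)
      qed
      then show "AE x in lborel. norm (s N x) \<le> exp \<bar>k * x\<bar> * norm (g x)" for N by simp
      show "s N \<in> borel_measurable lborel" for N unfolding s_def by measurable
    qed measurable
    moreover have "(LINT x|lborel. s N x) = 0" for N
    proof -
      have i: "integrable lborel (\<lambda>x. of_real x ^ n * g x)" for n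
        using int[OF moment_schwartz[OF hermite0_schwartz, of n]] by (simp add: g_def mult.assoc)
      have "(LINT x|lborel. s N x) = (LINT x|lborel. (\<Sum>n<N. (\<i> * of_real k) ^ n /\<^sub>R fact n * (of_real x ^ n * g x)))"
        unfolding s_def by (intro Bochner_Integration.integral_cong refl)
          (simp add: sum_distrib_right sum_distrib_left power_mult_distrib mult_ac)
      also have "\<dots> = (\<Sum>n<N. LINT x|lborel. (\<i> * of_real k) ^ n /\<^sub>R fact n * (of_real x ^ n * g x))"
        by (rule Bochner_Integration.integral_sum) (intro integrable_mult_right i)
      also have "\<dots> = 0" by (simp add: momg)
      finally show ?thesis .
    qed
    ultimately have "(LINT x|lborel. exp (\<i> * of_real (k * x)) * g x) = 0"
      by (simp add: LIMSEQ_const_iff)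
    then show ?thesis by (simp add: mult.commute)
  qed
  \<comment> \<open>Uniqueness is available for real functions only. Conjugation merely flips the
    frequency, so the transform of \<open>cnj g\<close> vanishes too, and with it those of the real
    and imaginary parts.\<close>
  have FTc: "(LINT x|lborel. cnj (g x) * exp (\<i> * of_real (k * x))) = 0" for k
  proof -
    have "(LINT x|lborel. cnj (g x) * exp (\<i> * of_real (k * x))) = (LINT x|lborel. cnj (g x * exp (\<i> * of_real (- k * x))))"
      by (intro Bochner_Integration.integral_cong refl) (simp add: exp_cnj)
    also have "\<dots> = cnj (LINT x|lborel. g x * exp (\<i> * of_real (- k * x)))"
      by (rule Bochner_Integration.integral_cnj)
    finally show ?thesis by (simp only: FT) simp
  qed
  have ie: "integrable lborel (\<lambda>x. v x * exp (\<i> * of_real (k * x)))" if v: "integrable lborel v" for v :: "real \<Rightarrow> complex" and k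
  proof (rule Bochner_Integration.integrable_bound[OF v])
    have [measurable]: "v \<in> borel_measurable borel" using v by auto
    show "(\<lambda>x. v x * exp (\<i> * of_real (k * x))) \<in> borel_measurable lborel" by measurable
  qed (simp add: norm_mult)
  have igc: "integrable lborel (\<lambda>x. cnj (g x))" using ig by simp
  have comb: "(LINT x|lborel. (c * g x + d * cnj (g x)) * exp (\<i> * of_real (k * x))) = 0" for c d k
  proof -
    have "(LINT x|lborel. (c * g x + d * cnj (g x)) * exp (\<i> * of_real (k * x)))
       = (LINT x|lborel. c * (g x * exp (\<i> * of_real (k * x))) + d * (cnj (g x) * exp (\<i> * of_real (k * x))))"
      by (simp add: algebra_simps)
    also have "\<dots> = 0"
      by (subst Bochner_Integration.integral_add) (simp_all only: integrable_mult_right ie ig igc integral_mult_right_zero FT FTc, simp)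
    finally show ?thesis .
  qed
  have "AE x in lborel. Re (g x) = 0"
  proof (rule fourier_transform_unique)
    fix k
    have "complex_of_real (Re z) = (1/2) * z + (1/2) * cnj z" for z by (simp add: complex_eq_iff)
    with comb[of "1/2" "1/2" k] show "(LINT x|lborel. of_real (Re (g x)) * exp (\<i> * of_real (k * x))) = (0::complex)"
      by simp
  qed (use ig in simp)
  moreover have "AE x in lborel. Im (g x) = 0"
  proof (rule fourier_transform_unique)
    fix k
    have "complex_of_real (Im z) = (- \<i>/2) * z + (\<i>/2) * cnj z" for z by (simp add: complex_eq_iff)
    with comb[of "- \<i>/2" "\<i>/2" k] show "(LINT x|lborel. of_real (Im (g x)) * exp (\<i> * of_real (k * x))) = (0::complex)"
      by simp
  qed (use ig in simp)
  ultimately show ?thesis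
    by eventually_elim (simp add: g_def hermite0_eq complex_eq_iff)
qed

section \<open>Generators with an eigenbasis of Schwartz functions\<close>

definition pair2 :: "(real \<Rightarrow> complex) \<Rightarrow> (real \<Rightarrow> complex) \<Rightarrow> (real \<Rightarrow> complex)^2" where
  "pair2 f g = (\<chi> i. if i = 1 then f else g)"

lemma pair2_nth [simp]: "pair2 f g $ 1 = f" "pair2 f g $ 2 = g"
  by (simp_all add: pair2_def)

lemma pair2_schwartz2 [simp]: "pair2 f g \<in> schwartz2 \<longleftrightarrow> f \<in> schwartz \<and> g \<in> schwartz"
  by (simp add: schwartz2_def forall_2)

lemma schwartz2_cases:
  assumes "\<psi> \<in> schwartz2"
  obtains f g where "\<psi> = pair2 f g" "f \<in> schwartz" "g \<in> schwartz"
  by (rule that[of "\<psi> $ 1" "\<psi> $ 2"]) (use assms in \<open>auto simp: vec_eq_iff forall_2 schwartz2_def\<close>)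

lemma pair2_eq_iff: "pair2 f g = pair2 f' g' \<longleftrightarrow> f = f' \<and> g = g'"
  by (auto simp: vec_eq_iff forall_2)

lemma to_l2_nth [simp]: "to_l2 \<psi> $ i = abs_l2 (\<psi> $ i)"
  by (simp add: to_l2_def)

lemma scaleC_to_l2_pair2:
  "square_integrable f \<Longrightarrow> square_integrable g \<Longrightarrow>
   scaleC_l22 c (to_l2 (pair2 f g)) = to_l2 (pair2 (\<lambda>x. c * f x) (\<lambda>x. c * g x))"
  by (simp add: vec_eq_iff forall_2 scaleC_l22_nth abs_l2_scaleC)

lemma add_to_l2_pair2:
  "square_integrable f \<Longrightarrow> square_integrable g \<Longrightarrow> square_integrable f' \<Longrightarrow> square_integrable g' \<Longrightarrow>
   to_l2 (pair2 f g) + to_l2 (pair2 f' g') = to_l2 (pair2 (\<lambda>x. f x + f' x) (\<lambda>x. g x + g' x))"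
  by (simp add: vec_eq_iff forall_2 abs_l2_plus)

lemma l22_cases:
  obtains f g where "square_integrable f" "square_integrable g" "u = to_l2 (pair2 f g)"
proof -
  obtain f g where "square_integrable f" "u $ 1 = abs_l2 f" "square_integrable g" "u $ 2 = abs_l2 g"
    by (metis abs_l2_cases)
  then show ?thesis by (intro that[of f g]) (simp_all add: vec_eq_iff forall_2)
qed

lemma Complex_inner_abs_l2:
  assumes f: "square_integrable f" and g: "square_integrable g"
  shows "Complex (abs_l2 f \<bullet> abs_l2 g) (scaleC_l2 \<i> (abs_l2 f) \<bullet> abs_l2 g) = hip f g"
proof -
  have i: "integrable lborel (\<lambda>x. cnj (f x) * g x)"
    using integrable_square_integrable_mult[OF square_integrable_cnj[OF f] g] .
  have "Re (hip f g) = (LINT x|lborel. f x \<bullet> g x)"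
    unfolding hip_def integral_Re[OF i, symmetric] by (simp add: inner_complex_def)
  moreover have "Im (hip f g) = (LINT x|lborel. (\<i> * f x) \<bullet> g x)"
    unfolding hip_def integral_Im[OF i, symmetric] by (simp add: inner_complex_def algebra_simps)
  ultimately show ?thesis
    by (simp add: complex_eq_iff abs_l2_scaleC abs_l2_inner f g square_integrable_cmult)
qed

lemma cip_to_l2_pair2:
  assumes "square_integrable f" "square_integrable g" "square_integrable f'" "square_integrable g'"
  shows "cip (to_l2 (pair2 f g)) (to_l2 (pair2 f' g')) = hip f f' + hip g g'"
  using assms by (simp add: cip_def inner_vec_def sum_2 scaleC_l22_nth complex_eq_iff flip: Complex_inner_abs_l2)

text \<open>Symmetry against an eigenvector gives \<open>cip (to_l2 (\<phi> n)) (to_l2 (A \<psi>)) =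
  E n * cip (to_l2 (\<phi> n)) (to_l2 \<psi>)\<close>, so the Schwartz graph lies inside the
  diagonal graph. As the eigenvectors are themselves Schwartz, its closure is the entire diagonal
  graph.\<close>

lemma eigenbasis_generator:
  fixes \<phi> :: "nat \<Rightarrow> (real \<Rightarrow> complex)^2" and E :: "nat \<Rightarrow> real"
  assumes onb: "onb (\<lambda>n. to_l2 (\<phi> n))"
    and \<phi>: "\<And>n. \<phi> n \<in> schwartz2"
    and A: "\<And>\<psi>. \<psi> \<in> schwartz2 \<Longrightarrow> A \<psi> \<in> schwartz2"
    and lin: "\<And>c f g d f' g'. f \<in> schwartz \<Longrightarrow> g \<in> schwartz \<Longrightarrow> f' \<in> schwartz \<Longrightarrow> g' \<in> schwartz \<Longrightarrow>
       A (pair2 (\<lambda>x. c * f x + d * f' x) (\<lambda>x. c * g x + d * g' x)) =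
       pair2 (\<lambda>x. c * (A (pair2 f g) $ 1) x + d * (A (pair2 f' g') $ 1) x)
             (\<lambda>x. c * (A (pair2 f g) $ 2) x + d * (A (pair2 f' g') $ 2) x)"
    and sym: "\<And>\<psi> \<xi>. \<psi> \<in> schwartz2 \<Longrightarrow> \<xi> \<in> schwartz2 \<Longrightarrow> cip (to_l2 \<psi>) (to_l2 (A \<xi>)) = cip (to_l2 (A \<psi>)) (to_l2 \<xi>)"
    and eig: "\<And>n. A (\<phi> n) = pair2 (\<lambda>x. of_real (E n) * (\<phi> n $ 1) x) (\<lambda>x. of_real (E n) * (\<phi> n $ 2) x)"
  shows "unitary_group_of (closure (schwartz_graph A)) (onb.diag_group (\<lambda>n. to_l2 (\<phi> n)) E)"
    and "closure (fst ` closure (schwartz_graph A)) = UNIV"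
proof -
  interpret onb "\<lambda>n. to_l2 (\<phi> n)" by (rule onb)
  note sq = square_integrable_schwartz
  have eig2: "to_l2 (A (\<phi> n)) = scaleC_l22 (of_real (E n)) (to_l2 (\<phi> n))" for n
  proof -
    obtain f g where "\<phi> n = pair2 f g" "f \<in> schwartz" "g \<in> schwartz" using schwartz2_cases[OF \<phi>] .
    then show ?thesis unfolding eig by (simp add: scaleC_to_l2_pair2 sq)
  qed
  have "closure (schwartz_graph A) = diag_graph E"
  proof (rule closure_eq_diag_graph)
    show "schwartz_graph A \<subseteq> diag_graph E"
      using sym[OF \<phi>] by (auto simp: schwartz_graph_def diag_graph_def eig2 cip_scaleC_left)
    have zero: "A (pair2 (\<lambda>x. 0) (\<lambda>x. 0)) = pair2 (\<lambda>x. 0) (\<lambda>x. 0)"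
      using lin[of "\<lambda>x. 0" "\<lambda>x. 0" "\<lambda>x. 0" "\<lambda>x. 0" 0 0] schwartz_cmult[OF hermite_schwartz[of 0], of 0] by simp
    have z: "to_l2 (pair2 (\<lambda>x. 0) (\<lambda>x. 0)) = 0"
      by (simp add: vec_eq_iff forall_2 zero_l2_def)
    show "(0, 0) \<in> schwartz_graph A"
      unfolding schwartz_graph_def using schwartz_cmult[OF hermite_schwartz[of 0], of 0]
      by (intro image_eqI[of _ _ "pair2 (\<lambda>x. 0) (\<lambda>x. 0)"]) (simp_all add: zero z)
    show "(x + x', y + y') \<in> schwartz_graph A"
      if "(x, y) \<in> schwartz_graph A" "(x', y') \<in> schwartz_graph A" for x y x' y'
    proof -
      from that obtain \<psi> \<psi>' where p: "\<psi> \<in> schwartz2" "x = to_l2 \<psi>" "y = to_l2 (A \<psi>)"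
        and p': "\<psi>' \<in> schwartz2" "x' = to_l2 \<psi>'" "y' = to_l2 (A \<psi>')" by (auto simp: schwartz_graph_def)
      obtain f g where fg: "\<psi> = pair2 f g" "f \<in> schwartz" "g \<in> schwartz" using schwartz2_cases[OF p(1)] .
      obtain f' g' where fg': "\<psi>' = pair2 f' g'" "f' \<in> schwartz" "g' \<in> schwartz" using schwartz2_cases[OF p'(1)] .
      obtain h k where hk: "A \<psi> = pair2 h k" "h \<in> schwartz" "k \<in> schwartz" using schwartz2_cases[OF A[OF p(1)]] .
      obtain h' k' where hk': "A \<psi>' = pair2 h' k'" "h' \<in> schwartz" "k' \<in> schwartz" using schwartz2_cases[OF A[OF p'(1)]] .
      have "A (pair2 (\<lambda>x. f x + f' x) (\<lambda>x. g x + g' x)) = pair2 (\<lambda>x. h x + h' x) (\<lambda>x. k x + k' x)"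
        using lin[of f g f' g' 1 1] fg fg' hk hk' by simp
      then show ?thesis unfolding schwartz_graph_def p p' 
        by (intro image_eqI[of _ _ "pair2 (\<lambda>x. f x + f' x) (\<lambda>x. g x + g' x)"])
          (simp_all add: fg fg' hk[unfolded fg] hk'[unfolded fg'] hk hk' add_to_l2_pair2 sq schwartz_add)
    qed
    show "(scaleC_l22 z (to_l2 (\<phi> n)), scaleC_l22 (of_real (E n) * z) (to_l2 (\<phi> n))) \<in> schwartz_graph A" for n z
    proof -
      obtain f g where fg: "\<phi> n = pair2 f g" "f \<in> schwartz" "g \<in> schwartz" using schwartz2_cases[OF \<phi>] .
      have "A (pair2 (\<lambda>x. z * f x) (\<lambda>x. z * g x)) = pair2 (\<lambda>x. of_real (E n) * z * f x) (\<lambda>x. of_real (E n) * z * g x)"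
        using lin[of f g f g z 0] fg eig[of n] by (simp add: mult_ac)
      then show ?thesis unfolding schwartz_graph_def
        by (intro image_eqI[of _ _ "pair2 (\<lambda>x. z * f x) (\<lambda>x. z * g x)"])
          (simp_all add: fg scaleC_to_l2_pair2 sq schwartz_cmult)
    qed
  qed
  then show "unitary_group_of (closure (schwartz_graph A)) (diag_group E)"
    and "closure (fst ` closure (schwartz_graph A)) = UNIV"
    using unitary_group_of_diag closure_Domain_diag_graph by simp_all
qed

section \<open>Components, linearity and symmetry of the two Hamiltonians\<close>

lemma H_fun_pair2: "H_fun \<Omega> \<omega> lam (pair2 f g) = pair2
   (\<lambda>x. of_real (\<Omega> / 2) * f x + of_real \<omega> * cre (ann f) x + of_real lam * (ann g x + cre g x))
   (\<lambda>x. of_real (- \<Omega> / 2) * g x + of_real \<omega> * cre (ann g) x + of_real lam * (ann f x + cre f x))"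
  by (simp add: vec_eq_iff forall_2 H_fun_def tensor_op_def sum_2 sigma_z_def sigma_x_def mat_def vector_2)

lemma H_RWA_fun_pair2: "H_RWA_fun \<Omega> \<omega> lam (pair2 f g) = pair2
   (\<lambda>x. of_real (\<Omega> / 2) * f x + of_real \<omega> * cre (ann f) x + of_real lam * ann g x)
   (\<lambda>x. of_real (- \<Omega> / 2) * g x + of_real \<omega> * cre (ann g) x + of_real lam * cre f x)"
  by (simp add: vec_eq_iff forall_2 H_RWA_fun_def tensor_op_def sum_2 sigma_z_def sigma_plus_def sigma_minus_def mat_def vector_2)

lemma schwartz_comb3:
  "f \<in> schwartz \<Longrightarrow> g \<in> schwartz \<Longrightarrow> h \<in> schwartz \<Longrightarrow> (\<lambda>x. a * f x + b * g x + c * h x) \<in> schwartz"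
  by (intro schwartz_add schwartz_cmult)

lemma H_fun_schwartz2: "\<psi> \<in> schwartz2 \<Longrightarrow> H_fun \<Omega> \<omega> lam \<psi> \<in> schwartz2"
  by (erule schwartz2_cases) (simp only: H_fun_pair2 pair2_schwartz2 schwartz_comb3 schwartz_add ann_schwartz cre_schwartz simp_thms)
lemma H_RWA_fun_schwartz2: "\<psi> \<in> schwartz2 \<Longrightarrow> H_RWA_fun \<Omega> \<omega> lam \<psi> \<in> schwartz2"
  by (erule schwartz2_cases) (simp only: H_RWA_fun_pair2 pair2_schwartz2 schwartz_comb3 schwartz_add ann_schwartz cre_schwartz simp_thms)

lemma H_fun_lin:
  assumes "f \<in> schwartz" "g \<in> schwartz" "f' \<in> schwartz" "g' \<in> schwartz"
  shows "H_fun \<Omega> \<omega> lam (pair2 (\<lambda>x. c * f x + d * f' x) (\<lambda>x. c * g x + d * g' x)) =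
       pair2 (\<lambda>x. c * (H_fun \<Omega> \<omega> lam (pair2 f g) $ 1) x + d * (H_fun \<Omega> \<omega> lam (pair2 f' g') $ 1) x)
             (\<lambda>x. c * (H_fun \<Omega> \<omega> lam (pair2 f g) $ 2) x + d * (H_fun \<Omega> \<omega> lam (pair2 f' g') $ 2) x)"
  using assms by (simp add: H_fun_pair2 pair2_eq_iff fun_eq_iff ann_lincomb cre_lincomb ann_schwartz cre_schwartz ring_distribs mult_ac)
lemma H_RWA_fun_lin:
  assumes "f \<in> schwartz" "g \<in> schwartz" "f' \<in> schwartz" "g' \<in> schwartz"
  shows "H_RWA_fun \<Omega> \<omega> lam (pair2 (\<lambda>x. c * f x + d * f' x) (\<lambda>x. c * g x + d * g' x)) =
       pair2 (\<lambda>x. c * (H_RWA_fun \<Omega> \<omega> lam (pair2 f g) $ 1) x + d * (H_RWA_fun \<Omega> \<omega> lam (pair2 f' g') $ 1) x)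
             (\<lambda>x. c * (H_RWA_fun \<Omega> \<omega> lam (pair2 f g) $ 2) x + d * (H_RWA_fun \<Omega> \<omega> lam (pair2 f' g') $ 2) x)"
  using assms by (simp add: H_RWA_fun_pair2 pair2_eq_iff fun_eq_iff ann_lincomb cre_lincomb ann_schwartz cre_schwartz ring_distribs mult_ac)

lemma hip_comb3_right:
  assumes "f \<in> schwartz" "g \<in> schwartz" "h \<in> schwartz" "k \<in> schwartz"
  shows "hip f (\<lambda>x. a * g x + b * h x + c * k x) = a * hip f g + b * hip f h + c * hip f k"
  using assms by (simp add: hip_add_right hip_cmult_right schwartz_add schwartz_cmult)
lemma hip_comb3_left:
  assumes "f \<in> schwartz" "g \<in> schwartz" "h \<in> schwartz" "k \<in> schwartz"
  shows "hip (\<lambda>x. a * g x + b * h x + c * k x) f = cnj a * hip g f + cnj b * hip h f + cnj c * hip k f"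
  using assms by (simp add: hip_add_left hip_cmult_left schwartz_add schwartz_cmult)

lemma H_fun_symmetric:
  assumes "\<psi> \<in> schwartz2" "\<xi> \<in> schwartz2"
  shows "cip (to_l2 \<psi>) (to_l2 (H_fun \<Omega> \<omega> lam \<xi>)) = cip (to_l2 (H_fun \<Omega> \<omega> lam \<psi>)) (to_l2 \<xi>)"
proof -
  obtain f g f' g' where fg: "\<psi> = pair2 f g" "\<xi> = pair2 f' g'"
    and S: "f \<in> schwartz" "g \<in> schwartz" "f' \<in> schwartz" "g' \<in> schwartz"
    using schwartz2_cases assms by metis
  note S = S ann_schwartz cre_schwartz schwartz_add schwartz_comb3
  show ?thesis
    unfolding fg H_fun_pair2
    by (simp only: cip_to_l2_pair2 square_integrable_schwartz S hip_comb3_right hip_comb3_left)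
      (simp add: hip_add_right hip_add_left hip_ann hip_cre S algebra_simps)
qed

lemma H_RWA_fun_symmetric:
  assumes "\<psi> \<in> schwartz2" "\<xi> \<in> schwartz2"
  shows "cip (to_l2 \<psi>) (to_l2 (H_RWA_fun \<Omega> \<omega> lam \<xi>)) = cip (to_l2 (H_RWA_fun \<Omega> \<omega> lam \<psi>)) (to_l2 \<xi>)"
proof -
  obtain f g f' g' where fg: "\<psi> = pair2 f g" "\<xi> = pair2 f' g'"
    and S: "f \<in> schwartz" "g \<in> schwartz" "f' \<in> schwartz" "g' \<in> schwartz"
    using schwartz2_cases assms by metis
  note S = S ann_schwartz cre_schwartz schwartz_add schwartz_comb3
  show ?thesis
    unfolding fg H_RWA_fun_pair2
    by (simp only: cip_to_l2_pair2 square_integrable_schwartz S hip_comb3_right hip_comb3_left)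
      (simp add: hip_add_right hip_add_left hip_ann hip_cre S algebra_simps)
qed

section \<open>The rotating wave Hamiltonian\<close>

text \<open>For the larger eigenvalue \<open>E\<close> the vector \<open>(q, E - p)\<close> is an
  eigenvector. The rotated vector is the other one, and the trace gives its eigenvalue
  \<open>p + r - E\<close>. The case \<open>q = 0\<close> is separate because this vector may then
  vanish.\<close>

lemma symmetric_2x2_diagonalizable:
  fixes p q r :: real
  shows "\<exists>c s E1 E2. c\<^sup>2 + s\<^sup>2 = 1 \<and> p * c + q * s = E1 * c \<and> q * c + r * s = E1 * s
     \<and> p * (- s) + q * c = E2 * (- s) \<and> q * (- s) + r * c = E2 * c"
proof (cases "q = 0")
  case True
  then show ?thesis by (intro exI[of _ 1] exI[of _ 0] exI[of _ p] exI[of _ r]) simp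
next
  case False
  define D where "D = sqrt (((p - r) / 2)\<^sup>2 + q\<^sup>2)"
  define E where "E = (p + r) / 2 + D"
  define N where "N = sqrt (q\<^sup>2 + (E - p)\<^sup>2)"
  have "D\<^sup>2 = ((p - r) / 2)\<^sup>2 + q\<^sup>2" by (simp add: D_def)
  then have char: "q * q = (E - p) * (E - r)"
    by (simp add: E_def power2_eq_square field_simps)
  have "q\<^sup>2 + (E - p)\<^sup>2 > 0" using False by (simp add: add_pos_nonneg)
  then have N: "N > 0" "N * N = q\<^sup>2 + (E - p)\<^sup>2" by (simp_all add: N_def)
  have "(q / N)\<^sup>2 + ((E - p) / N)\<^sup>2 = 1"
  proof -
    have "(q / N)\<^sup>2 + ((E - p) / N)\<^sup>2 = (q\<^sup>2 + (E - p)\<^sup>2) / (N * N)"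
      by (simp add: power_divide power2_eq_square[of N] add_divide_distrib)
    then show ?thesis using N(1) by (simp flip: N(2))
  qed
  moreover have "p * (q / N) + q * ((E - p) / N) = E * (q / N)"
    using N by (simp add: field_simps)
  moreover have "q * (q / N) + r * ((E - p) / N) = E * ((E - p) / N)"
    using N char by (simp add: field_simps)
  moreover have "p * (- ((E - p) / N)) + q * (q / N) = (p + r - E) * (- ((E - p) / N))"
    using N arg_cong[OF char, of "(*) N"] by (simp add: field_simps)
  moreover have "q * (- ((E - p) / N)) + r * (q / N) = (p + r - E) * (q / N)"
    using N by (simp add: field_simps)
  ultimately show ?thesis by blast
qed

lemma nat_div2_parity_eqI: "k div 2 = l div 2 \<Longrightarrow> even k = even l \<Longrightarrow> k = (l::nat)"
  by (metis div_mult_mod_eq even_iff_mod_2_eq_zero not_mod_2_eq_1_eq_0)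

text \<open>The rotating wave coupling conserves the number of excitations: it links
  \<open>hermite m\<close> in the upper component only with \<open>hermite (Suc m)\<close> in the
  lower one. The vector with lower component \<open>hermite 0\<close> has no partner and is an
  eigenvector by itself.\<close>

lemma H_RWA_group:
  "\<exists>U. unitary_group_of (H_RWA \<Omega> \<omega> lam) U" "closure (fst ` H_RWA \<Omega> \<omega> lam) = UNIV"
proof -
  \<comment> \<open>\<open>p\<close>, \<open>q\<close> and \<open>r\<close> are the entries of the
    real symmetric matrix of the Hamiltonian on the block with number \<open>m\<close>.\<close>
  define p where "p m = \<Omega> / 2 + \<omega> * real m" for m
  define q where "q m = lam * sqrt (real (Suc m))" for m
  define r where "r m = - \<Omega> / 2 + \<omega> * real (Suc m)" for m
  have "\<forall>m. \<exists>c s E1 E2. c\<^sup>2 + s\<^sup>2 = 1 \<and> p m * c + q m * s = E1 * c \<and> q m * c + r m * s = E1 * s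
     \<and> p m * (- s) + q m * c = E2 * (- s) \<and> q m * (- s) + r m * c = E2 * c"
    using symmetric_2x2_diagonalizable by blast
  then obtain c s E1 E2 where cs: "\<And>m. (c m)\<^sup>2 + (s m)\<^sup>2 = 1"
    and ev: "\<And>m. p m * c m + q m * s m = E1 m * c m" "\<And>m. q m * c m + r m * s m = E1 m * s m"
     "\<And>m. p m * (- s m) + q m * c m = E2 m * (- s m)" "\<And>m. q m * (- s m) + r m * c m = E2 m * c m"
    by metis
  define \<alpha> where "\<alpha> m b = (if b then c m else - s m)" for m b
  define \<beta> where "\<beta> m b = (if b then s m else c m)" for m b
  define EE where "EE m b = (if b then E1 m else E2 m)" for m b
  have ev': "p m * \<alpha> m b + q m * \<beta> m b = EE m b * \<alpha> m b" "q m * \<alpha> m b + r m * \<beta> m b = EE m b * \<beta> m b" for m b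
    using ev[of m] by (auto simp: \<alpha>_def \<beta>_def EE_def)
  define \<eta> where "\<eta> m b = pair2 (\<lambda>x. of_real (\<alpha> m b) * hermite m x) (\<lambda>x. of_real (\<beta> m b) * hermite (Suc m) x)" for m b
  \<comment> \<open>Index 0 is the unpaired vector. For \<open>Suc k\<close> the block is
    \<open>k div 2\<close>, and the parity of \<open>k\<close> selects one of its two
    eigenvectors.\<close>
  define \<phi> where "\<phi> n = (case n of 0 \<Rightarrow> pair2 (\<lambda>x. 0) (hermite 0) | Suc k \<Rightarrow> \<eta> (k div 2) (even k))" for n
  define E where "E n = (case n of 0 \<Rightarrow> - \<Omega> / 2 | Suc k \<Rightarrow> EE (k div 2) (even k))" for n
  have z: "(\<lambda>x. 0) \<in> schwartz" using schwartz_cmult[OF hermite_schwartz[of 0], of 0] by simp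
  have \<eta>: "\<eta> m b \<in> schwartz2" for m b
    by (simp add: \<eta>_def schwartz_cmult del: hermite.simps)
  have \<phi>: "\<phi> n \<in> schwartz2" for n
    using z by (cases n) (simp_all add: \<phi>_def \<eta> del: hermite.simps)
  note sq = square_integrable_schwartz
  have hz: "hip f (\<lambda>x. 0) = 0" "hip (\<lambda>x. 0) f = 0" for f by (simp_all add: hip_def)
  have onb: "onb (\<lambda>n. to_l2 (\<phi> n))"
  proof
    have \<eta>\<eta>: "cip (to_l2 (\<eta> m b)) (to_l2 (\<eta> n b')) = (if m = n \<and> b = b' then 1 else 0)" for m b n b'
    proof -
      have 1: "cip (to_l2 (\<eta> m b)) (to_l2 (\<eta> n b')) = (if m = n then of_real (\<alpha> m b * \<alpha> m b' + \<beta> m b * \<beta> m b') else 0)"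
        unfolding \<eta>_def
        by (simp add: cip_to_l2_pair2 sq schwartz_cmult hip_cmult_left hip_cmult_right hermite_orthonormal del: hermite.simps)
      have 2: "\<alpha> m b * \<alpha> m b' + \<beta> m b * \<beta> m b' = (if b = b' then 1 else 0)"
        using cs[of m] by (auto simp: \<alpha>_def \<beta>_def power2_eq_square)
      show ?thesis unfolding 1 2 by simp
    qed
    have 0: "cip (to_l2 (pair2 (\<lambda>x. 0) (hermite 0))) (to_l2 (\<eta> n b')) = 0" for n b'
      unfolding \<eta>_def by (simp add: cip_to_l2_pair2 sq schwartz_cmult hip_cmult_right hermite_orthonormal z hz del: hermite.simps)
    have 00: "cip (to_l2 (pair2 (\<lambda>x. 0) (hermite 0))) (to_l2 (pair2 (\<lambda>x. 0) (hermite 0))) = 1"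
      by (simp add: cip_to_l2_pair2 sq z hz hermite_orthonormal del: hermite.simps)
    show "cip (to_l2 (\<phi> m)) (to_l2 (\<phi> n)) = (if m = n then 1 else 0)" for m n
    proof (cases m; cases n)
      fix k assume "m = Suc k" "n = 0"
      then show ?thesis using 0[of "k div 2" "even k"] by (subst cip_commute) (simp add: \<phi>_def del: hermite.simps)
    next
      fix k l assume "m = Suc k" "n = Suc l"
      then show ?thesis using nat_div2_parity_eqI[of k l] by (auto simp: \<phi>_def \<eta>\<eta> simp del: hermite.simps)
    qed (simp_all add: \<phi>_def 0 00 del: hermite.simps)
    fix u assume u: "\<And>n. cip (to_l2 (\<phi> n)) u = 0"
    obtain f g where fg: "square_integrable f" "square_integrable g" "u = to_l2 (pair2 f g)" using l22_cases .
    have g0: "hip (hermite 0) g = 0"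
      using u[of 0] by (simp add: \<phi>_def fg cip_to_l2_pair2 sq z hz del: hermite.simps)
    have ab: "of_real (\<alpha> m b) * hip (hermite m) f + of_real (\<beta> m b) * hip (hermite (Suc m)) g = 0" for m b
    proof -
      define k where "k = 2 * m + (if b then 0 else 1)"
      have "k div 2 = m" "even k = b" by (auto simp: k_def)
      then show ?thesis
        using u[of "Suc k"] by (simp add: \<phi>_def \<eta>_def fg cip_to_l2_pair2 sq schwartz_cmult hip_cmult_left del: hermite.simps)
    qed
    have fg0: "hip (hermite m) f = 0 \<and> hip (hermite (Suc m)) g = 0" for m
    proof -
      define X where "X = hip (hermite m) f"
      define Y where "Y = hip (hermite (Suc m)) g"
      have 1: "of_real (c m) * X + of_real (s m) * Y = 0" using ab[of m True] by (simp add: \<alpha>_def \<beta>_def X_def Y_def)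
      have 2: "- of_real (s m) * X + of_real (c m) * Y = 0" using ab[of m False] by (simp add: \<alpha>_def \<beta>_def X_def Y_def)
      \<comment> \<open>The equations \<open>1\<close> and \<open>2\<close> are a rotation applied
        to \<open>(X, Y)\<close>; multiplying by the transposed rotation isolates each
        unknown.\<close>
      have cs1: "complex_of_real (c m) * of_real (c m) + of_real (s m) * of_real (s m) = 1"
        using cs[of m] by (simp add: power2_eq_square flip: of_real_mult of_real_add)
      have "X = (complex_of_real (c m) * of_real (c m) + of_real (s m) * of_real (s m)) * X" by (simp add: cs1)
      also have "\<dots> = of_real (c m) * (of_real (c m) * X + of_real (s m) * Y) - of_real (s m) * (- of_real (s m) * X + of_real (c m) * Y)"
        by (simp add: algebra_simps)
      also have "\<dots> = 0" by (simp only: 1 2) simp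
      finally have "X = 0" .
      have "Y = (complex_of_real (c m) * of_real (c m) + of_real (s m) * of_real (s m)) * Y" by (simp add: cs1)
      also have "\<dots> = of_real (s m) * (of_real (c m) * X + of_real (s m) * Y) + of_real (c m) * (- of_real (s m) * X + of_real (c m) * Y)"
        by (simp add: algebra_simps)
      also have "\<dots> = 0" by (simp only: 1 2) simp
      finally have "Y = 0" .
      with \<open>X = 0\<close> show ?thesis by (simp add: X_def Y_def)
    qed
    have g0: "hip (hermite n) g = 0" for n
      by (cases n) (use g0 fg0 in auto)
    have "AE x in lborel. f x = 0" using hermite_total[OF fg(1)] fg0 by blast
    moreover have "AE x in lborel. g x = 0" using hermite_total[OF fg(2)] g0 by blast
    ultimately show "u = 0"
      using fg by (simp add: vec_eq_iff forall_2 zero_l2_def abs_l2_eq_iff square_integrable_zero)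
  qed
  have eig: "H_RWA_fun \<Omega> \<omega> lam (\<phi> n) = pair2 (\<lambda>x. of_real (E n) * (\<phi> n $ 1) x) (\<lambda>x. of_real (E n) * (\<phi> n $ 2) x)" for n
  proof (cases n)
    case 0
    have zero: "ann (\<lambda>x. 0) = (\<lambda>x. 0)" "cre (\<lambda>x. 0) = (\<lambda>x. 0)"
      using ann_cmult[OF z, of 0] cre_cmult[OF z, of 0] by simp_all
    with 0 show ?thesis
      by (simp add: \<phi>_def E_def H_RWA_fun_pair2 pair2_eq_iff zero ann_hermite_0 del: hermite.simps)
  next
    case (Suc k)
    define m where "m = k div 2"
    define b where "b = even k"
    have a: "ann (\<lambda>x. d * hermite (Suc m) x) = (\<lambda>x. d * (of_real (sqrt (real (Suc m))) * hermite m x))" for d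
      by (simp only: ann_cmult[OF hermite_schwartz] ann_hermite_Suc)
    have cr: "cre (\<lambda>x. d * hermite m x) = (\<lambda>x. d * (of_real (sqrt (real (Suc m))) * hermite (Suc m) x))" for d
      by (simp only: cre_cmult[OF hermite_schwartz] cre_hermite)
    have N: "cre (ann (\<lambda>x. d * hermite j x)) = (\<lambda>x. d * (of_nat j * hermite j x))" for d j
      by (simp only: ann_cmult[OF hermite_schwartz] cre_cmult[OF ann_schwartz[OF hermite_schwartz]] number_hermite)
    have 1: "of_real (\<Omega> / 2) * (of_real (\<alpha> m b) * h) + of_real \<omega> * (of_real (\<alpha> m b) * (of_nat m * h))
        + of_real lam * (of_real (\<beta> m b) * (of_real (sqrt (real (Suc m))) * h)) = of_real (EE m b) * (of_real (\<alpha> m b) * h)" for h :: complex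
    proof -
      have "of_real (p m * \<alpha> m b + q m * \<beta> m b) * h = of_real (EE m b * \<alpha> m b) * h" by (simp only: ev')
      then show ?thesis by (simp add: p_def q_def algebra_simps)
    qed
    have 2: "of_real (- \<Omega> / 2) * (of_real (\<beta> m b) * h) + of_real \<omega> * (of_real (\<beta> m b) * (of_nat (Suc m) * h))
        + of_real lam * (of_real (\<alpha> m b) * (of_real (sqrt (real (Suc m))) * h)) = of_real (EE m b) * (of_real (\<beta> m b) * h)" for h :: complex
    proof -
      have "of_real (q m * \<alpha> m b + r m * \<beta> m b) * h = of_real (EE m b * \<beta> m b) * h" by (simp only: ev')
      then show ?thesis by (simp add: r_def q_def algebra_simps)
    qed
    have "\<phi> n = \<eta> m b" "E n = EE m b" by (simp_all add: \<phi>_def E_def Suc m_def b_def)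
    then show ?thesis
      by (simp only: \<eta>_def H_RWA_fun_pair2 pair2_nth N) (simp only: a cr 1 2)
  qed
  note * = eigenbasis_generator[of \<phi> "H_RWA_fun \<Omega> \<omega> lam" E, OF onb \<phi> H_RWA_fun_schwartz2 H_RWA_fun_lin H_RWA_fun_symmetric eig]
  show "\<exists>U. unitary_group_of (H_RWA \<Omega> \<omega> lam) U" "closure (fst ` H_RWA \<Omega> \<omega> lam) = UNIV"
    unfolding H_RWA_def using * by blast+
qed

section \<open>The Rabi Hamiltonian\<close>

definition shift :: "real \<Rightarrow> (real \<Rightarrow> complex) \<Rightarrow> real \<Rightarrow> complex" where
  "shift a f x = f (x + a)"

lemma shift_has_vector_derivative:
  assumes "f \<in> schwartz"
  shows "(shift a f has_vector_derivative shift a (ddx f) x) (at x)"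
proof -
  have "((\<lambda>x. x + a) has_vector_derivative 1) (at x)" by (auto intro!: derivative_eq_intros)
  from vector_diff_chain_at[OF this schwartz_derivative[OF assms]] show ?thesis
    by (simp add: o_def shift_def[abs_def])
qed

lemma ddx_shift: "f \<in> schwartz \<Longrightarrow> ddx (shift a f) = shift a (ddx f)"
  by (intro ddx_eqI shift_has_vector_derivative)

lemma abs_power_shift_le: "\<bar>x\<bar> ^ k \<le> 2 ^ k * (\<bar>x + a\<bar> ^ k + \<bar>a\<bar> ^ k)" for x a :: real
proof -
  have "\<bar>x\<bar> \<le> \<bar>x + a\<bar> + \<bar>a\<bar>" by linarith
  then have "\<bar>x\<bar> ^ k \<le> (2 * max \<bar>x + a\<bar> \<bar>a\<bar>) ^ k" by (intro power_mono) (auto simp: max_def)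
  also have "\<dots> \<le> 2 ^ k * (\<bar>x + a\<bar> ^ k + \<bar>a\<bar> ^ k)"
    by (simp add: power_mult_distrib max_def)
  finally show ?thesis .
qed

lemma shift_schwartz:
  assumes "f \<in> schwartz"
  shows "shift a f \<in> schwartz"
proof (rule schwartz_coinduct[where S = "shift a ` schwartz"])
  show "\<exists>f'\<in>shift a ` schwartz. \<forall>x. (h has_vector_derivative f' x) (at x)" if "h \<in> shift a ` schwartz" for h
    using that shift_has_vector_derivative ddx_schwartz by blast
  fix h k assume "h \<in> shift a ` schwartz"
  then obtain f where h: "h = shift a f" and f: "f \<in> schwartz" by blast
  obtain K L where K: "\<And>x. norm (of_real (x ^ k) * f x) \<le> K" and L: "\<And>x. norm (of_real (x ^ 0) * f x) \<le> L"
    using schwartz_bounded[OF f] by meson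
  have "norm (of_real (x ^ k) * h x) \<le> 2 ^ k * (K + \<bar>a\<bar> ^ k * L)" for x
  proof -
    have "norm (of_real (x ^ k) * h x) = \<bar>x\<bar> ^ k * norm (f (x + a))"
      by (simp add: h shift_def norm_mult norm_power)
    also have "\<dots> \<le> 2 ^ k * (\<bar>x + a\<bar> ^ k + \<bar>a\<bar> ^ k) * norm (f (x + a))"
      by (intro mult_right_mono abs_power_shift_le) simp
    also have "\<dots> = 2 ^ k * (norm (of_real ((x + a) ^ k) * f (x + a)) + \<bar>a\<bar> ^ k * norm (of_real ((x + a) ^ 0) * f (x + a)))"
      by (simp add: norm_mult norm_power algebra_simps flip: of_real_add)
    also have "\<dots> \<le> 2 ^ k * (K + \<bar>a\<bar> ^ k * L)"
      by (intro mult_left_mono add_mono K L) auto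
    finally show ?thesis .
  qed
  then show "\<exists>K. \<forall>x. norm (of_real (x ^ k) * h x) \<le> K" by blast
qed (use assms in blast)

lemma hip_shift: "hip (shift a f) (shift a g) = hip f g"
  using lborel_integral_real_affine[of 1 "\<lambda>x. cnj (f x) * g x" a]
  by (simp add: hip_def shift_def add.commute)

lemma square_integrable_shift: "square_integrable f \<Longrightarrow> square_integrable (shift a f)"
  using lborel_integrable_real_affine[of "\<lambda>x. (norm (f x))\<^sup>2" 1 a]
  by (auto simp: square_integrable_def shift_def[abs_def] add.commute)

lemma shift_shift: "shift a (shift b f) = shift (a + b) f"
  by (simp add: shift_def fun_eq_iff add.assoc)

lemma AE_shift_zero:
  assumes f: "square_integrable f" and "AE x in lborel. shift a f x = 0"
  shows "AE x in lborel. f x = 0"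
proof -
  have "shift a f \<in> borel_measurable borel" using square_integrable_shift[OF f] by (simp add: square_integrable_def)
  then have "AE x in lborel. shift a f (- a + 1 * x) = 0"
    using assms(2) by (intro AE_borel_affine) measurable
  then show ?thesis by (simp add: shift_def)
qed

lemma ann_shift: "f \<in> schwartz \<Longrightarrow> ann (shift a f) = (\<lambda>x. 1 * shift a (ann f) x + (- of_real (a / sqrt 2)) * shift a f x)"
  by (simp add: ann_def ddx_shift fun_eq_iff) (simp add: shift_def field_simps)
lemma cre_shift: "f \<in> schwartz \<Longrightarrow> cre (shift a f) = (\<lambda>x. 1 * shift a (cre f) x + (- of_real (a / sqrt 2)) * shift a f x)"
  by (simp add: cre_def ddx_shift fun_eq_iff) (simp add: shift_def field_simps)

lemma ann_plus_cre: "ann f x + cre f x = of_real (sqrt 2) * (of_real x * f x)"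
proof -
  have "complex_of_real (1 / sqrt 2) * 2 = of_real (sqrt 2)"
    by (metis of_real_mult of_real_numeral real_div_sqrt times_divide_eq_left mult_1 zero_le_numeral)
  moreover have "ann f x + cre f x = of_real (1 / sqrt 2) * 2 * (of_real x * f x)"
    by (simp add: ann_def cre_def algebra_simps)
  ultimately show ?thesis by simp
qed

text \<open>Translation subtracts \<open>a / sqrt 2\<close> from both ladder operators. The
  resulting term linear in \<open>x\<close> is the one that a coupling proportional to position can
  cancel.\<close>

lemma number_shift_hermite:
  "cre (ann (shift a (hermite n))) x =
     (of_real (real n - a\<^sup>2 / 2) - of_real a * of_real x) * shift a (hermite n) x"
proof -
  define h where "h = hermite n"
  have h: "h \<in> schwartz" by (simp add: h_def del: hermite.simps)
  define r where "r = complex_of_real (a / sqrt 2)"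
  have r: "r * (of_real (sqrt 2) * z) = of_real a * z" "r * (r * z) = of_real (a\<^sup>2 / 2) * z" for z
  proof -
    have "r * of_real (sqrt 2) = of_real a" unfolding r_def of_real_mult[symmetric] by simp
    then show "r * (of_real (sqrt 2) * z) = of_real a * z" by (simp add: mult.assoc[symmetric])
    have "r * r = of_real (a\<^sup>2 / 2)" unfolding r_def of_real_mult[symmetric] by (simp add: power2_eq_square)
    then show "r * (r * z) = of_real (a\<^sup>2 / 2) * z" by (simp add: mult.assoc[symmetric])
  qed
  have "cre (ann (shift a h)) x = cre (shift a (ann h)) x - r * cre (shift a h) x"
    unfolding ann_shift[OF h] r_def[symmetric]
    by (subst cre_lincomb) (simp_all add: shift_schwartz ann_schwartz h)
  also have "\<dots> = shift a (cre (ann h)) x - r * (shift a (ann h) x + shift a (cre h) x) + r * (r * shift a h x)"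
    by (simp add: cre_shift ann_schwartz h r_def algebra_simps)
  also have "shift a (ann h) x + shift a (cre h) x = of_real (sqrt 2) * (of_real (x + a) * shift a h x)"
    by (simp add: shift_def ann_plus_cre)
  also have "shift a (cre (ann h)) x = of_nat n * shift a h x"
    by (simp add: shift_def h_def number_hermite del: hermite.simps)
  finally show ?thesis
    unfolding h_def[symmetric] r by (simp add: algebra_simps power2_eq_square)
qed

text \<open>Without spin splitting \<open>sigma_x\<close> is conserved. On each of its eigenspaces
  the coupling is \<plusminus> \<open>lam * sqrt 2 * x\<close>, and completing the square leaves a
  displaced oscillator lowered by \<open>lam\<^sup>2 / \<omega>\<close>.\<close>

lemma H_Rabi_group_0:
  assumes "\<omega> > 0"
  shows "\<exists>U. unitary_group_of (H_Rabi 0 \<omega> lam) U" "closure (fst ` H_Rabi 0 \<omega> lam) = UNIV"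
proof -
  \<comment> \<open>The displacement for which \<open>\<omega> * d = sqrt 2 * lam\<close>, so that
    the linear terms cancel; then \<open>\<omega> * d\<^sup>2 / 2\<close> is the energy
    shift.\<close>
  define d where "d = sqrt 2 * lam / \<omega>"
  \<comment> \<open>The parity of the index is the eigenvalue of \<open>sigma_x\<close>, and half of
    it is the oscillator level. The displacement changes sign with the spin, while the energy does
    not.\<close>
  define \<sigma> :: "nat \<Rightarrow> real" where "\<sigma> k = (if even k then 1 else -1)" for k
  have \<sigma>2: "\<sigma> k * \<sigma> k = 1" "(\<sigma> k)\<^sup>2 = 1" for k by (auto simp: \<sigma>_def)
  define r where "r = 1 / sqrt 2"
  have r2: "r * r = 1/2" by (simp add: r_def)
  define h where "h k = shift (\<sigma> k * d) (hermite (k div 2))" for k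
  have h: "h k \<in> schwartz" for k unfolding h_def by (intro shift_schwartz hermite_schwartz)
  define \<phi> where "\<phi> k = pair2 (\<lambda>x. of_real r * h k x) (\<lambda>x. of_real (r * \<sigma> k) * h k x)" for k
  define E where "E k = \<omega> * real (k div 2) - lam\<^sup>2 / \<omega>" for k
  note sq = square_integrable_schwartz
  have \<phi>: "\<phi> k \<in> schwartz2" for k
    by (simp add: \<phi>_def schwartz_cmult h)
  have onb: "onb (\<lambda>n. to_l2 (\<phi> n))"
  proof
    show "cip (to_l2 (\<phi> k)) (to_l2 (\<phi> l)) = (if k = l then 1 else 0)" for k l
    proof -
      have "cip (to_l2 (\<phi> k)) (to_l2 (\<phi> l)) = of_real (r * r * (1 + \<sigma> k * \<sigma> l)) * hip (h k) (h l)"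
        by (simp add: \<phi>_def cip_to_l2_pair2 sq schwartz_cmult h hip_cmult_left hip_cmult_right algebra_simps)
      also have "\<dots> = (if k = l then 1 else 0)"
      proof (cases "even k = even l")
        case True
        then have s: "\<sigma> k = \<sigma> l" by (simp add: \<sigma>_def)
        have "hip (h k) (h l) = (if k = l then 1 else 0)"
          unfolding h_def s hip_shift hermite_orthonormal using True by (metis div_mult_mod_eq even_iff_mod_2_eq_zero not_mod_2_eq_1_eq_0)
        then show ?thesis by (simp add: s \<sigma>2 r2)
      next
        case False
        then have "1 + \<sigma> k * \<sigma> l = 0" by (auto simp: \<sigma>_def)
        with False show ?thesis by auto
      qed
      finally show ?thesis .
    qed
    fix u assume u: "\<And>n. cip (to_l2 (\<phi> n)) u = 0"
    obtain f g where fg: "square_integrable f" "square_integrable g" "u = to_l2 (pair2 f g)" using l22_cases .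
    have i: "integrable lborel (\<lambda>x. cnj (h k x) * f x)" "integrable lborel (\<lambda>x. cnj (h k x) * g x)" for k
      using integrable_square_integrable_mult[OF square_integrable_cnj[OF sq[OF h]]] fg by blast+
    \<comment> \<open>The component of \<open>u\<close> along an eigenvector of
      \<open>sigma_x\<close> is translated back, where completeness of the undisplaced Hermite
      functions applies. Both signs together give \<open>f\<close> and \<open>g\<close>.\<close>
    have z: "AE x in lborel. f x + of_real s * g x = 0" if s: "s = 1 \<or> s = -1" for s :: real
    proof -
      have sqfg: "square_integrable (\<lambda>x. f x + of_real s * g x)"
        using fg by (intro square_integrable_add square_integrable_cmult)
      have "hip (hermite m) (shift (- (s * d)) (\<lambda>x. f x + of_real s * g x)) = 0" for m
      proof -
        define k where "k = 2 * m + (if s = 1 then 0 else 1)"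
        have k: "k div 2 = m" "\<sigma> k = s" using s by (auto simp: k_def \<sigma>_def)
        have "0 = of_real r * (hip (h k) f + of_real s * hip (h k) g)"
          using u[of k] by (simp add: \<phi>_def fg cip_to_l2_pair2 sq schwartz_cmult h hip_cmult_left k algebra_simps)
        also have "hip (h k) f + of_real s * hip (h k) g = hip (h k) (\<lambda>x. f x + of_real s * g x)"
          using i[of k] by (simp add: hip_def ring_distribs mult.left_commute[of _ "of_real s"])
        finally have "hip (h k) (\<lambda>x. f x + of_real s * g x) = 0" by (simp add: r_def)
        then have "hip (shift (- (s * d)) (h k)) (shift (- (s * d)) (\<lambda>x. f x + of_real s * g x)) = 0"
          by (simp only: hip_shift)
        moreover have "shift (- (s * d)) (h k) = hermite m"
          by (simp add: h_def k shift_shift) (simp add: shift_def[abs_def])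
        ultimately show ?thesis by simp
      qed
      then have "AE x in lborel. shift (- (s * d)) (\<lambda>x. f x + of_real s * g x) x = 0"
        by (intro hermite_total square_integrable_shift sqfg)
      then show ?thesis by (rule AE_shift_zero[OF sqfg])
    qed
    have "AE x in lborel. f x = 0 \<and> g x = 0"
      using z[of 1] z[of "-1"] by (auto elim!: eventually_elim2)
    then show "u = 0"
      using fg by (auto simp: vec_eq_iff forall_2 zero_l2_def abs_l2_eq_iff square_integrable_zero elim: eventually_mono)
  qed
  have eig: "H_fun 0 \<omega> lam (\<phi> k) = pair2 (\<lambda>x. of_real (E k) * (\<phi> k $ 1) x) (\<lambda>x. of_real (E k) * (\<phi> k $ 2) x)" for k
  proof -
    have N: "cre (ann (\<lambda>x. c * h k x)) = (\<lambda>x. c * ((of_real (real (k div 2) - (\<sigma> k * d)\<^sup>2 / 2) - of_real (\<sigma> k * d) * of_real x) * h k x))" for c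
      unfolding ann_cmult[OF h] cre_cmult[OF ann_schwartz[OF h]] by (simp add: h_def number_shift_hermite del: hermite.simps)
    have d1: "\<omega> * d = sqrt 2 * lam" and d2: "\<omega> * (d\<^sup>2 / 2) = lam\<^sup>2 / \<omega>"
      using assms by (simp_all add: d_def power2_eq_square field_simps)
    have key: "of_real \<omega> * (c * ((of_real (real (k div 2) - (\<sigma> k * d)\<^sup>2 / 2) - of_real (\<sigma> k * d) * of_real x) * z))
        + of_real lam * (of_real (sqrt 2) * (of_real x * (of_real (\<sigma> k) * c * z))) = of_real (E k) * (c * z)" for c z :: complex and x
    proof -
      have "\<omega> * (real (k div 2) - (\<sigma> k * d)\<^sup>2 / 2 - \<sigma> k * d * x) + lam * (sqrt 2 * (x * \<sigma> k)) = E k"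
        using d1 d2 by (simp add: E_def power_mult_distrib \<sigma>2 right_diff_distrib mult_ac)
      then have "of_real (E k) * (c * z) = of_real (\<omega> * (real (k div 2) - (\<sigma> k * d)\<^sup>2 / 2 - \<sigma> k * d * x) + lam * (sqrt 2 * (x * \<sigma> k))) * (c * z)"
        by simp
      then show ?thesis by (simp add: algebra_simps)
    qed
    have 2: "of_real (\<sigma> k) * complex_of_real (r * \<sigma> k) * z = of_real r * z" for z
    proof -
      have "complex_of_real (\<sigma> k) * of_real (r * \<sigma> k) = of_real r"
        unfolding of_real_mult[symmetric] by (simp add: \<sigma>2 mult.left_commute)
      then show ?thesis by simp
    qed
    show ?thesis
      unfolding \<phi>_def H_fun_pair2 pair2_eq_iff pair2_nth N ann_plus_cre fun_eq_iff
    proof (intro conjI allI)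
      fix x
      show "of_real (0 / 2) * (of_real r * h k x) + of_real \<omega> * (of_real r * ((of_real (real (k div 2) - (\<sigma> k * d)\<^sup>2 / 2) - of_real (\<sigma> k * d) * of_real x) * h k x))
        + of_real lam * (of_real (sqrt 2) * (of_real x * (of_real (r * \<sigma> k) * h k x))) = of_real (E k) * (of_real r * h k x)"
        using key[of "of_real r" x "h k x"] by (simp add: mult_ac)
      show "of_real (- 0 / 2) * (of_real (r * \<sigma> k) * h k x) + of_real \<omega> * (of_real (r * \<sigma> k) * ((of_real (real (k div 2) - (\<sigma> k * d)\<^sup>2 / 2) - of_real (\<sigma> k * d) * of_real x) * h k x))
        + of_real lam * (of_real (sqrt 2) * (of_real x * (of_real r * h k x))) = of_real (E k) * (of_real (r * \<sigma> k) * h k x)"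
        using key[of "of_real (r * \<sigma> k)" x "h k x", unfolded 2] by simp
    qed
  qed
  note * = eigenbasis_generator[of \<phi> "H_fun 0 \<omega> lam" E, OF onb \<phi> H_fun_schwartz2 H_fun_lin H_fun_symmetric eig]
  show "\<exists>U. unitary_group_of (H_Rabi 0 \<omega> lam) U" "closure (fst ` H_Rabi 0 \<omega> lam) = UNIV"
    unfolding H_Rabi_def using * by blast+
qed

section \<open>Restoring the spin splitting as a bounded perturbation\<close>

definition sigma_z_l22 :: "real \<Rightarrow> l2^2 \<Rightarrow> l2^2" where
  "sigma_z_l22 c u = (\<chi> i. (if i = 1 then c else - c) *\<^sub>R u $ i)"

lemma sigma_z_l22_nth: "sigma_z_l22 c u $ 1 = c *\<^sub>R u $ 1" "sigma_z_l22 c u $ 2 = - c *\<^sub>R u $ 2"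
  by (simp_all add: sigma_z_l22_def)

lemma bounded_linear_sigma_z_l22: "bounded_linear (sigma_z_l22 c)"
proof (rule bounded_linear_intro)
  show "sigma_z_l22 c (x + y) = sigma_z_l22 c x + sigma_z_l22 c y" for x y
    by (simp add: vec_eq_iff forall_2 sigma_z_l22_nth scaleR_add_right)
  show "sigma_z_l22 c (r *\<^sub>R x) = r *\<^sub>R sigma_z_l22 c x" for r x
    by (simp add: vec_eq_iff forall_2 sigma_z_l22_nth)
  show "norm (sigma_z_l22 c x) \<le> norm x * \<bar>c\<bar>" for x
  proof (rule power2_le_imp_le)
    show "(norm (sigma_z_l22 c x))\<^sup>2 \<le> (norm x * \<bar>c\<bar>)\<^sup>2"
      by (simp add: power2_norm_eq_inner power_mult_distrib inner_vec_def sum_2 sigma_z_l22_nth)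
        (simp add: power2_eq_square algebra_simps)
  qed simp
qed

lemma sigma_z_l22_to_l2:
  "square_integrable f \<Longrightarrow> square_integrable g \<Longrightarrow>
   sigma_z_l22 c (to_l2 (pair2 f g)) = to_l2 (pair2 (\<lambda>x. of_real c * f x) (\<lambda>x. of_real (- c) * g x))"
  by (simp only: vec_eq_iff forall_2 sigma_z_l22_nth to_l2_nth pair2_nth scaleC_l2_of_real[symmetric] abs_l2_scaleC simp_thms)

lemma schwartz_graph_H_fun:
  "schwartz_graph (H_fun \<Omega> \<omega> lam) = (\<lambda>(x, y). (x, y + sigma_z_l22 (\<Omega> / 2) x)) ` schwartz_graph (H_fun 0 \<omega> lam)"
proof -
  have "to_l2 (H_fun \<Omega> \<omega> lam \<psi>) = to_l2 (H_fun 0 \<omega> lam \<psi>) + sigma_z_l22 (\<Omega> / 2) (to_l2 \<psi>)" if \<psi>: "\<psi> \<in> schwartz2" for \<psi>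
  proof -
    obtain f g where fg: "\<psi> = pair2 f g" "f \<in> schwartz" "g \<in> schwartz" using schwartz2_cases[OF \<psi>] .
    obtain f' g' where H: "H_fun 0 \<omega> lam \<psi> = pair2 f' g'" "f' \<in> schwartz" "g' \<in> schwartz"
      using schwartz2_cases[OF H_fun_schwartz2[OF \<psi>]] .
    have "H_fun \<Omega> \<omega> lam \<psi> = pair2 (\<lambda>x. f' x + of_real (\<Omega> / 2) * f x) (\<lambda>x. g' x + of_real (- (\<Omega> / 2)) * g x)"
      using H(1) by (auto simp: fg(1) H_fun_pair2 pair2_eq_iff fun_eq_iff)
    then show ?thesis
      unfolding H(1)[unfolded fg(1)] fg(1) by (simp only: sigma_z_l22_to_l2 add_to_l2_pair2 square_integrable_schwartz schwartz_cmult fg H)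
  qed
  then show ?thesis unfolding schwartz_graph_def image_image by (intro image_cong) simp_all
qed

text \<open>Since the spin term is bounded, closing the full graph is the same as adding the term to
  the closure of the solvable graph. The domain, and hence its density, is inherited from the case
  without splitting.\<close>

lemma H_Rabi_group:
  assumes "\<omega> > 0"
  shows "\<exists>U. unitary_group_of (H_Rabi \<Omega> \<omega> lam) U" "closure (fst ` H_Rabi \<Omega> \<omega> lam) = UNIV"
proof -
  have eq: "H_Rabi \<Omega> \<omega> lam = (\<lambda>(x, y). (x, y + sigma_z_l22 (\<Omega> / 2) x)) ` H_Rabi 0 \<omega> lam"
    unfolding H_Rabi_def schwartz_graph_H_fun[of \<Omega>]
    by (intro closure_shear linear_continuous_on bounded_linear_sigma_z_l22)
  obtain U where "unitary_group_of (H_Rabi 0 \<omega> lam) U" using H_Rabi_group_0[OF assms] by blast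
  then interpret ugroup "H_Rabi 0 \<omega> lam" U by unfold_locales
  have "sigma_z_l22 c (scaleC_l22 z x) = scaleC_l22 z (sigma_z_l22 c x)" for c z x
    by (simp add: vec_eq_iff forall_2 sigma_z_l22_nth scaleC_l22_nth scaleC_l2_mult[symmetric] mult.commute
        flip: scaleC_l2_of_real of_real_minus)
  moreover have "x \<bullet> scaleC_l22 (- \<i>) (sigma_z_l22 c x) = 0" for c x
  proof -
    have *: "v \<bullet> scaleC_l2 (- \<i>) v = 0" for v
    proof -
      have "scaleC_l2 (- \<i>) v = - scaleC_l2 \<i> v"
        using scaleC_l2_mult[of "-1" \<i> v] scaleC_l2_of_real[of "-1"] by simp
      then have "v \<bullet> scaleC_l2 (- \<i>) v = - (v \<bullet> scaleC_l2 \<i> v)" by simp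
      with scaleC_l2_inner[of \<i> v v] show ?thesis by (simp add: inner_commute)
    qed
    have "scaleC_l2 (- \<i>) (c *\<^sub>R v) = c *\<^sub>R scaleC_l2 (- \<i>) v" for v c
      by (simp add: scaleC_l2_mult[symmetric] mult.commute flip: scaleC_l2_of_real)
    then show ?thesis
      by (simp add: inner_vec_def sum_2 sigma_z_l22_nth scaleC_l22_nth * del: scaleR_minus_left)
  qed
  ultimately show "\<exists>U. unitary_group_of (H_Rabi \<Omega> \<omega> lam) U"
    unfolding eq by (intro bounded_perturbation bounded_linear_sigma_z_l22)
  have "fst ` H_Rabi \<Omega> \<omega> lam = fst ` H_Rabi 0 \<omega> lam" unfolding eq by force
  then show "closure (fst ` H_Rabi \<Omega> \<omega> lam) = UNIV" using H_Rabi_group_0[OF assms] by simp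
qed

section \<open>Wave packets\<close>

definition wave :: "real \<Rightarrow> real \<Rightarrow> real \<Rightarrow> complex" where
  "wave a R = gauss 1 a (\<i> * of_real R)"

lemma wave_eq: "wave a R x = exp (- of_real a * (of_real x)\<^sup>2 + \<i> * of_real R * of_real x)"
  by (simp add: wave_def gauss_def)

lemma poly_wave_schwartz: "a > 0 \<Longrightarrow> (\<lambda>x. poly p (of_real x) * wave a R x) \<in> schwartz"
  using gauss_schwartz[of a p "\<i> * of_real R"] by (simp add: wave_def gauss_def[abs_def])

lemma ddx_poly_wave:
  "ddx (\<lambda>x. poly p (of_real x) * wave a R x)
   = (\<lambda>x. poly (pderiv p + p * [:\<i> * of_real R, - 2 * of_real a:]) (of_real x) * wave a R x)"
  using ddx_eqI[OF gauss_has_vector_derivative[of p a "\<i> * of_real R"]]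
  by (simp add: wave_def gauss_def[abs_def])

lemma ann_poly_wave:
  "ann (\<lambda>x. poly p (of_real x) * wave a R x) = (\<lambda>x. poly (smult (of_real (1 / sqrt 2))
     ([:0, 1:] * p + (pderiv p + p * [:\<i> * of_real R, - 2 * of_real a:]))) (of_real x) * wave a R x)"
  unfolding ann_def ddx_poly_wave by (simp add: fun_eq_iff algebra_simps)

lemma cre_poly_wave:
  "cre (\<lambda>x. poly p (of_real x) * wave a R x) = (\<lambda>x. poly (smult (of_real (1 / sqrt 2))
     ([:0, 1:] * p - (pderiv p + p * [:\<i> * of_real R, - 2 * of_real a:]))) (of_real x) * wave a R x)"
  unfolding cre_def ddx_poly_wave by (simp add: fun_eq_iff algebra_simps)

lemma ann_wave: "ann (\<lambda>x. c * wave a R x) = (\<lambda>x. c * (of_real (1 / sqrt 2) * (\<i> * of_real R + (1 - 2 * of_real a) * of_real x)) * wave a R x)"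
  using ann_poly_wave[of "[:c:]" a R] by (simp add: fun_eq_iff pderiv_pCons algebra_simps add_divide_distrib diff_divide_distrib)
lemma cre_wave: "cre (\<lambda>x. c * wave a R x) = (\<lambda>x. c * (of_real (1 / sqrt 2) * (- \<i> * of_real R + (1 + 2 * of_real a) * of_real x)) * wave a R x)"
  using cre_poly_wave[of "[:c:]" a R] by (simp add: fun_eq_iff pderiv_pCons algebra_simps add_divide_distrib diff_divide_distrib)

text \<open>Apart from \<open>R\<^sup>2 / 2\<close>, which becomes part of the approximate
  eigenvalue, only the cross term \<open>2 * \<i> * a * R * x\<close> grows with the boost.\<close>

lemma number_wave: "cre (ann (\<lambda>x. c * wave a R x)) = (\<lambda>x. c * ((of_real (R\<^sup>2) + (2 * of_real a - 1) + 4 * \<i> * of_real a * of_real R * of_real x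
     + (1 - 4 * (of_real a)\<^sup>2) * (of_real x)\<^sup>2) / 2) * wave a R x)"
proof -
  define r where "r = complex_of_real (1 / sqrt 2)"
  have r: "r * r = 1/2" by (simp add: r_def flip: of_real_mult)
  define p where "p = smult (r * c) [:\<i> * of_real R, 1 - 2 * of_real a:]"
  have 1: "ann (\<lambda>x. c * wave a R x) = (\<lambda>x. poly p (of_real x) * wave a R x)"
    unfolding ann_wave r_def[symmetric] p_def by (simp add: fun_eq_iff algebra_simps)
  show ?thesis
    unfolding 1 cre_poly_wave r_def[symmetric]
  proof
    fix x
    define y where "y = complex_of_real x"
    have "poly (smult r ([:0, 1:] * p - (pderiv p + p * [:\<i> * of_real R, - 2 * of_real a:]))) y
       = r * r * c * (of_real (R\<^sup>2) + (2 * of_real a - 1) + 4 * \<i> * of_real a * of_real R * y + (1 - 4 * (of_real a)\<^sup>2) * y\<^sup>2)"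
      by (simp add: p_def pderiv_smult pderiv_pCons algebra_simps power2_eq_square)
    from this[unfolded y_def r] show "poly (smult r ([:0, 1:] * p - (pderiv p + p * [:\<i> * of_real R, - 2 * of_real a:]))) (of_real x) * wave a R x
      = c * ((of_real (R\<^sup>2) + (2 * of_real a - 1) + 4 * \<i> * of_real a * of_real R * of_real x
     + (1 - 4 * (of_real a)\<^sup>2) * (of_real x)\<^sup>2) / 2) * wave a R x"
      by (simp only:) simp
  qed
qed

text \<open>Taken at \<open>R = 0\<close> because a boost only changes phases: these moments are
  constants once the width is fixed.\<close>

definition wave_norm :: "nat \<Rightarrow> real \<Rightarrow> real" where
  "wave_norm k a = norm (abs_l2 (\<lambda>x. of_real x ^ k * wave a 0 x))"

lemma power_wave_schwartz: "a > 0 \<Longrightarrow> (\<lambda>x. of_real x ^ k * wave a R x) \<in> schwartz"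
  using poly_wave_schwartz[of a "monom 1 k" R] by (simp add: poly_monom)

lemma wave_schwartz: "a > 0 \<Longrightarrow> wave a R \<in> schwartz"
  using power_wave_schwartz[of a 0 R] by simp

lemma norm_power_wave:
  assumes "a > 0"
  shows "norm (abs_l2 (\<lambda>x. of_real x ^ k * wave a R x)) = wave_norm k a"
proof -
  have "norm (wave a R x) = norm (wave a 0 x)" for x
    by (simp add: wave_eq flip: of_real_power)
  then show ?thesis
    using assms by (simp add: wave_norm_def norm_abs_l2 square_integrable_schwartz power_wave_schwartz norm_mult)
qed

lemma norm_quadratic_wave_le:
  assumes "a > 0"
  shows "norm (abs_l2 (\<lambda>x. (c0 + c1 * of_real x + c2 * (of_real x)\<^sup>2) * wave a R x))
    \<le> cmod c0 * wave_norm 0 a + cmod c1 * wave_norm 1 a + cmod c2 * wave_norm 2 a"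
proof -
  define w where "w k = (\<lambda>x. complex_of_real x ^ k * wave a R x)" for k
  have w: "square_integrable (w k)" for k
    unfolding w_def by (intro square_integrable_schwartz power_wave_schwartz assms)
  have n: "norm (abs_l2 (\<lambda>x. c * w k x)) = cmod c * wave_norm k a" for c k
  proof -
    have "norm (abs_l2 (\<lambda>x. c * w k x)) = cmod c * norm (abs_l2 (w k))"
      using w[of k] by (simp add: norm_abs_l2 square_integrable_cmult norm_mult power_mult_distrib real_sqrt_mult)
    then show ?thesis by (simp add: w_def norm_power_wave assms)
  qed
  have "abs_l2 (\<lambda>x. (c0 + c1 * of_real x + c2 * (of_real x)\<^sup>2) * wave a R x)
     = abs_l2 (\<lambda>x. c0 * w 0 x) + abs_l2 (\<lambda>x. c1 * w 1 x) + abs_l2 (\<lambda>x. c2 * w 2 x)"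
    using w by (simp add: abs_l2_plus square_integrable_add square_integrable_cmult)
      (simp add: w_def algebra_simps)
  then show ?thesis
    using norm_triangle_ineq[of "abs_l2 (\<lambda>x. c0 * w 0 x) + abs_l2 (\<lambda>x. c1 * w 1 x)" "abs_l2 (\<lambda>x. c2 * w 2 x)"]
      norm_triangle_ineq[of "abs_l2 (\<lambda>x. c0 * w 0 x)" "abs_l2 (\<lambda>x. c1 * w 1 x)"] by (simp add: n)
qed

lemma wave_norm_0_pos:
  assumes "a > 0"
  shows "wave_norm 0 a > 0"
proof -
  have "abs_l2 (wave a 0) \<noteq> 0"
  proof
    assume "abs_l2 (wave a 0) = 0"
    then have "AE x in lborel. wave a 0 x = 0"
      using assms by (simp add: zero_l2_def abs_l2_eq_iff square_integrable_schwartz wave_schwartz square_integrable_zero)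
    then have "AE x::real in lborel. False" by (simp add: wave_eq)
    then show False unfolding eventually_False ae_filter_eq_bot_iff by simp
  qed
  then show ?thesis by (simp add: wave_norm_def)
qed

text \<open>Integration by parts against \<open>ddx (wave a 0) = - 2 a x (wave a 0)\<close> gives the variance of the Gaussian.\<close>

lemma wave_norm_1:
  assumes "e > 0"
  shows "2 * e * wave_norm 1 (e\<^sup>2) = wave_norm 0 (e\<^sup>2)"
proof -
  define a where "a = e\<^sup>2"
  have a: "a > 0" using assms by (simp add: a_def)
  define f where "f = wave a 0"
  define g where "g x = of_real x * f x" for x
  have f: "f \<in> schwartz" unfolding f_def by (rule wave_schwartz[OF a])
  have g: "g \<in> schwartz" unfolding g_def by (rule schwartz_x[OF f])
  have df: "ddx f = (\<lambda>x. (- 2 * of_real a) * g x)"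
    using ddx_poly_wave[of 1 a 0] by (simp add: f_def g_def fun_eq_iff algebra_simps)
  have dg: "ddx g = (\<lambda>x. 1 * f x + (- 2 * of_real a) * (of_real x * g x))"
    using ddx_x[OF f] by (simp add: df g_def[abs_def] fun_eq_iff algebra_simps)
  have xg: "hip f (\<lambda>x. of_real x * g x) = hip g g"
    unfolding hip_def g_def by (intro Bochner_Integration.integral_cong) auto
  have "hip f (ddx g) = - hip (ddx f) g" by (rule hip_ddx[OF f g])
  then have "hip f f - 2 * of_real a * hip g g = 2 * of_real a * hip g g"
    unfolding dg df hip_lincomb_right[OF f f schwartz_x[OF g]] hip_cmult_left xg by simp
  then have "hip f f = of_real (4 * a) * hip g g" by (simp add: algebra_simps)
  then have "(norm (abs_l2 f))\<^sup>2 = 4 * a * (norm (abs_l2 g))\<^sup>2"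
    unfolding hip_self of_real_mult[symmetric] of_real_eq_iff
    using a by (simp add: norm_abs_l2 square_integrable_schwartz f g zero_le_mult_iff)
  then have "(wave_norm 0 a)\<^sup>2 = (2 * e * wave_norm 1 a)\<^sup>2"
    by (simp add: wave_norm_def f_def g_def[abs_def] a_def power_mult_distrib)
  moreover have "0 \<le> wave_norm 0 a" "0 \<le> 2 * e * wave_norm 1 a" using assms by (simp_all add: wave_norm_def)
  ultimately show ?thesis unfolding a_def by (metis power2_eq_imp_eq)
qed

lemma norm_l22_le: "norm (u :: l2^2) \<le> norm (u $ 1) + norm (u $ 2)"
  using L2_set_le_sum[of UNIV "\<lambda>i. norm (u $ i)"] by (simp add: norm_vec_def sum_2)

text \<open>\<open>onorm\<close> is a supremum of quotients, and it dominates a single quotient once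
  the operator is bounded, which unitarity provides.\<close>

lemma onorm_unitary_difference_ge:
  assumes "unitary V" "unitary W" "norm (V x - W x) \<ge> c * norm x" "x \<noteq> 0"
  shows "onorm (\<lambda>x. V x - W x) \<ge> c"
proof -
  have bl: "bounded_linear V" if "unitary V" for V
  proof (rule bounded_linear_intro[where K = 1])
    show "V (r *\<^sub>R x) = r *\<^sub>R V x" for r x
      using that unfolding unitary_def by (metis scaleC_l22_of_real)
  qed (use that in \<open>auto simp: unitary_def\<close>)
  have "c * norm x \<le> onorm (\<lambda>x. V x - W x) * norm x"
    using assms(3) onorm[OF bounded_linear_sub[OF bl[OF assms(1)] bl[OF assms(2)]], of x] by linarith
  then show ?thesis using assms(4) by simp
qed

lemma schwartz_graph_closure: "\<psi> \<in> schwartz2 \<Longrightarrow> (to_l2 \<psi>, to_l2 (A \<psi>)) \<in> closure (schwartz_graph A)"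
  using closure_subset[of "schwartz_graph A"] by (auto simp: schwartz_graph_def)

text \<open>\<open>(1, - \<i>)\<close> is the eigenvector of \<open>\<i> \<sigma>\<^sub>+ - \<i> \<sigma>\<^sub>-\<close> with eigenvalue one.\<close>

definition probe :: "real \<Rightarrow> real \<Rightarrow> (real \<Rightarrow> complex)^2" where
  "probe a R = pair2 (\<lambda>x. 1 * wave a R x) (\<lambda>x. - \<i> * wave a R x)"

lemma probe_schwartz2: "a > 0 \<Longrightarrow> probe a R \<in> schwartz2"
  unfolding probe_def pair2_schwartz2 by (intro conjI schwartz_cmult wave_schwartz)

lemma norm_probe_ge:
  assumes "a > 0"
  shows "norm (to_l2 (probe a R)) \<ge> wave_norm 0 a"
  using Finite_Cartesian_Product.norm_nth_le[of "to_l2 (probe a R)" 1] norm_power_wave[OF assms, of 0 R] by (simp add: probe_def)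

section \<open>Residuals of the packet under both Hamiltonians\<close>

definition residual_bound :: "real \<Rightarrow> real \<Rightarrow> real \<Rightarrow> real \<Rightarrow> real \<Rightarrow> real" where
  "residual_bound \<Omega> \<omega> lam a R =
     (\<Omega> / 2 + \<omega> / 2) * wave_norm 0 a + (2 * \<omega> * a * R + 2 * lam) * wave_norm 1 a + \<omega> / 2 * wave_norm 2 a"

text \<open>One shape covers both components under both Hamiltonians: \<open>u\<close> is the spin
  entry, \<open>s\<close> the sign from \<open>sigma_z\<close>, and \<open>k\<close> the part of the
  coupling that stays linear in \<open>x\<close>. The restriction on \<open>a\<close> keeps
  \<open>\<bar>2 * a - 1\<bar>\<close> and \<open>\<bar>1 - 4 * a\<^sup>2\<bar>\<close> at most
  one.\<close>

lemma residual_component_bound: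
  assumes "0 < a" "a \<le> 1/2" "\<Omega> > 0" "\<omega> > 0" "lam > 0" "R > 0"
    and u: "cmod u = 1" and s: "\<bar>s\<bar> = 1" and k: "cmod k \<le> 2 * lam"
    and h: "\<And>x. h x = (u * (of_real (s * \<Omega> / 2 + \<omega> * (2 * a - 1) / 2)) + (u * (2 * \<i> * of_real (\<omega> * a * R)) + k) * of_real x
       + u * of_real (\<omega> * (1 - 4 * a\<^sup>2) / 2) * (of_real x)\<^sup>2) * wave a R x"
  shows "norm (abs_l2 h) \<le> residual_bound \<Omega> \<omega> lam a R"
proof -
  have w: "wave_norm k a \<ge> 0" for k by (simp add: wave_norm_def)
  have a2: "4 * a\<^sup>2 \<le> 1" using assms(1,2) power_mono[of a "1/2" 2] by (simp add: power2_eq_square)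
  have "norm (abs_l2 h) \<le> cmod (u * (of_real (s * \<Omega> / 2 + \<omega> * (2 * a - 1) / 2))) * wave_norm 0 a
     + cmod (u * (2 * \<i> * of_real (\<omega> * a * R)) + k) * wave_norm 1 a + cmod (u * of_real (\<omega> * (1 - 4 * a\<^sup>2) / 2)) * wave_norm 2 a"
    unfolding ext[of h, OF h] by (rule norm_quadratic_wave_le[OF assms(1)])
  also have "\<dots> \<le> residual_bound \<Omega> \<omega> lam a R"
    unfolding residual_bound_def
  proof (intro add_mono mult_right_mono w)
    have "\<bar>s * \<Omega> / 2 + \<omega> * (2 * a - 1) / 2\<bar> \<le> \<bar>s * \<Omega> / 2\<bar> + \<bar>\<omega> * (2 * a - 1) / 2\<bar>" by (rule abs_triangle_ineq)
    also have "\<bar>s * \<Omega> / 2\<bar> = \<Omega> / 2" using s assms by (simp add: abs_mult)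
    also have "\<bar>\<omega> * (2 * a - 1) / 2\<bar> \<le> \<omega> / 2" using assms by (simp add: abs_mult)
    finally show "cmod (u * of_real (s * \<Omega> / 2 + \<omega> * (2 * a - 1) / 2)) \<le> \<Omega> / 2 + \<omega> / 2"
      unfolding norm_mult u norm_of_real by simp
    have "cmod (u * (2 * \<i> * of_real (\<omega> * a * R)) + k) \<le> cmod (u * (2 * \<i> * of_real (\<omega> * a * R))) + cmod k"
      by (rule norm_triangle_ineq)
    also have "cmod (u * (2 * \<i> * of_real (\<omega> * a * R))) = 2 * \<omega> * a * R"
      using assms by (simp add: norm_mult abs_mult)
    finally show "cmod (u * (2 * \<i> * of_real (\<omega> * a * R)) + k) \<le> 2 * \<omega> * a * R + 2 * lam" using k by simp
    have "\<bar>\<omega> * (1 - 4 * a\<^sup>2) / 2\<bar> \<le> \<omega> / 2" using assms a2 by (simp add: abs_mult)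
    then show "cmod (u * of_real (\<omega> * (1 - 4 * a\<^sup>2) / 2)) \<le> \<omega> / 2" 
      unfolding norm_mult u norm_of_real by simp
  qed
  finally show ?thesis .
qed

lemma sqrt2_bounds: "sqrt 2 \<le> 3/2" "1 \<le> sqrt 2"
  by (rule real_le_lsqrt) (auto simp: power2_eq_square)

lemma norm_to_l2_diff_le:
  assumes "f \<in> schwartz" "g \<in> schwartz" "f' \<in> schwartz" "g' \<in> schwartz"
    and "norm (abs_l2 (\<lambda>x. f' x - of_real c * f x)) \<le> B" "norm (abs_l2 (\<lambda>x. g' x - of_real c * g x)) \<le> B"
  shows "norm (to_l2 (pair2 f' g') - c *\<^sub>R to_l2 (pair2 f g)) \<le> 2 * B"
proof -
  have "c *\<^sub>R to_l2 (pair2 f g) = to_l2 (pair2 (\<lambda>x. of_real c * f x) (\<lambda>x. of_real c * g x))"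
    using assms(1,2) by (simp add: scaleC_to_l2_pair2 square_integrable_schwartz flip: scaleC_l22_of_real)
  then have eq: "to_l2 (pair2 f' g') - c *\<^sub>R to_l2 (pair2 f g)
     = to_l2 (pair2 (\<lambda>x. f' x - of_real c * f x) (\<lambda>x. g' x - of_real c * g x))"
    using assms(1-4) by (simp add: vec_eq_iff forall_2 abs_l2_minus square_integrable_schwartz schwartz_cmult)
  show ?thesis using norm_l22_le[of "to_l2 (pair2 f' g') - c *\<^sub>R to_l2 (pair2 f g)"] assms(5,6) 
    by (simp add: eq)
qed

text \<open>\<open>ann + cre\<close> is multiplication by \<open>sqrt 2 * x\<close>, which does not
  see the boost. The coupling thus enters only the residual, and the eigenvalue is that of the free
  oscillator, \<open>\<omega> * R\<^sup>2 / 2\<close>.\<close>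

lemma H_Rabi_residual:
  assumes "0 < a" "a \<le> 1/2" "\<Omega> > 0" "\<omega> > 0" "lam > 0" "R > 0"
  shows "norm (to_l2 (H_fun \<Omega> \<omega> lam (probe a R)) - (\<omega> * R\<^sup>2 / 2) *\<^sub>R to_l2 (probe a R))
     \<le> 2 * residual_bound \<Omega> \<omega> lam a R"
  unfolding probe_def H_fun_pair2
proof (rule norm_to_l2_diff_le)
  have k: "cmod (- \<i> * of_real (lam * sqrt 2)) \<le> 2 * lam" "cmod (of_real (lam * sqrt 2)) \<le> 2 * lam"
    using assms sqrt2_bounds by (simp_all add: norm_mult)
  show "norm (abs_l2 (\<lambda>x. of_real (\<Omega> / 2) * (1 * wave a R x) + of_real \<omega> * cre (ann (\<lambda>x. 1 * wave a R x)) x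
     + of_real lam * (ann (\<lambda>x. - \<i> * wave a R x) x + cre (\<lambda>x. - \<i> * wave a R x) x) - of_real (\<omega> * R\<^sup>2 / 2) * (1 * wave a R x)))
     \<le> residual_bound \<Omega> \<omega> lam a R"
    by (rule residual_component_bound[OF assms, of 1 1, OF _ _ k(1)], simp, simp)
      (simp only: number_wave ann_plus_cre, simp add: algebra_simps add_divide_distrib diff_divide_distrib)
  show "norm (abs_l2 (\<lambda>x. of_real (- \<Omega> / 2) * (- \<i> * wave a R x) + of_real \<omega> * cre (ann (\<lambda>x. - \<i> * wave a R x)) x
     + of_real lam * (ann (\<lambda>x. 1 * wave a R x) x + cre (\<lambda>x. 1 * wave a R x) x) - of_real (\<omega> * R\<^sup>2 / 2) * (- \<i> * wave a R x)))
     \<le> residual_bound \<Omega> \<omega> lam a R"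
    by (rule residual_component_bound[OF assms, of "- \<i>" "-1", OF _ _ k(2)], simp, simp)
      (simp only: number_wave ann_plus_cre, simp add: algebra_simps add_divide_distrib diff_divide_distrib)
qed (intro schwartz_comb3 schwartz_add schwartz_cmult ann_schwartz cre_schwartz wave_schwartz assms)+

text \<open>To leading order \<open>ann\<close> acts as \<open>\<i> * R / sqrt 2\<close> and
  \<open>cre\<close> as its conjugate. On the entries 1 and \<open>- \<i>\<close> the coupling then
  returns \<open>lam * R / sqrt 2\<close> times the same entries; the remaining coefficients of
  \<open>x\<close> are \<open>(1 - 2 * a) / sqrt 2\<close> and \<open>(1 + 2 * a) / sqrt 2\<close>,
  up to a factor of modulus \<open>lam\<close>.\<close>

lemma H_RWA_residual:
  assumes "0 < a" "a \<le> 1/2" "\<Omega> > 0" "\<omega> > 0" "lam > 0" "R > 0"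
  shows "norm (to_l2 (H_RWA_fun \<Omega> \<omega> lam (probe a R)) - (\<omega> * R\<^sup>2 / 2 + lam * R * (1 / sqrt 2)) *\<^sub>R to_l2 (probe a R))
     \<le> 2 * residual_bound \<Omega> \<omega> lam a R"
  unfolding probe_def H_RWA_fun_pair2
proof (rule norm_to_l2_diff_le)
  define r where "r = 1 / sqrt 2"
  have r: "0 \<le> r" "r \<le> 1" using sqrt2_bounds by (auto simp: r_def)
  have "\<bar>lam * r * (1 - 2 * a)\<bar> \<le> lam * 1 * 2" "\<bar>lam * r * (1 + 2 * a)\<bar> \<le> lam * 1 * 2"
    unfolding abs_mult using assms r by (intro mult_mono; simp)+
  then have k: "cmod (- \<i> * of_real (lam * r * (1 - 2 * a))) \<le> 2 * lam" "cmod (of_real (lam * r * (1 + 2 * a))) \<le> 2 * lam"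
    unfolding norm_mult norm_of_real by simp_all
  show "norm (abs_l2 (\<lambda>x. of_real (\<Omega> / 2) * (1 * wave a R x) + of_real \<omega> * cre (ann (\<lambda>x. 1 * wave a R x)) x
     + of_real lam * ann (\<lambda>x. - \<i> * wave a R x) x - of_real (\<omega> * R\<^sup>2 / 2 + lam * R * (1 / sqrt 2)) * (1 * wave a R x)))
     \<le> residual_bound \<Omega> \<omega> lam a R"
    by (rule residual_component_bound[OF assms, of 1 1, OF _ _ k(1)], simp, simp)
      (simp only: number_wave, simp only: ann_wave r_def[symmetric], simp add: algebra_simps add_divide_distrib diff_divide_distrib)
  show "norm (abs_l2 (\<lambda>x. of_real (- \<Omega> / 2) * (- \<i> * wave a R x) + of_real \<omega> * cre (ann (\<lambda>x. - \<i> * wave a R x)) x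
     + of_real lam * cre (\<lambda>x. 1 * wave a R x) x - of_real (\<omega> * R\<^sup>2 / 2 + lam * R * (1 / sqrt 2)) * (- \<i> * wave a R x)))
     \<le> residual_bound \<Omega> \<omega> lam a R"
    by (rule residual_component_bound[OF assms, of "- \<i>" "-1", OF _ _ k(2)], simp, simp)
      (simp only: number_wave, simp only: cre_wave r_def[symmetric], simp add: algebra_simps add_divide_distrib diff_divide_distrib)
qed (intro schwartz_comb3 schwartz_add schwartz_cmult ann_schwartz cre_schwartz wave_schwartz assms)+

theorem mainTheorem4:
  fixes lam \<Omega> \<omega> :: real
  assumes "lam > 0" and "\<Omega> > 0" and "\<omega> > 0"
  shows "\<exists>t. 0 \<le> t \<and> t \<le> pi / \<omega> \<and>
     onorm (\<lambda>\<psi>. exp_mi t (H_Rabi \<Omega> \<omega> lam) \<psi> - exp_mi t (H_RWA \<Omega> \<omega> lam) \<psi>) \<ge> 1 / 6"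
proof -
  obtain U where U: "unitary_group_of (H_Rabi \<Omega> \<omega> lam) U" using H_Rabi_group[OF assms(3)] by blast
  obtain V where V: "unitary_group_of (H_RWA \<Omega> \<omega> lam) V" using H_RWA_group by blast
  interpret U: ugroup "H_Rabi \<Omega> \<omega> lam" U by unfold_locales (rule U)
  interpret V: ugroup "H_RWA \<Omega> \<omega> lam" V by unfold_locales (rule V)
  \<comment> \<open>\<open>e\<close> is the square root of the Gaussian parameter \<open>a\<close>.
    The target is \<open>24 * B \<le> lam * R * X\<close>; the bound
    \<open>lam / (48 * \<omega>)\<close> makes the boosted cross term use at most half of it, for
    every \<open>R\<close>. The bound \<open>1/2\<close> ensures \<open>a \<le> 1/2\<close>.\<close>
  define e where "e = min (1/2) (lam / (48 * \<omega>))"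
  have e: "e > 0" "e \<le> 1/2" "48 * \<omega> * e \<le> lam" using assms by (auto simp: e_def min_def field_simps)
  define a where "a = e\<^sup>2"
  have a: "0 < a" "a \<le> 1/2" using e power_mono[of e "1/2" 2] by (auto simp: a_def power2_eq_square)
  define X where "X = wave_norm 0 a"
  \<comment> \<open>The part of the residual bound that does not depend on \<open>R\<close>.\<close>
  define C where "C = (\<Omega> / 2 + \<omega> / 2) * wave_norm 0 a + 2 * lam * wave_norm 1 a + \<omega> / 2 * wave_norm 2 a"
  have X: "X > 0" unfolding X_def by (rule wave_norm_0_pos[OF a(1)])
  have C: "C \<ge> 0" using assms by (simp add: C_def wave_norm_def)
  \<comment> \<open>The first summand lets \<open>C\<close> use at most the other half of the
    budget; the second forces the time to be at most \<open>pi / \<omega>\<close>.\<close>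
  define R where "R = 48 * C / (lam * X) + 2 * \<omega> / lam"
  have R: "R > 0" "48 * C \<le> lam * R * X" "2 * \<omega> \<le> lam * R"
  proof -
    have "0 \<le> 48 * C / (lam * X)" "0 < 2 * \<omega> / lam" using assms X C by simp_all
    then show "R > 0" unfolding R_def by linarith
    have "lam * R * X = 48 * C + 2 * \<omega> * X" using assms X by (simp add: R_def field_simps)
    then show "48 * C \<le> lam * R * X" using assms X by simp
    have "lam * R = 48 * C / X + 2 * \<omega>" using assms X by (simp add: R_def field_simps)
    then show "2 * \<omega> \<le> lam * R" using X C by simp
  qed
  \<comment> \<open>The eigenvalues differ by \<open>lam * R / sqrt 2\<close>, so at this time the
    phases differ by exactly \<open>pi\<close>.\<close>
  define t where "t = pi * sqrt 2 / (lam * R)"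
  have t: "0 < t" "t * (lam * R) = pi * sqrt 2" using assms R by (auto simp: t_def)
  have ps: "pi * sqrt 2 \<le> 6"
    using mult_mono[of pi 4 "sqrt 2" "3/2"] pi_less_4 sqrt2_bounds by simp
  have "\<omega> * sqrt 2 \<le> \<omega> * 2" using sqrt2_bounds assms by (intro mult_left_mono) simp_all
  with R(3) have "\<omega> * sqrt 2 \<le> lam * R" by linarith
  then have "pi * (\<omega> * sqrt 2) \<le> pi * (lam * R)" by (intro mult_left_mono) auto
  then have t_le: "t \<le> pi / \<omega>" using assms R by (simp add: t_def field_simps)
  define \<psi> where "\<psi> = to_l2 (probe a R)"
  have \<psi>: "norm \<psi> \<ge> X" unfolding \<psi>_def X_def by (rule norm_probe_ge[OF a(1)])
  define B where "B = residual_bound \<Omega> \<omega> lam a R"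
  \<comment> \<open>One of the two factors \<open>e\<close> in \<open>a\<close> is consumed by the
    spread of the packet through \<open>wave_norm_1\<close>; the other one makes the cross term
    small.\<close>
  have "2 * \<omega> * a * R * wave_norm 1 a = \<omega> * e * R * (2 * e * wave_norm 1 (e\<^sup>2))"
    by (simp add: a_def power2_eq_square)
  also have "\<dots> = \<omega> * e * R * X" unfolding wave_norm_1[OF e(1)] by (simp add: X_def a_def)
  finally have "B = C + \<omega> * e * R * X"
    by (simp add: B_def C_def residual_bound_def algebra_simps)
  moreover have "48 * (\<omega> * e * R * X) \<le> lam * R * X"
    using mult_right_mono[OF e(3), of "R * X"] R X by (simp add: mult_ac)
  ultimately have "24 * B \<le> lam * R * X" using R(2) by simp
  then have "t * (24 * B) \<le> t * (lam * R * X)" using t by (intro mult_left_mono) auto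
  also have "\<dots> = pi * sqrt 2 * X" using t(2) by (simp add: mult_ac)
  also have "\<dots> \<le> 6 * X" using ps X by (intro mult_right_mono) auto
  finally have tB: "4 * (t * B) \<le> X" by (simp add: mult.commute)
  define c where "c = \<omega> * R\<^sup>2 / 2"
  define c' where "c' = \<omega> * R\<^sup>2 / 2 + lam * R * (1 / sqrt 2)"
  have "norm (U t \<psi> - scaleC_l22 (cis (- c * t)) \<psi>) \<le> \<bar>t\<bar> * norm (to_l2 (H_fun \<Omega> \<omega> lam (probe a R)) - c *\<^sub>R \<psi>)"
    unfolding \<psi>_def by (rule U.approximate_eigenvector)
      (simp add: H_Rabi_def schwartz_graph_closure probe_schwartz2 a)
  also have "\<dots> \<le> t * (2 * B)"
    using H_Rabi_residual[OF a assms(2,3,1) R(1)] t by (auto simp: \<psi>_def c_def B_def intro!: mult_mono)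
  finally have 1: "norm (U t \<psi> - scaleC_l22 (cis (- c * t)) \<psi>) \<le> 2 * (t * B)" by simp
  have "norm (V t \<psi> - scaleC_l22 (cis (- c' * t)) \<psi>) \<le> \<bar>t\<bar> * norm (to_l2 (H_RWA_fun \<Omega> \<omega> lam (probe a R)) - c' *\<^sub>R \<psi>)"
    unfolding \<psi>_def by (rule V.approximate_eigenvector)
      (simp add: H_RWA_def schwartz_graph_closure probe_schwartz2 a)
  also have "\<dots> \<le> t * (2 * B)"
    using H_RWA_residual[OF a assms(2,3,1) R(1)] t by (auto simp: \<psi>_def c'_def B_def intro!: mult_mono)
  finally have 2: "norm (V t \<psi> - scaleC_l22 (cis (- c' * t)) \<psi>) \<le> 2 * (t * B)" by simp
  have "c' * t = c * t + (t * (lam * R)) * (1 / sqrt 2)" by (simp add: c_def c'_def algebra_simps)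
  also have "\<dots> = c * t + pi" unfolding t(2) by simp
  finally have "cis (- c' * t) = - cis (- c * t)"
    by (simp add: cis.ctr complex_eq_iff cos_add sin_add)
  then have "scaleC_l22 (cis (- c * t)) \<psi> - scaleC_l22 (cis (- c' * t)) \<psi> = 2 *\<^sub>R scaleC_l22 (cis (- c * t)) \<psi>"
    by (simp add: scaleC.minus_left scaleR_2)
  then have 3: "norm (scaleC_l22 (cis (- c * t)) \<psi> - scaleC_l22 (cis (- c' * t)) \<psi>) = 2 * norm \<psi>"
    by (simp add: norm_scaleC_l22)
  have "2 * norm \<psi> \<le> norm (U t \<psi> - V t \<psi>) + norm (U t \<psi> - scaleC_l22 (cis (- c * t)) \<psi>) + norm (V t \<psi> - scaleC_l22 (cis (- c' * t)) \<psi>)"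
    unfolding 3[symmetric] by norm
  \<comment> \<open>The two errors together are at most
    \<open>4 * (t * B) \<le> X \<le> norm \<psi>\<close>, so of the distance
    \<open>2 * norm \<psi>\<close> between the opposite vectors at least \<open>norm \<psi>\<close>
    survives, well above the required sixth.\<close>
  with 1 2 tB \<psi> X have "1 / 6 * norm \<psi> \<le> norm (U t \<psi> - V t \<psi>)" by linarith
  moreover have "\<psi> \<noteq> 0" using \<psi> X by auto
  ultimately have "onorm (\<lambda>\<psi>. U t \<psi> - V t \<psi>) \<ge> 1 / 6"
    using U V by (intro onorm_unitary_difference_ge) (auto simp: unitary_group_of_def)
  moreover have "exp_mi t (H_Rabi \<Omega> \<omega> lam) = U t" "exp_mi t (H_RWA \<Omega> \<omega> lam) = V t"
    using exp_mi_eq U V H_Rabi_group(2)[OF assms(3)] H_RWA_group(2) by blast+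
  ultimately show ?thesis using t t_le by (intro exI[of _ t]) simp
qed

end
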